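(* Let $d,t\in\mathbb N$ and let $F:C_0^{2^-\text{-var}}(\mathbb R^d)\to C_0^{2^-\text{-var}}(\mathbb R^t)$ be of the form $$X\mapsto\Lambda^*_{A_1(X)}Y_1\sqcup\Psi_1(X)\sqcup\Lambda^*_{A_2(X)}Y_2\sqcup\Psi_2(X)\sqcup\dots\sqcup\Psi_k(X)\sqcup\Lambda^*_{A_{k+1}(X)}Y_{k+1},$$ where $k\in\mathbb N_0$, $n_i\in\mathbb N$, $Y_i\in C_0^{2^-\text{-var}}(\mathbb R^{n_i})$, $A_i:C_0^{2^-\text{-var}}(\mathbb R^d)\to L(\mathbb R^t,\mathbb R^{n_i})$ is a regular map and $\Psi_i\in\Upsilon(d,t)$. Then $F$ is a regular map. Moreover, denoting by $\Gamma(d,t)$ the class of all functions of this form, for all $d,t,e\in\mathbb N$ one has $G\circ F\in\Gamma(d,e)$ whenever $F\in\Gamma(d,t)$ and $G\in\Gamma(t,e)$.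
   Context: $C_0^{2^-\text{-var}}(\mathbb R^d)$ is the set of all continuous $X:[0,T]\to\mathbb R^d$ with $X_0=0$, $T\in(0,\infty)$ depending on $X$, that have finite $p$-variation for some $p\in[1,2)$. $T(\mathbb R^d)$ is the tensor algebra, identified with the real vector space spanned by the words in the letters $1,\dots,d$, including the empty word $\mathsf e$; $T^{\ge1}(\mathbb R^d)$ is the span of nonempty words; $T((\mathbb R^d))$ is the linear dual of $T(\mathbb R^d)$. The signature $\sigma(X)\in T((\mathbb R^d))$ is given by $\langle\sigma(X),\mathsf e\rangle=1$ and $\langle\sigma(X),i_1\cdots i_n\rangle=\int_{0<t_1<\dots<t_n<T}dX^{[i_1]}_{t_1}\cdots dX^{[i_n]}_{t_n}$ (iterated Riemann–Stieltjes integrals), and $\sigma(X|_{[0,0]})=\mathsf e$. Concatenation of $X$ on $[0,T_1]$ and $Y$ on $[0,T_2]$: $(X\sqcup Y)_s=X_s$ for $s\in[0,T_1]$ and $Y_{s-T_1}+X_{T_1}-Y_0$ for $s\in(T_1,T_1+T_2]$. $\mathcal AX$ denotes the time reversal of $X:[0,T]\to\mathbb R^d$, translated to start in $0$: $(\mathcal AX)_s=X_{T-s}-X_T$. Identities between paths in this statement may be understood up to tree-like equivalence, equivalently up to equality of signatures. $L(U,U')$ is the space of linear maps $U\to U'$. The letters $1,\dots,t$ are identified with the standard basis of $\mathbb R^t$, and $\mathbb R^n$ with the span of the letters in $T(\mathbb R^n)$, so $L(\mathbb R^t,\mathbb R^n)\subseteq L(\mathbb R^t,T^{\ge1}(\mathbb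 R^n))$. For $B\in L(\mathbb R^t,T^{\ge1}(\mathbb R^n))$ and $X\in C_0^{2^-\text{-var}}(\mathbb R^n)$, $\Lambda_B^*X\in C_0^{2^-\text{-var}}(\mathbb R^t)$ is the path with components $(\Lambda_B^*X)^{[i]}_s=\langle\sigma(X|_{[0,s]}),B(i)\rangle$, $i=1,\dots,t$. A map $F:C_0^{2^-\text{-var}}(\mathbb R^d)\to C_0^{2^-\text{-var}}(\mathbb R^t)$ is a regular map if there is a homomorphism of shuffle algebras $H:T(\mathbb R^t)\to T(\mathbb R^d)$ (each with the shuffle product of words) such that $\langle\sigma(F(X)),x\rangle=\langle\sigma(X),Hx\rangle$ for all $x\in T(\mathbb R^t)$ and all $X$. A map $A:C_0^{2^-\text{-var}}(\mathbb R^d)\to\mathcal X$ into a vector space $\mathcal X$ is a regular map if $A(X)=\sum_{j=1}^r\langle\sigma(X),x_j\rangle v_j$ for some $r\in\mathbb N$, $x_j\in T(\mathbb R^d)$, $v_j\in\mathcal X$. $\Upsilon(d,t)$ is the class of all maps $C_0^{2^-\text{-var}}(\mathbb R^d)\to C_0^{2^-\text{-var}}(\mathbb R^t)$ of the form $$X\mapsto\mathcal A^{s_1}\Lambda^*_{B_k(X)}\mathcal A\Lambda^*_{B_{k-1}(X)}\cdots\mathcal A\Lambda^*_{B_2(X)}\mathcal A\Lambda^*_{B_1(X)}\mathcal A^{s_0}X,$$ with $k\in\mathbb N_0$, $s_0,s_1\in\{0,1\}$, $n_1,\dots,n_{k+1}\in\mathbb N$ with $n_1=d$, $n_{k+1}=t$,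 and regular maps $B_i:C_0^{2^-\text{-var}}(\mathbb R^d)\to L(\mathbb R^{n_{i+1}},T^{\ge1}(\mathbb R^{n_i}))$; $k=0$ (only if $d=t$) refers to the identity $X\mapsto X$ and to $X\mapsto\mathcal AX$. *)

theory Defs
  imports "HOL-Analysis.Analysis" "HOL-Library.Poly_Mapping"
begin

section \<open>The tensor algebra and the shuffle product\<close>

instantiation poly_mapping :: (type, real_vector) real_vector
begin

lift_definition scaleR_poly_mapping :: "real \<Rightarrow> ('a \<Rightarrow>\<^sub>0 'b) \<Rightarrow> 'a \<Rightarrow>\<^sub>0 'b"
  is "\<lambda>c f k. c *\<^sub>R f k"
  by (rule finite_subset) auto

instance
  by standard (transfer; auto simp: fun_eq_iff scaleR_add_right scaleR_add_left)+

end

text \<open>All spaces \<open>T(\<real>\<^sup>d)\<close> live inside the single real vector space with basis the words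
  in letters from \<open>nat\<close>; \<open>T(\<real>\<^sup>d)\<close> is the subspace spanned by the words in
  \<open>1, \<dots>, d\<close>.\<close>

type_synonym tensor = "nat list \<Rightarrow>\<^sub>0 real"

definition word :: "nat list \<Rightarrow> tensor"
  where "word w = Poly_Mapping.single w 1"

definition T_alg :: "nat \<Rightarrow> tensor set"
  where "T_alg d = span {word w |w. set w \<subseteq> {1..d}}"

definition T_ge1 :: "nat \<Rightarrow> tensor set"
  where "T_ge1 d = span {word w |w. set w \<subseteq> {1..d} \<and> w \<noteq> []}"

definition letters :: "nat \<Rightarrow> tensor set"
  where "letters d = span {word [i] |i. i \<in> {1..d}}"

definition lin_ext :: "(nat list \<Rightarrow> 'a::real_vector) \<Rightarrow> tensor \<Rightarrow> 'a"
  where "lin_ext g x = (\<Sum>w\<in>Poly_Mapping.keys x. Poly_Mapping.lookup x w *\<^sub>R g w)"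

fun shuffle_words :: "nat list \<Rightarrow> nat list \<Rightarrow> tensor" where
  "shuffle_words [] v = word v"
| "shuffle_words (a # u) [] = word (a # u)"
| "shuffle_words (a # u) (b # v) =
     lin_ext (\<lambda>w. word (a # w)) (shuffle_words u (b # v)) +
     lin_ext (\<lambda>w. word (b # w)) (shuffle_words (a # u) v)"

definition shuffle :: "tensor \<Rightarrow> tensor \<Rightarrow> tensor"
  where "shuffle x y = lin_ext (\<lambda>u. lin_ext (\<lambda>v. shuffle_words u v) y) x"

text \<open>A linear map between subspaces is represented by any of its linear extensions to the
  ambient space (one always exists); two elements of \<open>lin_maps U U'\<close> represent the same map iff
  they agree on \<open>U\<close>. In particular \<open>lin_maps (letters t) (letters n)\<close> is contained in
  \<open>lin_maps (letters t) (T_ge1 n)\<close>.\<close>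

definition lin_maps :: "tensor set \<Rightarrow> tensor set \<Rightarrow> (tensor \<Rightarrow> tensor) set"
  where "lin_maps U U' = {f. linear f \<and> f ` U \<subseteq> U'}"

definition shuffle_hom :: "nat \<Rightarrow> nat \<Rightarrow> (tensor \<Rightarrow> tensor) \<Rightarrow> bool"
  where "shuffle_hom t d H \<longleftrightarrow>
    H \<in> lin_maps (T_alg t) (T_alg d) \<and>
    H (word []) = word [] \<and>
    (\<forall>x\<in>T_alg t. \<forall>y\<in>T_alg t. H (shuffle x y) = shuffle (H x) (H y))"


section \<open>Paths\<close>

text \<open>A path \<open>[0,T] \<rightarrow> \<real>\<^sup>d\<close> is given by \<open>T\<close> and a function of time and component index. To make
  equality of paths literal equality, this function is required to be \<open>0\<close> outside of
  \<open>[0,T] \<times> {1..d}\<close>.\<close>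

datatype path = Path (dur: real) (pos: "real \<Rightarrow> nat \<Rightarrow> real")

definition mk_path :: "real \<Rightarrow> (real \<Rightarrow> nat \<Rightarrow> real) \<Rightarrow> path"
  where "mk_path T f = Path T (\<lambda>s i. if s \<in> {0..T} then f s i else 0)"

definition finite_pvar :: "nat \<Rightarrow> real \<Rightarrow> path \<Rightarrow> bool"
  where "finite_pvar d p X \<longleftrightarrow>
    (\<exists>C. \<forall>n. \<forall>u::nat \<Rightarrow> real. mono_on {0..n} u \<and> u ` {0..n} \<subseteq> {0..dur X} \<longrightarrow>
       (\<Sum>k<n. L2_set (\<lambda>i. pos X (u (Suc k)) i - pos X (u k) i) {1..d} powr p) \<le> C)"

definition paths :: "nat \<Rightarrow> path set"
  where "paths d = {X. dur X > 0
    \<and> (\<forall>s i. s \<notin> {0..dur X} \<or> i \<notin> {1..d} \<longrightarrow> pos X s i = 0)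
    \<and> (\<forall>i. pos X 0 i = 0)
    \<and> (\<forall>i. continuous_on {0..dur X} (\<lambda>s. pos X s i))
    \<and> (\<exists>p. 1 \<le> p \<and> p < 2 \<and> finite_pvar d p X)}"

definition concat_path :: "path \<Rightarrow> path \<Rightarrow> path" (infixl \<open>\<squnion>\<^sub>p\<close> 65)
  where "X \<squnion>\<^sub>p Y = mk_path (dur X + dur Y) (\<lambda>s i.
    if s \<le> dur X then pos X s i
    else pos Y (s - dur X) i + pos X (dur X) i - pos Y 0 i)"

definition reversal :: "path \<Rightarrow> path"
  where "reversal X = mk_path (dur X) (\<lambda>s i. pos X (dur X - s) i - pos X (dur X) i)"

definition restrict_path :: "path \<Rightarrow> real \<Rightarrow> path"
  where "restrict_path X s = mk_path s (pos X)"


section \<open>Iterated Riemann--Stieltjes integrals and the signature\<close>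

definition has_RS_integral ::
    "(real \<Rightarrow> real) \<Rightarrow> (real \<Rightarrow> real) \<Rightarrow> real \<Rightarrow> real \<Rightarrow> real \<Rightarrow> bool"
  where "has_RS_integral f g a b I \<longleftrightarrow>
    (\<forall>\<epsilon>>0. \<exists>\<delta>>0. \<forall>(n::nat) (u::nat \<Rightarrow> real) (\<xi>::nat \<Rightarrow> real).
       u 0 = a \<and> u n = b \<and>
       (\<forall>k<n. u k \<le> \<xi> k \<and> \<xi> k \<le> u (Suc k) \<and> u (Suc k) - u k < \<delta>) \<longrightarrow>
       \<bar>(\<Sum>k<n. f (\<xi> k) * (g (u (Suc k)) - g (u k))) - I\<bar> < \<epsilon>)"

definition RS_integral :: "(real \<Rightarrow> real) \<Rightarrow> (real \<Rightarrow> real) \<Rightarrow> real \<Rightarrow> real \<Rightarrow> real"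
  where "RS_integral f g a b = (THE I. has_RS_integral f g a b I)"

text \<open>The word is read from its last letter, which belongs to the outermost integral: for
  \<open>w = i\<^sub>1 \<dots> i\<^sub>n\<close> the value of \<open>iter_int X (rev w) s\<close> is the integral over
  \<open>0 < t\<^sub>1 < \<dots> < t\<^sub>n < s\<close>.\<close>

primrec iter_int :: "path \<Rightarrow> nat list \<Rightarrow> real \<Rightarrow> real" where
  "iter_int X [] = (\<lambda>s. 1)"
| "iter_int X (i # w) = (\<lambda>s. RS_integral (iter_int X w) (\<lambda>r. pos X r i) 0 s)"

text \<open>\<open>sig X x\<close> is the pairing of the signature of \<open>X\<close> with \<open>x\<close>. For the degenerate path on
  \<open>[0,0]\<close> all iterated integrals over nonempty words vanish, i.e. the signature is the empty
  word.\<close>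

definition sig :: "path \<Rightarrow> tensor \<Rightarrow> real"
  where "sig X = lin_ext (\<lambda>w. iter_int X (rev w) (dur X))"

definition Lambda :: "nat \<Rightarrow> (tensor \<Rightarrow> tensor) \<Rightarrow> path \<Rightarrow> path"
  where "Lambda t B X = mk_path (dur X) (\<lambda>s i.
    if i \<in> {1..t} then sig (restrict_path X s) (B (word [i])) else 0)"


section \<open>Regular maps and the classes Upsilon and Gamma\<close>

definition regular_path_map :: "nat \<Rightarrow> nat \<Rightarrow> (path \<Rightarrow> path) \<Rightarrow> bool"
  where "regular_path_map d t F \<longleftrightarrow>
    F \<in> paths d \<rightarrow> paths t \<and>
    (\<exists>H. shuffle_hom t d H \<and> (\<forall>x\<in>T_alg t. \<forall>X\<in>paths d. sig (F X) x = sig X (H x)))"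

text \<open>Regular maps with values in the vector space of linear maps \<open>U \<rightarrow> U'\<close>.\<close>

definition regular_lin_map ::
    "nat \<Rightarrow> tensor set \<Rightarrow> tensor set \<Rightarrow> (path \<Rightarrow> tensor \<Rightarrow> tensor) \<Rightarrow> bool"
  where "regular_lin_map d U U' A \<longleftrightarrow>
    (\<forall>X\<in>paths d. A X \<in> lin_maps U U') \<and>
    (\<exists>(r::nat) x v. r \<ge> 1 \<and>
      (\<forall>j\<in>{1..r}. x j \<in> T_alg d \<and> v j \<in> lin_maps U U') \<and>
      (\<forall>X\<in>paths d. \<forall>u\<in>U. A X u = (\<Sum>j=1..r. sig X (x j) *\<^sub>R v j u)))"

text \<open>The path \<open>\<Lambda>\<^sub>B\<^sub>j \<A> \<dots> \<A> \<Lambda>\<^sub>B\<^sub>1 Z\<close>, where \<open>B\<^sub>j\<close> is a map \<open>\<real>\<^bsup>n(j+1)\<^esup> \<rightarrow> T(\<real>\<^bsup>n(j)\<^esup>)\<close>; there is no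
  reversal before the first \<open>\<Lambda>\<close>.\<close>

fun Lambda_chain :: "(nat \<Rightarrow> nat) \<Rightarrow> (nat \<Rightarrow> tensor \<Rightarrow> tensor) \<Rightarrow> path \<Rightarrow> nat \<Rightarrow> path" where
  "Lambda_chain n B Z 0 = Z"
| "Lambda_chain n B Z (Suc 0) = Lambda (n 2) (B 1) Z"
| "Lambda_chain n B Z (Suc (Suc j)) =
     Lambda (n (j + 3)) (B (j + 2)) (reversal (Lambda_chain n B Z (Suc j)))"

text \<open>For \<open>k = 0\<close> the conditions force \<open>d = t\<close>, and since \<open>reversal\<close> is an involution on
  \<open>paths d\<close> they describe exactly the identity and the time reversal.\<close>

definition Upsilon_maps :: "nat \<Rightarrow> nat \<Rightarrow> (path \<Rightarrow> path) set"
  where "Upsilon_maps d t = {\<Psi>. \<Psi> \<in> paths d \<rightarrow> paths t \<and>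
    (\<exists>(k::nat) n B (s0::nat) (s1::nat).
      s0 \<in> {0, 1} \<and> s1 \<in> {0, 1} \<and>
      (\<forall>i\<in>{1..k+1}. n i \<ge> 1) \<and> n 1 = d \<and> n (k + 1) = t \<and>
      (\<forall>i\<in>{1..k}. regular_lin_map d (letters (n (i + 1))) (T_ge1 (n i)) (B i)) \<and>
      (\<forall>X\<in>paths d. \<Psi> X =
         (reversal ^^ s1) (Lambda_chain n (\<lambda>i. B i X) ((reversal ^^ s0) X) k)))}"

primrec Gamma_concat ::
    "nat \<Rightarrow> (nat \<Rightarrow> path \<Rightarrow> tensor \<Rightarrow> tensor) \<Rightarrow> (nat \<Rightarrow> path) \<Rightarrow> (nat \<Rightarrow> path \<Rightarrow> path) \<Rightarrow> path \<Rightarrow> nat \<Rightarrow> path"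
where
  "Gamma_concat t A Y \<Psi> X 0 = Lambda t (A 1 X) (Y 1)"
| "Gamma_concat t A Y \<Psi> X (Suc k) =
     Gamma_concat t A Y \<Psi> X k \<squnion>\<^sub>p \<Psi> (k + 1) X \<squnion>\<^sub>p Lambda t (A (k + 2) X) (Y (k + 2))"

definition Gamma_maps :: "nat \<Rightarrow> nat \<Rightarrow> (path \<Rightarrow> path) set"
  where "Gamma_maps d t = {F. F \<in> paths d \<rightarrow> paths t \<and>
    (\<exists>(k::nat) n Y A \<Psi>.
      (\<forall>i\<in>{1..k+1}. n i \<ge> 1 \<and> Y i \<in> paths (n i) \<and>
         regular_lin_map d (letters t) (letters (n i)) (A i)) \<and>
      (\<forall>i\<in>{1..k}. \<Psi> i \<in> Upsilon_maps d t) \<and>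
      (\<forall>X\<in>paths d. F X = Gamma_concat t A Y \<Psi> X k))}"

end

theory Submission
  imports Defs
begin

text \<open>A component of a path of finite \<open>p\<close>-variation satisfies \<open>\<bar>f t - f s\<bar> \<le> C (v t - v s) powr \<alpha>\<close>
  with \<open>v\<close> monotone and \<open>\<alpha> = 1 / p > 1 / 2\<close>, and Young's integration theory for such functions
  makes \<open>dJ = f dg\<close> a calculus with a product rule and a chain rule. It yields the shuffle
  identity, Chen's identity, the signature of a reversed path, and the signature of \<open>\<Lambda>\<^sup>*\<^sub>B X\<close> through
  half-shuffles. Hence the coordinates of the signature of \<open>F X\<close> are themselves coordinates
  \<open>sig X x\<close>; since signatures separate the tensor algebra, \<open>x\<close> is unique and depends on the
  word as a shuffle homomorphism.

  For the composition, reversal turns a concatenation around and \<open>\<Lambda>\<^sup>*\<^sub>B\<close> maps \<open>X \<squnion> Y\<close> to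
  \<open>\<Lambda>\<^sup>*\<^sub>B X \<squnion> \<Lambda>\<^sup>*\<^sub>C Y\<close>, where \<open>C\<close> depends on \<open>B\<close> and on the signature of \<open>X\<close>. So a map in
  \<open>\<Upsilon>\<close> acts blockwise on an element of \<open>\<Gamma>\<close>; products of two \<open>\<Lambda>\<close> and adjacent blocks coming
  from fixed paths are merged.\<close>

section \<open>Riemann--Stieltjes sums\<close>

text \<open>Regularity above 1/2 makes the product of two increments an error of higher order, so no
  bracket term survives in the product rule and the shuffle product alone governs products of
  coordinates. The control is only known to be monotone; hence continuity is carried along
  separately in the function space \<open>H\<close>.

  Two facts make \<Gamma> stable under composition. An iterated integral over a concatenation splits
  by Chen's identity into numbers, the coordinates of the preceding blocks, and words read on the
  later block. These numbers vary with \<open>X\<close>, which is why the maps \<open>B\<close> must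
  be allowed to depend regularly on \<open>X\<close>. For a block built on a fixed path, coordinates
  of arbitrary words can be made the letters of a new fixed path, which is why letters suffice
  there.

  Multiplicativity is not tracked along the way: only regularity of each word coordinate is
  propagated through the operations on paths. All path identities are literal, because
  \<open>paths d\<close> normalises the values outside the domain.\<close>

definition tagged_seq ::
    "real \<Rightarrow> real \<Rightarrow> real \<Rightarrow> nat \<times> (nat \<Rightarrow> real) \<times> (nat \<Rightarrow> real) \<Rightarrow> bool"
  where "tagged_seq \<delta> a b = (\<lambda>(n, u, \<xi>). u 0 = a \<and> u n = b \<and>
     (\<forall>k<n. u k \<le> \<xi> k \<and> \<xi> k \<le> u (Suc k) \<and> u (Suc k) - u k < \<delta>))"

definition RS_sum ::
    "(real \<Rightarrow> real) \<Rightarrow> (real \<Rightarrow> real) \<Rightarrow> nat \<times> (nat \<Rightarrow> real) \<times> (nat \<Rightarrow> real) \<Rightarrow> real"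
  where "RS_sum f g = (\<lambda>(n, u, \<xi>). \<Sum>k<n. f (\<xi> k) * (g (u (Suc k)) - g (u k)))"

text \<open>Tagged partitions directed by their mesh: along this filter
  \<open>has_RS_integral\<close> is a limit, so uniqueness and linearity come from the general
  theory of limits.\<close>

definition RS_filter :: "real \<Rightarrow> real \<Rightarrow> (nat \<times> (nat \<Rightarrow> real) \<times> (nat \<Rightarrow> real)) filter"
  where "RS_filter a b = (INF \<delta>\<in>{0<..}. principal {P. tagged_seq \<delta> a b P})"

lemma tagged_seq_mesh_mono: "tagged_seq \<delta> a b P \<Longrightarrow> \<delta> \<le> \<delta>' \<Longrightarrow> tagged_seq \<delta>' a b P"
  unfolding tagged_seq_def by force

lemma eventually_RS_filter:
  "eventually Q (RS_filter a b) \<longleftrightarrow> (\<exists>\<delta>>0. \<forall>P. tagged_seq \<delta> a b P \<longrightarrow> Q P)"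
proof -
  have "eventually Q (RS_filter a b) \<longleftrightarrow>
      (\<exists>\<delta>\<in>{0<..}. eventually Q (principal {P. tagged_seq \<delta> a b P}))"
    unfolding RS_filter_def
  proof (rule eventually_INF_base)
    fix x y :: real assume "x \<in> {0<..}" "y \<in> {0<..}"
    then show "\<exists>z\<in>{0<..}. principal {P. tagged_seq z a b P} \<le>
        inf (principal {P. tagged_seq x a b P}) (principal {P. tagged_seq y a b P})"
      by (intro bexI[of _ "min x y"]) (auto intro: tagged_seq_mesh_mono)
  qed auto
  then show ?thesis by (auto simp: eventually_principal)
qed

lemma has_RS_integral_iff_tendsto:
  "has_RS_integral f g a b I \<longleftrightarrow> (RS_sum f g \<longlongrightarrow> I) (RS_filter a b)"
  unfolding has_RS_integral_def tendsto_iff eventually_RS_filter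
  by (simp add: tagged_seq_def RS_sum_def dist_real_def)

lemma ex_fine_seq:
  assumes "a \<le> (b::real)" "\<delta> > 0"
  obtains n u where "\<And>i. u i \<le> u (Suc i)" "u 0 = a" "u n = b" "\<And>i. u (Suc i) - u i < \<delta>"
proof -
  obtain n :: nat where n: "real n > (b - a) / \<delta>" using reals_Archimedean2 by blast
  then have "n > 0" using assms by (metis diff_ge_0_iff_ge divide_nonneg_pos gr0I less_irrefl of_nat_0 order.strict_trans1)
  define u where "u i = a + (b - a) * real i / real n" for i
  show thesis
  proof (rule that[of u n])
    have d: "u (Suc i) - u i = (b - a) / n" for i
      using \<open>n > 0\<close> by (simp add: u_def field_simps)
    show "u i \<le> u (Suc i)" for i using d[of i] assms \<open>n > 0\<close>
      by (smt (verit) divide_nonneg_nonneg of_nat_0_le_iff)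
    show "u (Suc i) - u i < \<delta>" for i
      unfolding d using n \<open>n > 0\<close> assms by (simp add: field_simps)
  qed (use \<open>n > 0\<close> in \<open>auto simp: u_def\<close>)
qed

lemma ex_tagged_seq:
  assumes "a \<le> b" "\<delta> > 0"
  obtains n u where "tagged_seq \<delta> a b (n, u, u)"
proof -
  obtain n u where "\<And>i. u i \<le> u (Suc i)" "u 0 = a" "u n = b" "\<And>i. u (Suc i) - u i < \<delta>"
    using ex_fine_seq[OF assms] by blast
  then have "tagged_seq \<delta> a b (n, u, u)" by (auto simp: tagged_seq_def)
  then show thesis by (rule that)
qed

lemma RS_filter_neq_bot: "a \<le> b \<Longrightarrow> RS_filter a b \<noteq> bot"
  unfolding trivial_limit_def eventually_RS_filter by (metis ex_tagged_seq)

lemma has_RS_integral_unique: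
  assumes "has_RS_integral f g a b I" "has_RS_integral f g a b J" "a \<le> b"
  shows "I = J"
  using assms tendsto_unique[OF RS_filter_neq_bot] unfolding has_RS_integral_iff_tendsto by blast

lemma RS_integral_eq:
  assumes "has_RS_integral f g a b I" "a \<le> b"
  shows "RS_integral f g a b = I"
  unfolding RS_integral_def using has_RS_integral_unique[OF _ _ assms(2)] assms(1) by blast

lemma tagged_seq_mono:
  assumes "tagged_seq \<delta> a b (n, u, \<xi>)" "i \<le> j" "j \<le> n"
  shows "u i \<le> u j"
  using assms(2,3)
proof (induction j rule: dec_induct)
  case (step j)
  then have "u j \<le> \<xi> j" "\<xi> j \<le> u (Suc j)" using assms(1) by (auto simp: tagged_seq_def)
  then show ?case using step by auto
qed auto

lemma tagged_seq_range:
  assumes "tagged_seq \<delta> a b (n, u, \<xi>)" "i \<le> n"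
  shows "a \<le> u i" "u i \<le> b"
  using tagged_seq_mono[OF assms(1), of 0 i] tagged_seq_mono[OF assms(1), of i n] assms
  by (auto simp: tagged_seq_def)

lemma tagged_seqD:
  assumes "tagged_seq \<delta> a b (n, u, \<xi>)"
  shows "u 0 = a" "u n = b" "k < n \<Longrightarrow> u k \<le> \<xi> k" "k < n \<Longrightarrow> \<xi> k \<le> u (Suc k)"
    "k < n \<Longrightarrow> u (Suc k) - u k < \<delta>" "k < n \<Longrightarrow> u k \<le> u (Suc k)"
    "k < n \<Longrightarrow> a \<le> \<xi> k" "k < n \<Longrightarrow> \<xi> k \<le> b"
  using assms tagged_seq_range[OF assms, of k] tagged_seq_range[OF assms, of "Suc k"]
  by (fastforce simp: tagged_seq_def)+

lemma RS_sum_cong: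
  assumes "tagged_seq \<delta> a b P"
    and "\<And>x. a \<le> x \<Longrightarrow> x \<le> b \<Longrightarrow> f x = f' x" "\<And>x. a \<le> x \<Longrightarrow> x \<le> b \<Longrightarrow> g x = g' x"
  shows "RS_sum f g P = RS_sum f' g' P"
proof -
  obtain n u \<xi> where P: "P = (n, u, \<xi>)" by (cases P)
  show ?thesis unfolding P RS_sum_def prod.case
  proof (rule sum.cong)
    fix k assume "k \<in> {..<n}"
    then show "f (\<xi> k) * (g (u (Suc k)) - g (u k)) = f' (\<xi> k) * (g' (u (Suc k)) - g' (u k))"
      using assms(2,3) tagged_seqD(7,8)[OF assms(1)[unfolded P], of k]
        tagged_seq_range[OF assms(1)[unfolded P]] by simp
  qed simp
qed

section \<open>Congruence, linearity and change of parameter of the integral\<close>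

lemma has_RS_integral_cong:
  assumes "\<And>x. a \<le> x \<Longrightarrow> x \<le> b \<Longrightarrow> f x = f' x" "\<And>x. a \<le> x \<Longrightarrow> x \<le> b \<Longrightarrow> g x = g' x"
  shows "has_RS_integral f g a b I \<longleftrightarrow> has_RS_integral f' g' a b I"
  unfolding has_RS_integral_iff_tendsto
proof (rule tendsto_cong)
  show "\<forall>\<^sub>F P in RS_filter a b. RS_sum f g P = RS_sum f' g' P"
    unfolding eventually_RS_filter
  proof (intro exI[of _ 1] conjI allI impI)
    fix P assume "tagged_seq 1 a b P"
    then show "RS_sum f g P = RS_sum f' g' P" by (rule RS_sum_cong) (use assms in auto)
  qed auto
qed

lemma RS_integral_cong:
  assumes "\<And>x. a \<le> x \<Longrightarrow> x \<le> b \<Longrightarrow> f x = f' x" "\<And>x. a \<le> x \<Longrightarrow> x \<le> b \<Longrightarrow> g x = g' x"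
  shows "RS_integral f g a b = RS_integral f' g' a b"
  unfolding RS_integral_def
  by (intro arg_cong[of _ _ The] ext has_RS_integral_cong assms)

lemma has_RS_integral_add_left:
  assumes "has_RS_integral f g a b I" "has_RS_integral f' g a b J"
  shows "has_RS_integral (\<lambda>x. f x + f' x) g a b (I + J)"
proof -
  have "RS_sum (\<lambda>x. f x + f' x) g = (\<lambda>P. RS_sum f g P + RS_sum f' g P)"
    by (auto simp: RS_sum_def sum.distrib[symmetric] algebra_simps fun_eq_iff)
  then show ?thesis using tendsto_add[OF assms[unfolded has_RS_integral_iff_tendsto]]
    by (simp add: has_RS_integral_iff_tendsto)
qed

lemma has_RS_integral_cmult_left:
  assumes "has_RS_integral f g a b I"
  shows "has_RS_integral (\<lambda>x. c * f x) g a b (c * I)"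
proof -
  have "RS_sum (\<lambda>x. c * f x) g = (\<lambda>P. c * RS_sum f g P)"
    by (auto simp: RS_sum_def sum_distrib_left algebra_simps fun_eq_iff)
  then show ?thesis using tendsto_mult_left[OF assms[unfolded has_RS_integral_iff_tendsto]]
    by (simp add: has_RS_integral_iff_tendsto)
qed

lemma has_RS_integral_cmult_right:
  assumes "has_RS_integral f g a b I"
  shows "has_RS_integral f (\<lambda>x. c * g x) a b (c * I)"
proof -
  have "RS_sum f (\<lambda>x. c * g x) = (\<lambda>P. c * RS_sum f g P)"
    by (auto simp: RS_sum_def sum_distrib_left algebra_simps fun_eq_iff)
  then show ?thesis using tendsto_mult_left[OF assms[unfolded has_RS_integral_iff_tendsto]]
    by (simp add: has_RS_integral_iff_tendsto)
qed

lemma has_RS_integral_add_const_right: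
  "has_RS_integral f g a b I \<Longrightarrow> has_RS_integral f (\<lambda>x. g x + c) a b I"
  unfolding has_RS_integral_iff_tendsto RS_sum_def by simp

lemma has_RS_integral_const_right: "has_RS_integral f (\<lambda>x. c) a b 0"
  by (simp add: has_RS_integral_iff_tendsto RS_sum_def case_prod_unfold)

lemma has_RS_integral_sum_left:
  assumes "\<And>j. j \<in> S \<Longrightarrow> has_RS_integral (f j) g a b (I j)"
  shows "has_RS_integral (\<lambda>x. \<Sum>j\<in>S. f j x) g a b (\<Sum>j\<in>S. I j)"
proof -
  have z: "has_RS_integral (\<lambda>x. 0) g a b 0"
    by (simp add: has_RS_integral_iff_tendsto RS_sum_def case_prod_unfold)
  show ?thesis using assms
    by (induction S rule: infinite_finite_induct) (auto simp: z intro: has_RS_integral_add_left)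
qed

lemma has_RS_integral_shift:
  assumes "has_RS_integral f g a b I"
  shows "has_RS_integral (\<lambda>x. f (x - c)) (\<lambda>x. g (x - c)) (a + c) (b + c) I"
  unfolding has_RS_integral_iff_tendsto tendsto_iff eventually_RS_filter
proof (intro allI impI)
  fix e :: real assume "e > 0"
  then obtain \<delta> where \<delta>: "\<delta> > 0" "\<And>P. tagged_seq \<delta> a b P \<Longrightarrow> dist (RS_sum f g P) I < e"
    using assms unfolding has_RS_integral_iff_tendsto tendsto_iff eventually_RS_filter by blast
  have "dist (RS_sum (\<lambda>x. f (x - c)) (\<lambda>x. g (x - c)) P) I < e"
    if "tagged_seq \<delta> (a + c) (b + c) P" for P
  proof -
    obtain n u \<xi> where P: "P = (n, u, \<xi>)" by (cases P)
    have "tagged_seq \<delta> a b (n, \<lambda>k. u k - c, \<lambda>k. \<xi> k - c)"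
      using that unfolding P tagged_seq_def by auto
    from \<delta>(2)[OF this] show ?thesis unfolding P RS_sum_def by simp
  qed
  then show "\<exists>\<delta>>0. \<forall>P. tagged_seq \<delta> (a + c) (b + c) P \<longrightarrow>
      dist (RS_sum (\<lambda>x. f (x - c)) (\<lambda>x. g (x - c)) P) I < e" using \<delta>(1) by blast
qed

text \<open>Reading a tagged partition backwards keeps its mesh and flips the sign of every
  increment of the integrator; the tag with index \<open>n - Suc k\<close> belongs to the interval
  between the points \<open>n - Suc k\<close> and \<open>n - k\<close>.\<close>

lemma has_RS_integral_reflect:
  assumes "has_RS_integral f g a b I"
  shows "has_RS_integral (\<lambda>x. f (c - x)) (\<lambda>x. g (c - x)) (c - b) (c - a) (- I)"
  unfolding has_RS_integral_iff_tendsto tendsto_iff eventually_RS_filter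
proof (intro allI impI)
  fix e :: real assume "e > 0"
  then obtain \<delta> where \<delta>: "\<delta> > 0" "\<And>P. tagged_seq \<delta> a b P \<Longrightarrow> dist (RS_sum f g P) I < e"
    using assms unfolding has_RS_integral_iff_tendsto tendsto_iff eventually_RS_filter by blast
  have "dist (RS_sum (\<lambda>x. f (c - x)) (\<lambda>x. g (c - x)) P) (- I) < e"
    if "tagged_seq \<delta> (c - b) (c - a) P" for P
  proof -
    obtain n u \<xi> where P: "P = (n, u, \<xi>)" by (cases P)
    have t: "u 0 = c - b" "u n = c - a"
       "\<And>k. k < n \<Longrightarrow> u k \<le> \<xi> k \<and> \<xi> k \<le> u (Suc k) \<and> u (Suc k) - u k < \<delta>"
      using that unfolding P tagged_seq_def by auto
    have "tagged_seq \<delta> a b (n, \<lambda>k. c - u (n - k), \<lambda>k. c - \<xi> (n - Suc k))"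
      unfolding tagged_seq_def prod.case
    proof (intro conjI allI impI)
      fix k assume "k < n"
      then have "n - Suc k < n" "Suc (n - Suc k) = n - k" by auto
      with t(3)[of "n - Suc k"] show "c - u (n - k) \<le> c - \<xi> (n - Suc k)"
        "c - \<xi> (n - Suc k) \<le> c - u (n - Suc k)" "c - u (n - Suc k) - (c - u (n - k)) < \<delta>"
        by auto
    qed (use t in auto)
    from \<delta>(2)[OF this]
    have "dist (\<Sum>k<n. f (c - \<xi> (n - Suc k)) * (g (c - u (n - Suc k)) - g (c - u (n - k)))) I < e"
      by (simp add: RS_sum_def)
    also have "(\<Sum>k<n. f (c - \<xi> (n - Suc k)) * (g (c - u (n - Suc k)) - g (c - u (n - k))))
       = (\<Sum>k<n. f (c - \<xi> (n - Suc k)) * (g (c - u (n - Suc k)) - g (c - u (Suc (n - Suc k)))))"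
      by (intro sum.cong) (auto simp: Suc_diff_Suc)
    also have "\<dots> = (\<Sum>k<n. f (c - \<xi> k) * (g (c - u k) - g (c - u (Suc k))))"
      by (rule sum.nat_diff_reindex[of "\<lambda>k. f (c - \<xi> k) * (g (c - u k) - g (c - u (Suc k)))"])
    also have "\<dots> = - RS_sum (\<lambda>x. f (c - x)) (\<lambda>x. g (c - x)) P"
      unfolding P RS_sum_def by (simp add: sum_negf[symmetric] algebra_simps)
    finally show ?thesis by (simp add: dist_real_def abs_minus_commute)
  qed
  then show "\<exists>\<delta>>0. \<forall>P. tagged_seq \<delta> (c - b) (c - a) P \<longrightarrow>
      dist (RS_sum (\<lambda>x. f (c - x)) (\<lambda>x. g (c - x)) P) (- I) < e" using \<delta>(1) by blast
qed

text \<open>Fine partitions of the two halves glue to a fine partition of the whole. Only partitions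
  through \<open>b\<close> arise in this way, so the integral over \<open>[a, c]\<close> has to be
  given beforehand.\<close>

lemma has_RS_integral_combine:
  assumes J: "has_RS_integral f g a c J" and I1: "has_RS_integral f g a b I1"
    and I2: "has_RS_integral f g b c I2" and ab: "a \<le> b" "b \<le> c"
  shows "J = I1 + I2"
proof (rule ccontr)
  assume "J \<noteq> I1 + I2"
  \<comment> \<open>A third of the presumed gap for each of the three approximations.\<close>
  define e where "e = \<bar>J - (I1 + I2)\<bar> / 3"
  have "e > 0" using \<open>J \<noteq> I1 + I2\<close> by (simp add: e_def)
  obtain d0 where d0: "d0 > 0" "\<And>P. tagged_seq d0 a c P \<Longrightarrow> dist (RS_sum f g P) J < e"
    using J \<open>e > 0\<close> unfolding has_RS_integral_iff_tendsto tendsto_iff eventually_RS_filter by blast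
  obtain d1 where d1: "d1 > 0" "\<And>P. tagged_seq d1 a b P \<Longrightarrow> dist (RS_sum f g P) I1 < e"
    using I1 \<open>e > 0\<close> unfolding has_RS_integral_iff_tendsto tendsto_iff eventually_RS_filter by blast
  obtain d2 where d2: "d2 > 0" "\<And>P. tagged_seq d2 b c P \<Longrightarrow> dist (RS_sum f g P) I2 < e"
    using I2 \<open>e > 0\<close> unfolding has_RS_integral_iff_tendsto tendsto_iff eventually_RS_filter by blast
  define d where "d = min d0 (min d1 d2)"
  have "d > 0" using d0 d1 d2 by (simp add: d_def)
  obtain n u where u: "tagged_seq d a b (n, u, u)" using ex_tagged_seq[OF ab(1) \<open>d > 0\<close>] by blast
  obtain m w where w: "tagged_seq d b c (m, w, w)" using ex_tagged_seq[OF ab(2) \<open>d > 0\<close>] by blast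
  define z where "z k = (if k \<le> n then u k else w (k - n))" for k
  have zn: "z (n + k) = w k" for k
    using tagged_seqD(2)[OF u] tagged_seqD(1)[OF w] by (simp add: z_def)
  have z: "tagged_seq d a c (n + m, z, z)"
    unfolding tagged_seq_def prod.case
  proof (intro conjI allI impI)
    show "z 0 = a" using tagged_seqD(1)[OF u] by (simp add: z_def)
    show "z (n + m) = c" using tagged_seqD(2)[OF w] by (simp add: zn)
    fix k assume k: "k < n + m"
    show "z k \<le> z (Suc k)"
    proof (cases "k < n")
      case True then show ?thesis using tagged_seqD(6)[OF u] by (simp add: z_def)
    next
      case False
      then have "z k = w (k - n)" "z (Suc k) = w (Suc (k - n))"
        using zn[of "k - n"] zn[of "Suc (k - n)"] by auto
      then show ?thesis using tagged_seqD(6)[OF w, of "k - n"] False k by simp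
    qed
    show "z (Suc k) - z k < d"
    proof (cases "k < n")
      case True then show ?thesis using tagged_seqD(5)[OF u] by (simp add: z_def)
    next
      case False
      then have "z k = w (k - n)" "z (Suc k) = w (Suc (k - n))"
        using zn[of "k - n"] zn[of "Suc (k - n)"] by auto
      then show ?thesis using tagged_seqD(5)[OF w, of "k - n"] False k by simp
    qed
  qed auto
  have "RS_sum f g (n + m, z, z) = (\<Sum>k<n. f (z k) * (g (z (Suc k)) - g (z k)))
      + (\<Sum>k<m. f (z (n + k)) * (g (z (Suc (n + k))) - g (z (n + k))))"
    unfolding RS_sum_def prod.case
    by (induction m) (auto simp: algebra_simps)
  also have "(\<Sum>k<n. f (z k) * (g (z (Suc k)) - g (z k))) = RS_sum f g (n, u, u)"
    unfolding RS_sum_def by (auto intro!: sum.cong simp: z_def)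
  also have "(\<Sum>k<m. f (z (n + k)) * (g (z (Suc (n + k))) - g (z (n + k)))) = RS_sum f g (m, w, w)"
    unfolding RS_sum_def using zn[of "Suc _"] by (auto intro!: sum.cong simp: zn)
  finally have "RS_sum f g (n + m, z, z) = RS_sum f g (n, u, u) + RS_sum f g (m, w, w)" .
  moreover have "dist (RS_sum f g (n + m, z, z)) J < e"
    by (rule d0(2), rule tagged_seq_mesh_mono[OF z]) (simp add: d_def)
  moreover have "dist (RS_sum f g (n, u, u)) I1 < e"
    by (rule d1(2), rule tagged_seq_mesh_mono[OF u]) (simp add: d_def)
  moreover have "dist (RS_sum f g (m, w, w)) I2 < e"
    by (rule d2(2), rule tagged_seq_mesh_mono[OF w]) (simp add: d_def)
  ultimately have "\<bar>J - (I1 + I2)\<bar> < 3 * e" unfolding dist_real_def by linarith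
  then show False by (simp add: e_def)
qed

section \<open>The discrete Young inequality\<close>

text \<open>Solves \<open>C = 2 + C * 2 powr (1 - \<theta>)\<close>: halving the control turns the
  bounds for the two halves into \<open>2 powr (1 - \<theta>)\<close> times the full one, and two
  cross terms add 2.\<close>

definition young_const :: "real \<Rightarrow> real"
  where "young_const \<theta> = 2 / (1 - 2 powr (1 - \<theta>))"

lemma young_const_pos: "\<theta> > 1 \<Longrightarrow> young_const \<theta> > 0"
  unfolding young_const_def by (simp add: powr_less_one)

text \<open>Split at the last index at which \<open>c\<close> has not yet completed half of its increase: both
  remaining blocks contribute at most \<open>2 powr -\<theta>\<close> of the bound, and \<open>2 * 2 powr -\<theta> < 1\<close>.\<close>

lemma discrete_young:
  fixes a b c :: "nat \<Rightarrow> real"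
  assumes \<theta>: "\<theta> > 1" and K: "K \<ge> 0"
    and mono: "\<And>i j. i \<le> j \<Longrightarrow> j \<le> N \<Longrightarrow> c i \<le> c j"
    and bd: "\<And>i j k. i \<le> j \<Longrightarrow> j \<le> k \<Longrightarrow> k \<le> N \<Longrightarrow>
        \<bar>a j - a i\<bar> * \<bar>b k - b j\<bar> \<le> K * (c k - c i) powr \<theta>"
  shows "i \<le> j \<Longrightarrow> j \<le> N \<Longrightarrow>
    \<bar>(\<Sum>k=i..<j. a k * (b (Suc k) - b k)) - a i * (b j - b i)\<bar>
      \<le> K * young_const \<theta> * (c j - c i) powr \<theta>"
proof (induction "j - i" arbitrary: i j rule: less_induct)
  case less
  define S where "S i j = (\<Sum>k=i..<j. a k * (b (Suc k) - b k))" for i j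
  show ?case
  proof (cases "i = j")
    case True then show ?thesis using K young_const_pos[OF \<theta>] by simp
  next
    case False
    then have "i < j" using less by simp
    define W where "W = c j - c i"
    have "W \<ge> 0" using mono[of i j] less by (simp add: W_def)
    define m where "m = Max {k\<in>{i..<j}. c k - c i \<le> W / 2}"
    have ne: "{k\<in>{i..<j}. c k - c i \<le> W / 2} \<noteq> {}" using \<open>i < j\<close> \<open>W \<ge> 0\<close> by auto
    have m: "i \<le> m" "m < j" "c m - c i \<le> W / 2"
      using Max_in[OF _ ne] by (auto simp: m_def)
    have m1: "c j - c (Suc m) \<le> W / 2"
    proof (cases "Suc m = j")
      case True then show ?thesis using \<open>W \<ge> 0\<close> by simp
    next
      case False
      then have "Suc m < j" using m by simp
      have "\<not> c (Suc m) - c i \<le> W / 2"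
      proof
        assume "c (Suc m) - c i \<le> W / 2"
        then have "Suc m \<in> {k\<in>{i..<j}. c k - c i \<le> W / 2}" using \<open>Suc m < j\<close> m(1) by simp
        then have "Suc m \<le> Max {k\<in>{i..<j}. c k - c i \<le> W / 2}" by (intro Max_ge) auto
        then have "Suc m \<le> m" by (simp only: m_def)
        then show False by simp
      qed
      then show ?thesis by (simp add: W_def field_simps)
    qed
    have S: "S i j = S i m + a m * (b (Suc m) - b m) + S (Suc m) j"
    proof -
      have "S i j = S i m + S m j" unfolding S_def using m by (simp add: sum.atLeastLessThan_concat)
      also have "S m j = a m * (b (Suc m) - b m) + S (Suc m) j"
        unfolding S_def using m by (simp add: sum.atLeast_Suc_lessThan)
      finally show ?thesis by simp
    qed
    let ?C = "young_const \<theta>"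
    have 1: "\<bar>S i m - a i * (b m - b i)\<bar> \<le> K * ?C * (W / 2) powr \<theta>"
    proof -
      have "\<bar>S i m - a i * (b m - b i)\<bar> \<le> K * ?C * (c m - c i) powr \<theta>"
        unfolding S_def using m less by (intro less.hyps) auto
      also have "\<dots> \<le> K * ?C * (W / 2) powr \<theta>"
        using m mono[of i m] less K young_const_pos[OF \<theta>] \<theta>
        by (intro mult_left_mono powr_mono2) auto
      finally show ?thesis .
    qed
    have 2: "\<bar>S (Suc m) j - a (Suc m) * (b j - b (Suc m))\<bar> \<le> K * ?C * (W / 2) powr \<theta>"
    proof -
      have "\<bar>S (Suc m) j - a (Suc m) * (b j - b (Suc m))\<bar> \<le> K * ?C * (c j - c (Suc m)) powr \<theta>"
        unfolding S_def using m less by (intro less.hyps) auto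
      also have "\<dots> \<le> K * ?C * (W / 2) powr \<theta>"
        using m m1 mono[of "Suc m" j] less K young_const_pos[OF \<theta>] \<theta>
        by (intro mult_left_mono powr_mono2) auto
      finally show ?thesis .
    qed
    have 3: "\<bar>a m - a i\<bar> * \<bar>b (Suc m) - b m\<bar> \<le> K * W powr \<theta>"
    proof -
      have "\<bar>a m - a i\<bar> * \<bar>b (Suc m) - b m\<bar> \<le> K * (c (Suc m) - c i) powr \<theta>"
        using m less by (intro bd) auto
      also have "\<dots> \<le> K * W powr \<theta>" unfolding W_def
        using m mono[of i "Suc m"] mono[of "Suc m" j] less K \<theta>
        by (intro mult_left_mono powr_mono2) auto
      finally show ?thesis .
    qed
    have 4: "\<bar>a (Suc m) - a i\<bar> * \<bar>b j - b (Suc m)\<bar> \<le> K * W powr \<theta>"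
      using m less bd[of i "Suc m" j] by (simp add: W_def)
    \<comment> \<open>Each half is corrected by its own left-point term; the two cross terms that
      remain are of the kind bounded by \<open>bd\<close>.\<close>
    have "S i j - a i * (b j - b i) = (S i m - a i * (b m - b i))
        + (S (Suc m) j - a (Suc m) * (b j - b (Suc m)))
        + (a m - a i) * (b (Suc m) - b m) + (a (Suc m) - a i) * (b j - b (Suc m))"
      unfolding S by (simp add: algebra_simps)
    then have "\<bar>S i j - a i * (b j - b i)\<bar> \<le> 2 * (K * ?C * (W / 2) powr \<theta>) + 2 * (K * W powr \<theta>)"
      using 1 2 3 4 unfolding abs_mult[symmetric] by linarith
    also have "\<dots> = K * W powr \<theta> * (2 + ?C * 2 powr (1 - \<theta>))"
      using \<open>W \<ge> 0\<close> by (simp add: powr_divide powr_diff field_simps)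
    also have "2 + ?C * 2 powr (1 - \<theta>) = ?C"
    proof -
      have "1 - 2 powr (1 - \<theta>) \<noteq> (0::real)" using \<theta> powr_less_one[of 2 "1 - \<theta>"] by simp
      then show ?thesis unfolding young_const_def by (simp add: add_divide_eq_iff)
    qed
    finally show ?thesis unfolding S_def W_def by (simp add: algebra_simps)
  qed
qed

text \<open>In \<open>x powr \<theta> = x * x powr (\<theta> - 1)\<close> the second factor is at
  most its value at the total increase, and the first factors telescope.\<close>

lemma sum_powr_increments_le:
  fixes c :: "nat \<Rightarrow> real"
  assumes "\<theta> \<ge> 1" and mono: "\<And>i j. i \<le> j \<Longrightarrow> j \<le> n \<Longrightarrow> c i \<le> c j"
  shows "(\<Sum>k<n. (c (Suc k) - c k) powr \<theta>) \<le> (c n - c 0) powr \<theta>"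
proof -
  define M where "M = c n - c 0"
  have M: "M \<ge> 0" using mono[of 0 n] by (simp add: M_def)
  have eq: "x powr \<theta> = x * x powr (\<theta> - 1)" if "x \<ge> 0" for x :: real
    using that by (cases "x = 0") (auto simp: powr_diff)
  have "(\<Sum>k<n. (c (Suc k) - c k) powr \<theta>) \<le> (\<Sum>k<n. (c (Suc k) - c k) * M powr (\<theta> - 1))"
  proof (rule sum_mono)
    fix k assume k: "k \<in> {..<n}"
    have "0 \<le> c (Suc k) - c k" "c (Suc k) - c k \<le> M"
      using mono[of k "Suc k"] mono[of 0 k] mono[of "Suc k" n] k by (auto simp: M_def)
    then show "(c (Suc k) - c k) powr \<theta> \<le> (c (Suc k) - c k) * M powr (\<theta> - 1)"
      using assms(1) by (subst eq) (auto intro!: mult_left_mono powr_mono2)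
  qed
  also have "\<dots> = M * M powr (\<theta> - 1)"
    unfolding M_def by (simp add: sum_distrib_right[symmetric] sum_lessThan_telescope)
  finally show ?thesis using eq[OF M] by (simp add: M_def)
qed


section \<open>Young integration\<close>

text \<open>Projection onto \<open>[x, y]\<close>. It turns a partition of a larger interval into
  one of \<open>[x, y]\<close> with repeated points, so that common refinements can be formed
  without sorting.\<close>

definition clamp_to :: "real \<Rightarrow> real \<Rightarrow> real \<Rightarrow> real"
  where "clamp_to x y z = max x (min y z)"

lemma clamp_to_range: "x \<le> y \<Longrightarrow> x \<le> clamp_to x y z \<and> clamp_to x y z \<le> y"
  and clamp_to_mono: "z \<le> z' \<Longrightarrow> clamp_to x y z \<le> clamp_to x y z'"
  and clamp_to_low: "z \<le> x \<Longrightarrow> x \<le> y \<Longrightarrow> clamp_to x y z = x"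
  and clamp_to_high: "y \<le> z \<Longrightarrow> x \<le> y \<Longrightarrow> clamp_to x y z = y"
  by (auto simp: clamp_to_def)

text \<open>Both sides are the contribution of the intersection of \<open>[x, y]\<close> and \<open>[z, z']\<close> to a
  Riemann sum, and vanish if the interiors are disjoint. Summed over two partitions this says
  that both induce the same common refinement.\<close>

lemma clamp_to_swap:
  assumes "x \<le> y" "z \<le> z'"
  shows "f (clamp_to x y z) * (g (clamp_to x y z') - g (clamp_to x y z)) =
    f (clamp_to z z' x) * (g (clamp_to z z' y) - g (clamp_to z z' x) :: real)"
  using assms unfolding clamp_to_def by (auto simp: min_def max_def)

text \<open>The increment \<open>v t - v s\<close> takes the place of a superadditive two-parameter
  control: being additive, it telescopes over partitions.\<close>

locale control =
  fixes T :: real and v :: "real \<Rightarrow> real" and \<alpha> :: real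
  assumes v_mono: "\<And>s t. 0 \<le> s \<Longrightarrow> s \<le> t \<Longrightarrow> t \<le> T \<Longrightarrow> v s \<le> v t"
    and alpha: "\<alpha> > 1 / 2"
    and T_nonneg: "T \<ge> 0"
begin

text \<open>Hoelder functions of exponent \<alpha> with respect to \<open>v\<close> as clock;
  continuity is listed separately since \<open>v\<close> may jump.\<close>

definition H :: "(real \<Rightarrow> real) set"
  where "H = {f. continuous_on {0..T} f \<and>
    (\<exists>C\<ge>0. \<forall>s t. 0 \<le> s \<longrightarrow> s \<le> t \<longrightarrow> t \<le> T \<longrightarrow> \<bar>f t - f s\<bar> \<le> C * (v t - v s) powr \<alpha>)}"

text \<open>Summed over a partition the bound telescopes, so negligible errors vanish as the mesh tends
  to \<open>0\<close>.\<close>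

definition negligible :: "(real \<Rightarrow> real \<Rightarrow> real) \<Rightarrow> bool"
  where "negligible E \<longleftrightarrow> (\<forall>\<epsilon>>0. \<exists>\<delta>>0. \<forall>s t. 0 \<le> s \<longrightarrow> s \<le> t \<longrightarrow> t \<le> T \<longrightarrow> t - s < \<delta> \<longrightarrow>
    \<bar>E s t\<bar> \<le> \<epsilon> * (v t - v s))"

text \<open>The infinitesimal form of \<open>J\<close> being an integral of \<open>f\<close> against
  \<open>g\<close>. No integral occurs in it, so the rules of calculus become algebra of error
  terms; \<open>has_RS_integral_of_rs_diff\<close> and \<open>rs_diff_exists\<close> translate to
  and from integrals.\<close>

definition rs_diff :: "(real \<Rightarrow> real) \<Rightarrow> (real \<Rightarrow> real) \<Rightarrow> (real \<Rightarrow> real) \<Rightarrow> bool"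
  where "rs_diff f g J \<longleftrightarrow> negligible (\<lambda>s t. J t - J s - f s * (g t - g s))"

section \<open>Basic properties of the function space \<open>H\<close>\<close>

lemma HD_cont: "f \<in> H \<Longrightarrow> continuous_on {0..T} f"
  by (simp add: H_def)

lemma HE:
  assumes "f \<in> H"
  obtains C where "C \<ge> 0"
    "\<And>s t. 0 \<le> s \<Longrightarrow> s \<le> t \<Longrightarrow> t \<le> T \<Longrightarrow> \<bar>f t - f s\<bar> \<le> C * (v t - v s) powr \<alpha>"
  using assms unfolding H_def by blast

lemma HI:
  assumes "continuous_on {0..T} f" "C \<ge> 0"
    "\<And>s t. 0 \<le> s \<Longrightarrow> s \<le> t \<Longrightarrow> t \<le> T \<Longrightarrow> \<bar>f t - f s\<bar> \<le> C * (v t - v s) powr \<alpha>"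
  shows "f \<in> H"
  using assms unfolding H_def by blast

lemma H_cong:
  assumes "f \<in> H" "\<And>x. 0 \<le> x \<Longrightarrow> x \<le> T \<Longrightarrow> f x = g x"
  shows "g \<in> H"
proof -
  obtain C where C: "C \<ge> 0" "\<And>s t. 0 \<le> s \<Longrightarrow> s \<le> t \<Longrightarrow> t \<le> T \<Longrightarrow> \<bar>f t - f s\<bar> \<le> C * (v t - v s) powr \<alpha>"
    by (rule HE[OF assms(1)]) blast
  have "continuous_on {0..T} g"
    using HD_cont[OF assms(1)] by (rule continuous_on_eq) (use assms(2) in auto)
  then show ?thesis by (rule HI[OF _ C(1)]) (use C(2) assms(2) in force)
qed

lemma H_const: "(\<lambda>x. c) \<in> H"
  by (rule HI[of _ 0]) auto

lemma H_add:
  assumes "f \<in> H" "g \<in> H"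
  shows "(\<lambda>x. f x + g x) \<in> H"
proof -
  obtain C where C: "C \<ge> 0" "\<And>s t. 0 \<le> s \<Longrightarrow> s \<le> t \<Longrightarrow> t \<le> T \<Longrightarrow> \<bar>f t - f s\<bar> \<le> C * (v t - v s) powr \<alpha>"
    by (rule HE[OF assms(1)]) blast
  obtain D where D: "D \<ge> 0" "\<And>s t. 0 \<le> s \<Longrightarrow> s \<le> t \<Longrightarrow> t \<le> T \<Longrightarrow> \<bar>g t - g s\<bar> \<le> D * (v t - v s) powr \<alpha>"
    by (rule HE[OF assms(2)]) blast
  show ?thesis
  proof (rule HI[of _ "C + D"])
    fix s t assume "0 \<le> s" "s \<le> t" "t \<le> T"
    from C(2)[OF this] D(2)[OF this]
    show "\<bar>f t + g t - (f s + g s)\<bar> \<le> (C + D) * (v t - v s) powr \<alpha>"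
      by (simp add: algebra_simps abs_le_iff)
  qed (use C D assms[THEN HD_cont] in \<open>auto intro!: continuous_intros\<close>)
qed

lemma H_cmult:
  assumes "f \<in> H"
  shows "(\<lambda>x. c * f x) \<in> H"
proof -
  obtain C where C: "C \<ge> 0" "\<And>s t. 0 \<le> s \<Longrightarrow> s \<le> t \<Longrightarrow> t \<le> T \<Longrightarrow> \<bar>f t - f s\<bar> \<le> C * (v t - v s) powr \<alpha>"
    by (rule HE[OF assms(1)]) blast
  show ?thesis
  proof (rule HI[of _ "\<bar>c\<bar> * C"])
    fix s t assume "0 \<le> s" "s \<le> t" "t \<le> T"
    from mult_left_mono[OF C(2)[OF this], of "\<bar>c\<bar>"]
    show "\<bar>c * f t - c * f s\<bar> \<le> (\<bar>c\<bar> * C) * (v t - v s) powr \<alpha>"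
      by (simp add: abs_mult[symmetric] algebra_simps)
  qed (use C assms[THEN HD_cont] in \<open>auto intro!: continuous_intros\<close>)
qed

lemma H_sum: "(\<And>j. j \<in> S \<Longrightarrow> f j \<in> H) \<Longrightarrow> (\<lambda>x. \<Sum>j\<in>S. f j x) \<in> H"
  by (induction S rule: infinite_finite_induct) (auto intro: H_const H_add)

lemma H_bounded:
  assumes "f \<in> H"
  obtains M where "M > 0" "\<And>s. 0 \<le> s \<Longrightarrow> s \<le> T \<Longrightarrow> \<bar>f s\<bar> \<le> M"
proof -
  have "compact (f ` {0..T})" using HD_cont[OF assms] by (intro compact_continuous_image) auto
  then obtain M where "\<And>y. y \<in> f ` {0..T} \<Longrightarrow> norm y \<le> M" and "M > 0"
    using compact_imp_bounded bounded_pos by metis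
  then show thesis by (intro that[of M]) auto
qed

lemma H_fine:
  assumes "f \<in> H" "e > 0"
  obtains \<delta> where "\<delta> > 0"
    "\<And>s t. 0 \<le> s \<Longrightarrow> s \<le> t \<Longrightarrow> t \<le> T \<Longrightarrow> t - s < \<delta> \<Longrightarrow> \<bar>f t - f s\<bar> \<le> e"
proof -
  have "uniformly_continuous_on {0..T} f"
    using HD_cont[OF assms(1)] by (intro compact_uniformly_continuous) auto
  then obtain d where d: "d > 0" "\<And>x x'. x \<in> {0..T} \<Longrightarrow> x' \<in> {0..T} \<Longrightarrow> dist x' x < d \<Longrightarrow> dist (f x') (f x) < e"
    using assms(2) unfolding uniformly_continuous_on_def by meson
  show thesis
  proof (rule that[OF d(1)])
    fix s t assume "0 \<le> s" "s \<le> t" "t \<le> T" "t - s < d"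
    then show "\<bar>f t - f s\<bar> \<le> e" using d(2)[of s t] by (simp add: dist_real_def)
  qed
qed

lemma v_diff_mono:
  assumes "0 \<le> s" "s \<le> x" "x \<le> y" "y \<le> t" "t \<le> T"
  shows "0 \<le> v y - v x" "v y - v x \<le> v t - v s"
  using v_mono[of x y] v_mono[of s x] v_mono[of y t] assms by auto

lemma v_powr_mono:
  assumes "0 \<le> s" "s \<le> x" "x \<le> y" "y \<le> t" "t \<le> T" "C \<ge> 0"
  shows "C * (v y - v x) powr \<alpha> \<le> C * (v t - v s) powr \<alpha>"
  using v_diff_mono[OF assms(1-5)] alpha assms(6) by (intro mult_left_mono powr_mono2) auto

text \<open>Here the constant is not small but the full exponent \<open>2 * \<alpha>\<close> is
  kept; this gives the a priori bound by which integrals stay in \<open>H\<close>.\<close>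

lemma young_global:
  assumes "f \<in> H" "g \<in> H"
  obtains K where "K \<ge> 0"
    "\<And>x y z. 0 \<le> x \<Longrightarrow> x \<le> y \<Longrightarrow> y \<le> z \<Longrightarrow> z \<le> T \<Longrightarrow>
       \<bar>f y - f x\<bar> * \<bar>g z - g y\<bar> \<le> K * (v z - v x) powr (2 * \<alpha>)"
proof -
  obtain C where C: "C \<ge> 0" "\<And>s t. 0 \<le> s \<Longrightarrow> s \<le> t \<Longrightarrow> t \<le> T \<Longrightarrow> \<bar>f t - f s\<bar> \<le> C * (v t - v s) powr \<alpha>"
    by (rule HE[OF assms(1)]) blast
  obtain D where D: "D \<ge> 0" "\<And>s t. 0 \<le> s \<Longrightarrow> s \<le> t \<Longrightarrow> t \<le> T \<Longrightarrow> \<bar>g t - g s\<bar> \<le> D * (v t - v s) powr \<alpha>"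
    by (rule HE[OF assms(2)]) blast
  show thesis
  proof (rule that[of "C * D"])
    fix x y z assume *: "0 \<le> x" "x \<le> y" "y \<le> z" "z \<le> T"
    have "\<bar>f y - f x\<bar> \<le> C * (v z - v x) powr \<alpha>"
      using C(2)[of x y] v_powr_mono[of x x y z C] C(1) * by linarith
    moreover have "\<bar>g z - g y\<bar> \<le> D * (v z - v x) powr \<alpha>"
      using D(2)[of y z] v_powr_mono[of x y z z D] D(1) * by linarith
    ultimately have "\<bar>f y - f x\<bar> * \<bar>g z - g y\<bar> \<le> (C * (v z - v x) powr \<alpha>) * (D * (v z - v x) powr \<alpha>)"
      by (intro mult_mono) (use C in auto)
    also have "\<dots> = C * D * ((v z - v x) powr \<alpha> * (v z - v x) powr \<alpha>)" by simp
    also have "(v z - v x) powr \<alpha> * (v z - v x) powr \<alpha> = (v z - v x) powr (2 * \<alpha>)"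
      by (simp add: powr_add[symmetric])
    finally show "\<bar>f y - f x\<bar> * \<bar>g z - g y\<bar> \<le> C * D * (v z - v x) powr (2 * \<alpha>)" .
  qed (use C D in auto)
qed

text \<open>Part of the variation of \<open>f\<close> is traded for uniform continuity, so that the constant in
  Young's condition becomes small on short intervals although \<open>v\<close> may be discontinuous.\<close>

lemma young_local:
  assumes "f \<in> H" "g \<in> H" "e > 0"
  obtains \<delta> where "\<delta> > 0"
    "\<And>s x y x' y' t. 0 \<le> s \<Longrightarrow> s \<le> x \<Longrightarrow> x \<le> y \<Longrightarrow> y \<le> t \<Longrightarrow> s \<le> x' \<Longrightarrow> x' \<le> y' \<Longrightarrow> y' \<le> t \<Longrightarrow>
       t \<le> T \<Longrightarrow> t - s < \<delta> \<Longrightarrow>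
       \<bar>f y - f x\<bar> * \<bar>g y' - g x'\<bar> \<le> e * (v t - v s) powr (\<alpha> + 1 / 2)"
proof -
  obtain C where C: "C \<ge> 0" "\<And>s t. 0 \<le> s \<Longrightarrow> s \<le> t \<Longrightarrow> t \<le> T \<Longrightarrow> \<bar>f t - f s\<bar> \<le> C * (v t - v s) powr \<alpha>"
    by (rule HE[OF assms(1)]) blast
  obtain D where D: "D \<ge> 0" "\<And>s t. 0 \<le> s \<Longrightarrow> s \<le> t \<Longrightarrow> t \<le> T \<Longrightarrow> \<bar>g t - g s\<bar> \<le> D * (v t - v s) powr \<alpha>"
    by (rule HE[OF assms(2)]) blast
  \<comment> \<open>The power \<beta> of an increment of \<open>f\<close> is bounded through
    \<open>v\<close>, the power \<open>1 - \<beta>\<close> through continuity. The choice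
    \<open>\<alpha> * \<beta> = 1 / 2\<close> leaves the total exponent
    \<open>\<alpha> + 1 / 2\<close>, still above 1.\<close>
  define \<beta> where "\<beta> = 1 / (2 * \<alpha>)"
  have \<beta>: "0 < \<beta>" "\<beta> < 1" "\<alpha> * \<beta> = 1 / 2" using alpha by (auto simp: \<beta>_def field_simps)
  \<comment> \<open>\<open>L\<close> collects the constants, with 1 added to keep it positive; the
    oscillation \<eta> allowed to \<open>f\<close> is then fixed by
    \<open>\<eta> powr (1 - \<beta>) = e / L\<close>.\<close>
  define L where "L = 1 + C powr \<beta> * D"
  have L: "L > 0" using D by (simp add: L_def add_pos_nonneg)
  define \<eta> where "\<eta> = (e / L) powr (1 / (1 - \<beta>))"
  have "\<eta> > 0" using L assms by (simp add: \<eta>_def)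
  have \<eta>: "\<eta> powr (1 - \<beta>) = e / L" using L assms \<beta> by (simp add: \<eta>_def powr_powr)
  obtain \<delta> where \<delta>: "\<delta> > 0" "\<And>s t. 0 \<le> s \<Longrightarrow> s \<le> t \<Longrightarrow> t \<le> T \<Longrightarrow> t - s < \<delta> \<Longrightarrow> \<bar>f t - f s\<bar> \<le> \<eta>"
    by (rule H_fine[OF assms(1) \<open>\<eta> > 0\<close>]) blast
  show thesis
  proof (rule that[OF \<delta>(1)])
    fix s x y x' y' t assume *: "0 \<le> s" "s \<le> x" "x \<le> y" "y \<le> t" "s \<le> x'" "x' \<le> y'" "y' \<le> t"
       "t \<le> T" "t - s < \<delta>"
    define W where "W = v t - v s"
    have W: "W \<ge> 0" using v_mono[of s t] * by (simp add: W_def)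
    have 1: "\<bar>f y - f x\<bar> \<le> \<eta>" using \<delta>(2)[of x y] * by auto
    have 2: "\<bar>f y - f x\<bar> \<le> C * W powr \<alpha>"
      using C(2)[of x y] v_powr_mono[of s x y t C] C(1) * unfolding W_def by linarith
    have 3: "\<bar>g y' - g x'\<bar> \<le> D * W powr \<alpha>"
      using D(2)[of x' y'] v_powr_mono[of s x' y' t D] D(1) * unfolding W_def by linarith
    have "\<bar>f y - f x\<bar> = \<bar>f y - f x\<bar> powr (1 - \<beta>) * \<bar>f y - f x\<bar> powr \<beta>"
      by (simp add: powr_add[symmetric])
    also have "\<dots> \<le> \<eta> powr (1 - \<beta>) * (C * W powr \<alpha>) powr \<beta>"
      using 1 2 \<beta> by (intro mult_mono powr_mono2) auto
    also have "\<dots> = e / L * (C powr \<beta> * W powr (1 / 2))"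
      using C W by (simp add: \<eta> powr_mult powr_powr \<beta>(3) del: times_divide_eq_right)
    finally have "\<bar>f y - f x\<bar> * \<bar>g y' - g x'\<bar> \<le> (e / L * (C powr \<beta> * W powr (1 / 2))) * (D * W powr \<alpha>)"
      using 3 assms L by (intro mult_mono) auto
    also have "\<dots> = e * (C powr \<beta> * D / L) * (W powr (1 / 2) * W powr \<alpha>)" by simp
    also have "\<dots> = e * (C powr \<beta> * D / L) * W powr (\<alpha> + 1 / 2)"
      by (simp add: powr_add[symmetric] add.commute)
    also have "\<dots> \<le> e * 1 * W powr (\<alpha> + 1 / 2)"
      using assms L D by (intro mult_right_mono mult_left_mono) (auto simp: L_def)
    finally show "\<bar>f y - f x\<bar> * \<bar>g y' - g x'\<bar> \<le> e * (v t - v s) powr (\<alpha> + 1 / 2)"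
      by (simp add: W_def)
  qed
qed

section \<open>Negligible errors\<close>

lemma theta: "\<alpha> + 1 / 2 > 1" "2 * \<alpha> > 1" using alpha by auto

lemma negligibleE:
  assumes "negligible E" "e > 0"
  obtains \<delta> where "\<delta> > 0"
    "\<And>s t. 0 \<le> s \<Longrightarrow> s \<le> t \<Longrightarrow> t \<le> T \<Longrightarrow> t - s < \<delta> \<Longrightarrow> \<bar>E s t\<bar> \<le> e * (v t - v s)"
  using assms unfolding negligible_def by blast

text \<open>A power above 1 of an increment of \<open>v\<close> is the increment times a factor
  bounded by the total increase, and this factor can be absorbed into the small constant.\<close>

lemma negligibleI_powr:
  assumes "\<theta> \<ge> 1"
    and "\<And>\<epsilon>. \<epsilon> > 0 \<Longrightarrow> \<exists>\<delta>>0. \<forall>s t. 0 \<le> s \<longrightarrow> s \<le> t \<longrightarrow> t \<le> T \<longrightarrow> t - s < \<delta> \<longrightarrow>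
      \<bar>E s t\<bar> \<le> \<epsilon> * (v t - v s) powr \<theta>"
  shows "negligible E"
  unfolding negligible_def
proof (intro allI impI)
  fix e :: real assume "e > 0"
  define M where "M = 1 + (v T - v 0) powr (\<theta> - 1)"
  have M: "M > 0" by (simp add: M_def add_pos_nonneg)
  then obtain \<delta> where \<delta>: "\<delta> > 0" "\<And>s t. 0 \<le> s \<Longrightarrow> s \<le> t \<Longrightarrow> t \<le> T \<Longrightarrow> t - s < \<delta> \<Longrightarrow>
      \<bar>E s t\<bar> \<le> e / M * (v t - v s) powr \<theta>"
    using assms(2)[of "e / M"] \<open>e > 0\<close> by auto
  have "\<bar>E s t\<bar> \<le> e * (v t - v s)" if *: "0 \<le> s" "s \<le> t" "t \<le> T" "t - s < \<delta>" for s t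
  proof -
    define W where "W = v t - v s"
    have W: "0 \<le> W" "W \<le> v T - v 0" using v_diff_mono[of 0 s t T] * by (auto simp: W_def)
    have "\<bar>E s t\<bar> \<le> e / M * W powr \<theta>" using \<delta>(2)[OF *] by (simp add: W_def)
    also have "W powr \<theta> = W * W powr (\<theta> - 1)" using W by (cases "W = 0") (auto simp: powr_diff)
    also have "e / M * (W * W powr (\<theta> - 1)) \<le> e / M * (W * M)"
      using W \<open>e > 0\<close> M assms(1) powr_mono2[of "\<theta> - 1" W "v T - v 0"]
      by (intro mult_left_mono) (auto simp: M_def)
    also have "\<dots> = e * W" using M by simp
    finally show ?thesis by (simp add: W_def)
  qed
  then show "\<exists>\<delta>>0. \<forall>s t. 0 \<le> s \<longrightarrow> s \<le> t \<longrightarrow> t \<le> T \<longrightarrow> t - s < \<delta> \<longrightarrow> \<bar>E s t\<bar> \<le> e * (v t - v s)"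
    using \<delta>(1) by blast
qed

lemma negligible_add:
  assumes "negligible E" "negligible F"
  shows "negligible (\<lambda>s t. E s t + F s t)"
  unfolding negligible_def
proof (intro allI impI)
  fix e :: real assume "e > 0"
  obtain d where d: "d > 0" "\<And>s t. 0 \<le> s \<Longrightarrow> s \<le> t \<Longrightarrow> t \<le> T \<Longrightarrow> t - s < d \<Longrightarrow> \<bar>E s t\<bar> \<le> e / 2 * (v t - v s)"
    by (rule negligibleE[OF assms(1), of "e / 2"]) (use \<open>e > 0\<close> in auto)
  obtain d' where d': "d' > 0" "\<And>s t. 0 \<le> s \<Longrightarrow> s \<le> t \<Longrightarrow> t \<le> T \<Longrightarrow> t - s < d' \<Longrightarrow> \<bar>F s t\<bar> \<le> e / 2 * (v t - v s)"
    by (rule negligibleE[OF assms(2), of "e / 2"]) (use \<open>e > 0\<close> in auto)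
  have "\<bar>E s t + F s t\<bar> \<le> e * (v t - v s)"
    if *: "0 \<le> s" "s \<le> t" "t \<le> T" "t - s < min d d'" for s t
    using d(2)[of s t] d'(2)[of s t] * by (simp add: field_simps abs_le_iff)
  then show "\<exists>\<delta>>0. \<forall>s t. 0 \<le> s \<longrightarrow> s \<le> t \<longrightarrow> t \<le> T \<longrightarrow> t - s < \<delta> \<longrightarrow> \<bar>E s t + F s t\<bar> \<le> e * (v t - v s)"
    using d(1) d'(1) by (intro exI[of _ "min d d'"]) auto
qed

lemma negligible_mult:
  assumes "negligible E" "M > 0" "\<And>s. 0 \<le> s \<Longrightarrow> s \<le> T \<Longrightarrow> \<bar>h s\<bar> \<le> M"
  shows "negligible (\<lambda>s t. h s * E s t)"
  unfolding negligible_def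
proof (intro allI impI)
  fix e :: real assume "e > 0"
  obtain d where d: "d > 0" "\<And>s t. 0 \<le> s \<Longrightarrow> s \<le> t \<Longrightarrow> t \<le> T \<Longrightarrow> t - s < d \<Longrightarrow> \<bar>E s t\<bar> \<le> e / M * (v t - v s)"
    by (rule negligibleE[OF assms(1), of "e / M"]) (use \<open>e > 0\<close> assms(2) in auto)
  have "\<bar>h s * E s t\<bar> \<le> e * (v t - v s)"
    if *: "0 \<le> s" "s \<le> t" "t \<le> T" "t - s < d" for s t
  proof -
    have "\<bar>h s * E s t\<bar> \<le> M * (e / M * (v t - v s))"
      unfolding abs_mult using d(2)[of s t] assms(2) assms(3)[of s] * by (intro mult_mono) auto
    then show ?thesis using assms(2) by simp
  qed
  then show "\<exists>\<delta>>0. \<forall>s t. 0 \<le> s \<longrightarrow> s \<le> t \<longrightarrow> t \<le> T \<longrightarrow> t - s < \<delta> \<longrightarrow> \<bar>h s * E s t\<bar> \<le> e * (v t - v s)"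
    using d(1) by (intro exI[of _ d]) auto
qed

lemma negligible_cmult: "negligible E \<Longrightarrow> negligible (\<lambda>s t. c * E s t)"
  by (rule negligible_mult[where M = "\<bar>c\<bar> + 1"]) auto

lemma negligible_diff: "negligible E \<Longrightarrow> negligible F \<Longrightarrow> negligible (\<lambda>s t. E s t - F s t)"
  using negligible_add[OF _ negligible_cmult[of F "-1"]] by simp

text \<open>Vanishing of the bracket of \<open>f\<close> and \<open>g\<close>: this is the point at
  which regularity above 1/2 excludes a correction term in the product rule.\<close>

lemma negligible_product:
  assumes "f \<in> H" "g \<in> H"
  shows "negligible (\<lambda>s t. (f t - f s) * (g t - g s))"
proof (rule negligibleI_powr[where \<theta> = "\<alpha> + 1 / 2"])
  fix e :: real assume "e > 0"
  obtain \<delta> where \<delta>: "\<delta> > 0"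
    "\<And>s x y x' y' t. 0 \<le> s \<Longrightarrow> s \<le> x \<Longrightarrow> x \<le> y \<Longrightarrow> y \<le> t \<Longrightarrow> s \<le> x' \<Longrightarrow> x' \<le> y' \<Longrightarrow> y' \<le> t \<Longrightarrow>
       t \<le> T \<Longrightarrow> t - s < \<delta> \<Longrightarrow>
       \<bar>f y - f x\<bar> * \<bar>g y' - g x'\<bar> \<le> e * (v t - v s) powr (\<alpha> + 1 / 2)"
    by (rule young_local[OF assms \<open>e > 0\<close>]) blast
  then show "\<exists>\<delta>>0. \<forall>s t. 0 \<le> s \<longrightarrow> s \<le> t \<longrightarrow> t \<le> T \<longrightarrow> t - s < \<delta> \<longrightarrow>
      \<bar>(f t - f s) * (g t - g s)\<bar> \<le> e * (v t - v s) powr (\<alpha> + 1 / 2)"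
    by (intro exI[of _ \<delta>]) (auto simp: abs_mult)
qed (use theta in auto)

text \<open>A Riemann sum differs from the telescoping increments of \<open>J\<close> by moving tags
  to left endpoints, bounded by \<open>young_local\<close>, and by the left-point errors of
  \<open>J\<close>, which are negligible.\<close>

lemma has_RS_integral_of_rs_diff:
  assumes "f \<in> H" "g \<in> H" "rs_diff f g J" "0 \<le> a" "a \<le> b" "b \<le> T"
  shows "has_RS_integral f g a b (J b - J a)"
  unfolding has_RS_integral_iff_tendsto tendsto_iff eventually_RS_filter
proof (intro allI impI)
  fix e :: real assume "e > 0"
  define W where "W = v b - v a"
  have W: "W \<ge> 0" using v_mono[of a b] assms by (simp add: W_def)
  \<comment> \<open>The tag errors sum to at most \<open>e' * W powr (\<alpha> + 1 / 2)\<close>, the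
    errors of \<open>J\<close> to at most \<open>e' * W\<close>; the 1 keeps the denominator
    positive.\<close>
  define e' where "e' = e / (2 * (W + W powr (\<alpha> + 1 / 2) + 1))"
  have e': "e' > 0" using \<open>e > 0\<close> W by (simp add: e'_def add_nonneg_pos)
  obtain d where d: "d > 0" "\<And>s t. 0 \<le> s \<Longrightarrow> s \<le> t \<Longrightarrow> t \<le> T \<Longrightarrow> t - s < d \<Longrightarrow>
      \<bar>J t - J s - f s * (g t - g s)\<bar> \<le> e' * (v t - v s)"
    by (rule negligibleE[OF assms(3)[unfolded rs_diff_def] e']) blast
  obtain d' where d': "d' > 0"
    "\<And>s x y x' y' t. 0 \<le> s \<Longrightarrow> s \<le> x \<Longrightarrow> x \<le> y \<Longrightarrow> y \<le> t \<Longrightarrow> s \<le> x' \<Longrightarrow> x' \<le> y' \<Longrightarrow> y' \<le> t \<Longrightarrow>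
       t \<le> T \<Longrightarrow> t - s < d' \<Longrightarrow>
       \<bar>f y - f x\<bar> * \<bar>g y' - g x'\<bar> \<le> e' * (v t - v s) powr (\<alpha> + 1 / 2)"
    by (rule young_local[OF assms(1,2) e']) blast
  have "dist (RS_sum f g P) (J b - J a) < e" if "tagged_seq (min d d') a b P" for P
  proof -
    obtain n u \<xi> where P: "P = (n, u, \<xi>)" by (cases P)
    note t = that[unfolded P]
    have r: "0 \<le> u k" "u k \<le> T" if "k \<le> n" for k
      using tagged_seq_range[OF t that] assms by auto
    have tel: "J b - J a = (\<Sum>k<n. J (u (Suc k)) - J (u k))"
      using tagged_seqD(1,2)[OF t] sum_lessThan_telescope[of "\<lambda>k. J (u k)" n] by simp
    have telv: "W = (\<Sum>k<n. v (u (Suc k)) - v (u k))"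
      using tagged_seqD(1,2)[OF t] sum_lessThan_telescope[of "\<lambda>k. v (u k)" n] by (simp add: W_def)
    have "RS_sum f g P - (J b - J a) =
        (\<Sum>k<n. (f (\<xi> k) - f (u k)) * (g (u (Suc k)) - g (u k))
          - (J (u (Suc k)) - J (u k) - f (u k) * (g (u (Suc k)) - g (u k))))"
      unfolding tel P RS_sum_def by (simp add: sum_subtractf[symmetric] algebra_simps)
    then have "\<bar>RS_sum f g P - (J b - J a)\<bar> \<le>
        (\<Sum>k<n. \<bar>(f (\<xi> k) - f (u k)) * (g (u (Suc k)) - g (u k))
          - (J (u (Suc k)) - J (u k) - f (u k) * (g (u (Suc k)) - g (u k)))\<bar>)"
      by (simp add: sum_abs)
    also have "\<dots> \<le> (\<Sum>k<n. e' * (v (u (Suc k)) - v (u k)) powr (\<alpha> + 1 / 2)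
        + e' * (v (u (Suc k)) - v (u k)))"
    proof (rule sum_mono)
      fix k assume k: "k \<in> {..<n}"
      have "\<bar>f (\<xi> k) - f (u k)\<bar> * \<bar>g (u (Suc k)) - g (u k)\<bar>
          \<le> e' * (v (u (Suc k)) - v (u k)) powr (\<alpha> + 1 / 2)"
        using tagged_seqD(3-6)[OF t, of k] k r[of k] r[of "Suc k"] by (intro d'(2)) auto
      moreover have "\<bar>J (u (Suc k)) - J (u k) - f (u k) * (g (u (Suc k)) - g (u k))\<bar>
          \<le> e' * (v (u (Suc k)) - v (u k))"
        using tagged_seqD(3-6)[OF t, of k] k r[of k] r[of "Suc k"] by (intro d(2)) auto
      ultimately show "\<bar>(f (\<xi> k) - f (u k)) * (g (u (Suc k)) - g (u k))
          - (J (u (Suc k)) - J (u k) - f (u k) * (g (u (Suc k)) - g (u k)))\<bar>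
          \<le> e' * (v (u (Suc k)) - v (u k)) powr (\<alpha> + 1 / 2) + e' * (v (u (Suc k)) - v (u k))"
        unfolding abs_mult[symmetric] by linarith
    qed
    also have "\<dots> = e' * (\<Sum>k<n. (v (u (Suc k)) - v (u k)) powr (\<alpha> + 1 / 2)) + e' * W"
      unfolding telv by (simp add: sum.distrib sum_distrib_left)
    also have "(\<Sum>k<n. (v (u (Suc k)) - v (u k)) powr (\<alpha> + 1 / 2)) \<le> W powr (\<alpha> + 1 / 2)"
    proof -
      have "(\<Sum>k<n. (v (u (Suc k)) - v (u k)) powr (\<alpha> + 1 / 2)) \<le> (v (u n) - v (u 0)) powr (\<alpha> + 1 / 2)"
        using theta tagged_seq_mono[OF t] r by (intro sum_powr_increments_le v_mono) auto
      then show ?thesis using tagged_seqD(1,2)[OF t] by (simp add: W_def)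
    qed
    finally have "\<bar>RS_sum f g P - (J b - J a)\<bar> \<le> e' * W powr (\<alpha> + 1 / 2) + e' * W"
      using e' by simp
    also have "\<dots> = e' * (W + W powr (\<alpha> + 1 / 2))" by (simp add: algebra_simps)
    also have "\<dots> < e"
    proof -
      have "e' * (W + W powr (\<alpha> + 1 / 2)) \<le> e' * (W + W powr (\<alpha> + 1 / 2) + 1)"
        using e' by (intro mult_left_mono) auto
      also have "\<dots> = e / 2"
      proof -
        have "W + W powr (\<alpha> + 1 / 2) + 1 \<noteq> 0"
          using add_nonneg_pos[of "W + W powr (\<alpha> + 1 / 2)" 1] W by simp
        moreover have "e / (2 * x) * x = e / 2" if "x \<noteq> 0" for x :: real using that by simp
        ultimately show ?thesis unfolding e'_def by blast
      qed
      finally show ?thesis using \<open>e > 0\<close> by simp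
    qed
    finally show ?thesis by (simp add: dist_real_def)
  qed
  then show "\<exists>\<delta>>0. \<forall>P. tagged_seq \<delta> a b P \<longrightarrow> dist (RS_sum f g P) (J b - J a) < e"
    using d(1) d'(1) by (intro exI[of _ "min d d'"]) auto
qed

text \<open>In each interval of \<open>u\<close> the clamped points of \<open>w\<close> form a
  partition, and \<open>discrete_young\<close> compares its sum with the single left-point term.
  Since \<open>bd\<close> concerns only intervals shorter than \<delta>, the constant
  \<open>K\<close> may be taken small.\<close>

lemma RS_sum_refine:
  assumes K: "K \<ge> 0" and \<theta>: "\<theta> > 1"
    and bd: "\<And>x y z. 0 \<le> x \<Longrightarrow> x \<le> y \<Longrightarrow> y \<le> z \<Longrightarrow> z \<le> T \<Longrightarrow> z - x < \<delta> \<Longrightarrow>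
        \<bar>f y - f x\<bar> * \<bar>g z - g y\<bar> \<le> K * (v z - v x) powr \<theta>"
    and ab: "0 \<le> a" "b \<le> T"
    and u: "tagged_seq \<delta> a b (n, u, u)" and w: "tagged_seq \<delta>' a b (m, w, w)"
  shows "\<bar>(\<Sum>k<n. \<Sum>l<m. f (clamp_to (u k) (u (Suc k)) (w l)) *
      (g (clamp_to (u k) (u (Suc k)) (w (Suc l))) - g (clamp_to (u k) (u (Suc k)) (w l))))
    - RS_sum f g (n, u, u)\<bar> \<le> K * young_const \<theta> * (v b - v a) powr \<theta>"
proof -
  define F where "F k = (\<Sum>l<m. f (clamp_to (u k) (u (Suc k)) (w l)) *
      (g (clamp_to (u k) (u (Suc k)) (w (Suc l))) - g (clamp_to (u k) (u (Suc k)) (w l))))" for k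
  have r: "0 \<le> u k" "u k \<le> T" if "k \<le> n" for k
    using tagged_seq_range[OF u that] ab by auto
  have F: "\<bar>F k - f (u k) * (g (u (Suc k)) - g (u k))\<bar>
      \<le> K * young_const \<theta> * (v (u (Suc k)) - v (u k)) powr \<theta>" if k: "k < n" for k
  proof -
    \<comment> \<open>Points of \<open>w\<close> outside the interval collapse onto its endpoints,
      so \<open>c\<close> runs from \<open>u k\<close> to \<open>u (Suc k)\<close>, possibly with
      steps of length 0.\<close>
    define c where "c l = clamp_to (u k) (u (Suc k)) (w l)" for l
    note uk = tagged_seqD(3-6)[OF u k]
    have c0: "c 0 = u k" unfolding c_def
      using tagged_seqD(1)[OF w] tagged_seq_range(1)[OF u, of k] k uk by (intro clamp_to_low) auto
    have cm: "c m = u (Suc k)" unfolding c_def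
      using tagged_seqD(2)[OF w] tagged_seq_range(2)[OF u, of "Suc k"] k uk by (intro clamp_to_high) auto
    have cr: "u k \<le> c l" "c l \<le> u (Suc k)" for l
      unfolding c_def using clamp_to_range[OF uk(4)] by auto
    have cr': "0 \<le> c l" "c l \<le> T" for l
      using cr[of l] r[of k] r[of "Suc k"] k by auto
    have cmono: "c i \<le> c j" if "i \<le> j" "j \<le> m" for i j
      unfolding c_def using tagged_seq_mono[OF w that] by (rule clamp_to_mono)
    have "\<bar>(\<Sum>l=0..<m. f (c l) * (g (c (Suc l)) - g (c l))) - f (c 0) * (g (c m) - g (c 0))\<bar>
        \<le> K * young_const \<theta> * (v (c m) - v (c 0)) powr \<theta>"
    proof (rule discrete_young[where N = m and c = "\<lambda>l. v (c l)"])
      fix i j assume "i \<le> j" "j \<le> m"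
      then show "v (c i) \<le> v (c j)" using cmono cr' by (intro v_mono) auto
    next
      fix i j l assume *: "i \<le> j" "j \<le> l" "l \<le> m"
      have "c l - c i < \<delta>" using cr[of l] cr[of i] uk(3) by linarith
      then show "\<bar>f (c j) - f (c i)\<bar> * \<bar>g (c l) - g (c j)\<bar> \<le> K * (v (c l) - v (c i)) powr \<theta>"
        using * cmono[of i j] cmono[of j l] cr' by (intro bd) auto
    qed (use K \<theta> in auto)
    then show ?thesis by (simp add: c0 cm F_def c_def[symmetric] atLeast0LessThan)
  qed
  have "\<bar>(\<Sum>k<n. F k) - RS_sum f g (n, u, u)\<bar>
      = \<bar>\<Sum>k<n. F k - f (u k) * (g (u (Suc k)) - g (u k))\<bar>"
    by (simp add: RS_sum_def sum_subtractf)
  also have "\<dots> \<le> (\<Sum>k<n. \<bar>F k - f (u k) * (g (u (Suc k)) - g (u k))\<bar>)" by (rule sum_abs)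
  also have "\<dots> \<le> (\<Sum>k<n. K * young_const \<theta> * (v (u (Suc k)) - v (u k)) powr \<theta>)"
    using F by (intro sum_mono) auto
  also have "\<dots> = K * young_const \<theta> * (\<Sum>k<n. (v (u (Suc k)) - v (u k)) powr \<theta>)"
    by (simp add: sum_distrib_left)
  also have "\<dots> \<le> K * young_const \<theta> * (v (u n) - v (u 0)) powr \<theta>"
    using \<theta> K young_const_pos[OF \<theta>] tagged_seq_mono[OF u] r
    by (intro mult_left_mono sum_powr_increments_le v_mono) auto
  finally show ?thesis using tagged_seqD(1,2)[OF u] by (simp add: F_def)
qed

text \<open>Tags are moved to left endpoints, and both partitions are compared with their common
  refinement. By \<open>clamp_to_swap\<close> the refined sum is the same double sum seen from
  either partition.\<close>

lemma RS_sum_Cauchy: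
  assumes fg: "f \<in> H" "g \<in> H" and ab: "0 \<le> a" "a \<le> b" "b \<le> T" and e: "e > 0"
  obtains \<delta> where "\<delta> > 0"
    "\<And>P m w. tagged_seq \<delta> a b P \<Longrightarrow> tagged_seq \<delta> a b (m, w, w) \<Longrightarrow>
       \<bar>RS_sum f g P - RS_sum f g (m, w, w)\<bar> \<le> e"
proof -
  define \<theta> where "\<theta> = \<alpha> + 1 / 2"
  have \<theta>: "\<theta> > 1" using theta by (simp add: \<theta>_def)
  \<comment> \<open>One tag error and two refinement errors, in units of \<open>K\<close>; the
    leading 1 keeps \<open>Q\<close> positive.\<close>
  define Q where "Q = 1 + (1 + 2 * young_const \<theta>) * (v b - v a) powr \<theta>"
  have Q: "Q > 0" using young_const_pos[OF \<theta>] by (simp add: Q_def add_pos_nonneg)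
  define K where "K = e / Q"
  have K: "K > 0" using Q e by (simp add: K_def)
  obtain \<delta> where \<delta>: "\<delta> > 0"
    "\<And>s x y x' y' t. 0 \<le> s \<Longrightarrow> s \<le> x \<Longrightarrow> x \<le> y \<Longrightarrow> y \<le> t \<Longrightarrow> s \<le> x' \<Longrightarrow> x' \<le> y' \<Longrightarrow> y' \<le> t \<Longrightarrow>
       t \<le> T \<Longrightarrow> t - s < \<delta> \<Longrightarrow> \<bar>f y - f x\<bar> * \<bar>g y' - g x'\<bar> \<le> K * (v t - v s) powr \<theta>"
    unfolding \<theta>_def by (rule young_local[OF fg K]) blast
  show thesis
  proof (rule that[OF \<delta>(1)])
    fix P m w assume P': "tagged_seq \<delta> a b P" and w: "tagged_seq \<delta> a b (m, w, w)"
    obtain n u \<xi> where P: "P = (n, u, \<xi>)" by (cases P)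
    note t = P'[unfolded P]
    have u: "tagged_seq \<delta> a b (n, u, u)"
      unfolding tagged_seq_def using tagged_seqD[OF t] by auto
    have r: "0 \<le> u k" "u k \<le> T" if "k \<le> n" for k
      using tagged_seq_range[OF u that] ab by auto
    have bd: "\<bar>f y - f x\<bar> * \<bar>g z - g y\<bar> \<le> K * (v z - v x) powr \<theta>"
      if "0 \<le> x" "x \<le> y" "y \<le> z" "z \<le> T" "z - x < \<delta>" for x y z
      using that by (intro \<delta>(2)) auto
    let ?S = "(\<Sum>k<n. \<Sum>l<m. f (clamp_to (u k) (u (Suc k)) (w l)) *
      (g (clamp_to (u k) (u (Suc k)) (w (Suc l))) - g (clamp_to (u k) (u (Suc k)) (w l))))"
    have "?S
      = (\<Sum>k<n. \<Sum>l<m. f (clamp_to (w l) (w (Suc l)) (u k)) *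
      (g (clamp_to (w l) (w (Suc l)) (u (Suc k))) - g (clamp_to (w l) (w (Suc l)) (u k))))"
      using tagged_seqD(6)[OF u] tagged_seqD(6)[OF w]
      by (intro sum.cong refl clamp_to_swap) auto
    also have "\<dots> = (\<Sum>l<m. \<Sum>k<n. f (clamp_to (w l) (w (Suc l)) (u k)) *
      (g (clamp_to (w l) (w (Suc l)) (u (Suc k))) - g (clamp_to (w l) (w (Suc l)) (u k))))"
      by (rule sum.swap)
    finally have swap: "?S = \<dots>" .
    have "\<bar>RS_sum f g P - RS_sum f g (n, u, u)\<bar>
        = \<bar>\<Sum>k<n. (f (\<xi> k) - f (u k)) * (g (u (Suc k)) - g (u k))\<bar>"
      unfolding P RS_sum_def by (simp add: sum_subtractf[symmetric] algebra_simps)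
    also have "\<dots> \<le> (\<Sum>k<n. \<bar>(f (\<xi> k) - f (u k)) * (g (u (Suc k)) - g (u k))\<bar>)" by (rule sum_abs)
    also have "\<dots> \<le> (\<Sum>k<n. K * (v (u (Suc k)) - v (u k)) powr \<theta>)"
    proof (rule sum_mono)
      fix k assume "k \<in> {..<n}"
      then have k: "k < n" "k \<le> n" "Suc k \<le> n" by auto
      note uk = tagged_seqD(3-6)[OF t k(1)] r[OF k(2)] r[OF k(3)]
      show "\<bar>(f (\<xi> k) - f (u k)) * (g (u (Suc k)) - g (u k))\<bar>
          \<le> K * (v (u (Suc k)) - v (u k)) powr \<theta>"
        unfolding abs_mult by (rule \<delta>(2)) (use uk in \<open>simp_all only: order_refl\<close>)
    qed
    also have "\<dots> = K * (\<Sum>k<n. (v (u (Suc k)) - v (u k)) powr \<theta>)" by (simp add: sum_distrib_left)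
    also have "\<dots> \<le> K * (v (u n) - v (u 0)) powr \<theta>"
      using \<theta> K tagged_seq_mono[OF u] r by (intro mult_left_mono sum_powr_increments_le v_mono) auto
    finally have 1: "\<bar>RS_sum f g P - RS_sum f g (n, u, u)\<bar> \<le> K * (v b - v a) powr \<theta>"
      using tagged_seqD(1,2)[OF u] by simp
    have 2: "\<bar>?S - RS_sum f g (n, u, u)\<bar> \<le> K * young_const \<theta> * (v b - v a) powr \<theta>"
      by (rule RS_sum_refine[OF less_imp_le[OF K] \<theta> _ ab(1,3) u w]) (rule bd)
    have 3: "\<bar>?S - RS_sum f g (m, w, w)\<bar> \<le> K * young_const \<theta> * (v b - v a) powr \<theta>"
      unfolding swap by (rule RS_sum_refine[OF less_imp_le[OF K] \<theta> _ ab(1,3) w u]) (rule bd)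
    have "\<bar>RS_sum f g P - RS_sum f g (m, w, w)\<bar> \<le> K * (v b - v a) powr \<theta>
        + 2 * (K * young_const \<theta> * (v b - v a) powr \<theta>)"
      using 1 2 3 by linarith
    also have "\<dots> = K * (Q - 1)" by (simp add: Q_def algebra_simps)
    also have "\<dots> \<le> K * Q" using K by simp
    also have "\<dots> = e" using Q by (simp add: K_def)
    finally show "\<bar>RS_sum f g P - RS_sum f g (m, w, w)\<bar> \<le> e" .
  qed
qed

text \<open>Completeness of the reals yields a limit of left-point sums of mesh below
  \<open>1 / real (Suc i)\<close>. By \<open>RS_sum_Cauchy\<close> every fine tagged sum is close to
  these, so the limit is the integral.\<close>

lemma has_RS_integral_exists:
  assumes fg: "f \<in> H" "g \<in> H" and ab: "0 \<le> a" "a \<le> b" "b \<le> T"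
  shows "\<exists>I. has_RS_integral f g a b I"
proof -
  have "\<exists>p. tagged_seq (1 / real (Suc i)) a b (fst p, snd p, snd p)" for i
  proof -
    obtain n u where "tagged_seq (1 / real (Suc i)) a b (n, u, u)"
      using ex_tagged_seq[OF ab(2), of "1 / real (Suc i)"] by auto
    then show ?thesis by (intro exI[of _ "(n, u)"]) simp
  qed
  then obtain p where p: "\<And>i. tagged_seq (1 / real (Suc i)) a b (fst (p i), snd (p i), snd (p i))"
    by metis
  define X where "X i = RS_sum f g (fst (p i), snd (p i), snd (p i))" for i
  have fine: "\<exists>N. \<forall>i\<ge>N. tagged_seq \<delta> a b (fst (p i), snd (p i), snd (p i))" if d: "\<delta> > 0" for \<delta>
  proof -
    obtain N where N: "1 / real (Suc N) < \<delta>" using nat_approx_posE[OF d] by blast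
    have "1 / real (Suc i) \<le> \<delta>" if "i \<ge> N" for i
      using N frac_le[of 1 1 "real (Suc N)" "real (Suc i)"] that by simp
    then show ?thesis using tagged_seq_mesh_mono[OF p] by blast
  qed
  have "Cauchy X"
    unfolding Cauchy_def
  proof (intro allI impI)
    fix e :: real assume "e > 0"
    then have "e / 2 > 0" by simp
    obtain \<delta> where \<delta>: "\<delta> > 0"
      "\<And>P m w. tagged_seq \<delta> a b P \<Longrightarrow> tagged_seq \<delta> a b (m, w, w) \<Longrightarrow>
       \<bar>RS_sum f g P - RS_sum f g (m, w, w)\<bar> \<le> e / 2"
      by (rule RS_sum_Cauchy[OF fg ab \<open>e / 2 > 0\<close>]) blast
    obtain N where N: "\<And>i. i \<ge> N \<Longrightarrow> tagged_seq \<delta> a b (fst (p i), snd (p i), snd (p i))"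
      using fine[OF \<delta>(1)] by blast
    have "dist (X i) (X j) < e" if "i \<ge> N" "j \<ge> N" for i j
      using \<delta>(2)[OF N[OF that(1)] N[OF that(2)]] \<open>e > 0\<close> by (simp add: X_def dist_real_def)
    then show "\<exists>M. \<forall>m\<ge>M. \<forall>n\<ge>M. dist (X m) (X n) < e" by blast
  qed
  then obtain L where L: "X \<longlonglongrightarrow> L" using Cauchy_convergent_iff convergent_def by blast
  have "has_RS_integral f g a b L"
    unfolding has_RS_integral_iff_tendsto tendsto_iff eventually_RS_filter
  proof (intro allI impI)
    fix e :: real assume "e > 0"
    then have "e / 2 > 0" by simp
    obtain \<delta> where \<delta>: "\<delta> > 0"
      "\<And>P m w. tagged_seq \<delta> a b P \<Longrightarrow> tagged_seq \<delta> a b (m, w, w) \<Longrightarrow>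
       \<bar>RS_sum f g P - RS_sum f g (m, w, w)\<bar> \<le> e / 2"
      by (rule RS_sum_Cauchy[OF fg ab \<open>e / 2 > 0\<close>]) blast
    obtain N where N: "\<And>i. i \<ge> N \<Longrightarrow> tagged_seq \<delta> a b (fst (p i), snd (p i), snd (p i))"
      using fine[OF \<delta>(1)] by blast
    have "dist (RS_sum f g P) L < e" if P: "tagged_seq \<delta> a b P" for P
    proof -
      have "(\<lambda>i. \<bar>RS_sum f g P - X i\<bar>) \<longlonglongrightarrow> \<bar>RS_sum f g P - L\<bar>"
        by (intro tendsto_intros L)
      moreover have "\<forall>i\<ge>N. \<bar>RS_sum f g P - X i\<bar> \<le> e / 2"
        using \<delta>(2)[OF P N] by (simp add: X_def)
      ultimately have "\<bar>RS_sum f g P - L\<bar> \<le> e / 2" using LIMSEQ_le_const2 by blast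
      then show ?thesis using \<open>e > 0\<close> by (simp add: dist_real_def)
    qed
    then show "\<exists>\<delta>>0. \<forall>P. tagged_seq \<delta> a b P \<longrightarrow> dist (RS_sum f g P) L < e" using \<delta>(1) by blast
  qed
  then show ?thesis by blast
qed

text \<open>The Young-Loeve inequality: the bound of \<open>discrete_young\<close> does not depend
  on the partition and survives the limit.\<close>

lemma young_estimate:
  assumes I: "has_RS_integral f g s t I" and st: "0 \<le> s" "s \<le> t" "t \<le> T"
    and K: "K \<ge> 0" and \<theta>: "\<theta> > 1"
    and bd: "\<And>x y z. s \<le> x \<Longrightarrow> x \<le> y \<Longrightarrow> y \<le> z \<Longrightarrow> z \<le> t \<Longrightarrow>
        \<bar>f y - f x\<bar> * \<bar>g z - g y\<bar> \<le> K * (v z - v x) powr \<theta>"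
  shows "\<bar>I - f s * (g t - g s)\<bar> \<le> K * young_const \<theta> * (v t - v s) powr \<theta>"
proof (rule field_le_epsilon)
  fix e :: real assume "e > 0"
  then obtain \<delta> where \<delta>: "\<delta> > 0" "\<And>P. tagged_seq \<delta> s t P \<Longrightarrow> dist (RS_sum f g P) I < e"
    using I unfolding has_RS_integral_iff_tendsto tendsto_iff eventually_RS_filter by blast
  obtain n u where u: "tagged_seq \<delta> s t (n, u, u)" using ex_tagged_seq[OF st(2) \<delta>(1)] by blast
  note r = tagged_seq_range[OF u]
  have "\<bar>(\<Sum>k=0..<n. f (u k) * (g (u (Suc k)) - g (u k))) - f (u 0) * (g (u n) - g (u 0))\<bar>
      \<le> K * young_const \<theta> * (v (u n) - v (u 0)) powr \<theta>"
  proof (rule discrete_young[where N = n and c = "\<lambda>k. v (u k)"])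
    fix i j assume *: "i \<le> j" "j \<le> n"
    then show "v (u i) \<le> v (u j)"
      using tagged_seq_mono[OF u *] r[of i] r[of j] st by (intro v_mono) auto
  next
    fix i j l assume *: "i \<le> j" "j \<le> l" "l \<le> n"
    then show "\<bar>f (u j) - f (u i)\<bar> * \<bar>g (u l) - g (u j)\<bar> \<le> K * (v (u l) - v (u i)) powr \<theta>"
      using tagged_seq_mono[OF u] r by (intro bd) auto
  qed (use K \<theta> in auto)
  then have "\<bar>RS_sum f g (n, u, u) - f s * (g t - g s)\<bar> \<le> K * young_const \<theta> * (v t - v s) powr \<theta>"
    using tagged_seqD(1,2)[OF u] by (simp add: RS_sum_def atLeast0LessThan)
  then show "\<bar>I - f s * (g t - g s)\<bar> \<le> K * young_const \<theta> * (v t - v s) powr \<theta> + e"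
    using \<delta>(2)[OF u] unfolding dist_real_def by linarith
qed

text \<open>Integration does not leave \<open>H\<close>, which lets integrals be iterated. The
  increment of \<open>J\<close> is a left-point term plus a Young error of exponent
  \<open>2 * \<alpha>\<close>, in which one factor of exponent \<alpha> is bounded by the total
  increase.\<close>

lemma rs_diff_imp_H:
  assumes fg: "f \<in> H" "g \<in> H" and J: "rs_diff f g J"
  shows "J \<in> H"
proof -
  obtain K where K: "K \<ge> 0"
    "\<And>x y z. 0 \<le> x \<Longrightarrow> x \<le> y \<Longrightarrow> y \<le> z \<Longrightarrow> z \<le> T \<Longrightarrow>
       \<bar>f y - f x\<bar> * \<bar>g z - g y\<bar> \<le> K * (v z - v x) powr (2 * \<alpha>)"
    by (rule young_global[OF fg]) blast
  obtain M where M: "M > 0" "\<And>s. 0 \<le> s \<Longrightarrow> s \<le> T \<Longrightarrow> \<bar>f s\<bar> \<le> M"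
    by (rule H_bounded[OF fg(1)]) blast
  obtain D where D: "D \<ge> 0" "\<And>s t. 0 \<le> s \<Longrightarrow> s \<le> t \<Longrightarrow> t \<le> T \<Longrightarrow> \<bar>g t - g s\<bar> \<le> D * (v t - v s) powr \<alpha>"
    by (rule HE[OF fg(2)]) blast
  let ?Y = "young_const (2 * \<alpha>)"
  have Y: "?Y > 0" using young_const_pos theta by simp
  have est: "\<bar>J t - J s\<bar> \<le> M * \<bar>g t - g s\<bar> + K * ?Y * (v t - v s) powr (2 * \<alpha>)"
    if "0 \<le> s" "s \<le> t" "t \<le> T" for s t
  proof -
    have "\<bar>J t - J s - f s * (g t - g s)\<bar> \<le> K * ?Y * (v t - v s) powr (2 * \<alpha>)"
      using that K theta has_RS_integral_of_rs_diff[OF fg J that] by (intro young_estimate) auto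
    moreover have "\<bar>f s * (g t - g s)\<bar> \<le> M * \<bar>g t - g s\<bar>"
      unfolding abs_mult using M(2)[of s] that by (intro mult_right_mono) auto
    ultimately show ?thesis by linarith
  qed
  show ?thesis
  proof (rule HI[of _ "M * D + K * ?Y * (v T - v 0) powr \<alpha>"])
    show "0 \<le> M * D + K * ?Y * (v T - v 0) powr \<alpha>" using M D K Y by simp
    fix s t assume st: "0 \<le> s" "s \<le> t" "t \<le> T"
    define W where "W = v t - v s"
    have W: "W \<ge> 0" "W \<le> v T - v 0" using v_diff_mono[of 0 s t T] st by (auto simp: W_def)
    have "W powr (2 * \<alpha>) = W powr \<alpha> * W powr \<alpha>" by (simp add: powr_add[symmetric])
    also have "\<dots> \<le> (v T - v 0) powr \<alpha> * W powr \<alpha>"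
      using W alpha by (intro mult_right_mono powr_mono2) auto
    finally have "K * ?Y * W powr (2 * \<alpha>) \<le> K * ?Y * ((v T - v 0) powr \<alpha> * W powr \<alpha>)"
      using K Y by (intro mult_left_mono) auto
    moreover have "M * \<bar>g t - g s\<bar> \<le> M * (D * W powr \<alpha>)"
      using D(2)[OF st] M by (simp add: W_def)
    ultimately show "\<bar>J t - J s\<bar> \<le> (M * D + K * ?Y * (v T - v 0) powr \<alpha>) * (v t - v s) powr \<alpha>"
      using est[OF st] unfolding W_def by (simp add: algebra_simps)
  next
    \<comment> \<open>The Hoelder bound does not give continuity where \<open>v\<close> jumps; small
      left-point errors together with uniform continuity of \<open>g\<close> do.\<close>
    show "continuous_on {0..T} J"
      unfolding continuous_on_iff
    proof (intro ballI allI impI)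
      fix x e :: real assume x: "x \<in> {0..T}" and e: "e > 0"
      define e1 where "e1 = e / (2 * (v T - v 0 + 1))"
      have vT: "v T - v 0 + 1 > 0" using v_mono[of 0 T] T_nonneg by simp
      have e1: "e1 > 0" using e vT by (simp add: e1_def)
      define e2 where "e2 = e / (4 * M)"
      have e2: "e2 > 0" using e M by (simp add: e2_def)
      obtain d where d: "d > 0" "\<And>s t. 0 \<le> s \<Longrightarrow> s \<le> t \<Longrightarrow> t \<le> T \<Longrightarrow> t - s < d \<Longrightarrow>
          \<bar>J t - J s - f s * (g t - g s)\<bar> \<le> e1 * (v t - v s)"
        by (rule negligibleE[OF J[unfolded rs_diff_def] e1]) blast
      obtain d' where d': "d' > 0" "\<And>s t. 0 \<le> s \<Longrightarrow> s \<le> t \<Longrightarrow> t \<le> T \<Longrightarrow> t - s < d' \<Longrightarrow> \<bar>g t - g s\<bar> \<le> e2"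
        by (rule H_fine[OF fg(2) e2]) blast
      have *: "\<bar>J t - J s\<bar> < e" if st: "0 \<le> s" "s \<le> t" "t \<le> T" "t - s < min d d'" for s t
      proof -
        have "\<bar>J t - J s - f s * (g t - g s)\<bar> \<le> e1 * (v t - v s)" using d st by auto
        also have "\<dots> \<le> e1 * (v T - v 0 + 1)"
          using v_diff_mono[of 0 s t T] st e1 by (intro mult_left_mono) auto
        also have "\<dots> = e / 2" using vT by (simp add: e1_def field_simps)
        finally have 1: "\<bar>J t - J s - f s * (g t - g s)\<bar> \<le> e / 2" .
        have "\<bar>f s * (g t - g s)\<bar> \<le> M * e2"
          unfolding abs_mult using M st d'(2)[of s t] e2 by (intro mult_mono) auto
        also have "\<dots> = e / 4" using M by (simp add: e2_def)
        finally show ?thesis using 1 e by linarith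
      qed
      have "dist (J x') (J x) < e" if "x' \<in> {0..T}" "dist x' x < min d d'" for x'
        using *[of x x'] *[of x' x] that x
        by (cases "x \<le> x'") (auto simp: dist_real_def abs_minus_commute)
      then show "\<exists>d>0. \<forall>x'\<in>{0..T}. dist x' x < d \<longrightarrow> dist (J x') (J x) < e"
        using d(1) d'(1) by (intro exI[of _ "min d d'"]) auto
    qed
  qed
qed

text \<open>By additivity over adjacent intervals an increment is the integral over
  \<open>[s, t]\<close>, and there the Young-Loeve inequality applies with the small constant
  supplied by \<open>young_local\<close>.\<close>

lemma rs_diff_exists:
  assumes fg: "f \<in> H" "g \<in> H"
  shows "rs_diff f g (RS_integral f g 0)"
proof -
  let ?J = "RS_integral f g 0"
  have I: "has_RS_integral f g 0 t (?J t)" if "0 \<le> t" "t \<le> T" for t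
    using has_RS_integral_exists[OF fg _ that] RS_integral_eq that by fastforce
  have J: "has_RS_integral f g s t (?J t - ?J s)" if st: "0 \<le> s" "s \<le> t" "t \<le> T" for s t
  proof -
    obtain K where "has_RS_integral f g s t K" using has_RS_integral_exists[OF fg st] by blast
    moreover from has_RS_integral_combine[OF I I this] st have "?J t = ?J s + K" by simp
    ultimately show ?thesis by simp
  qed
  define \<theta> where "\<theta> = \<alpha> + 1 / 2"
  have \<theta>: "\<theta> > 1" using theta by (simp add: \<theta>_def)
  note Y = young_const_pos[OF \<theta>]
  show ?thesis unfolding rs_diff_def
  proof (rule negligibleI_powr[where \<theta> = \<theta>])
    fix e :: real assume "e > 0"
    then have e': "e / young_const \<theta> > 0" using Y by simp
    obtain \<delta> where \<delta>: "\<delta> > 0"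
      "\<And>s x y x' y' t. 0 \<le> s \<Longrightarrow> s \<le> x \<Longrightarrow> x \<le> y \<Longrightarrow> y \<le> t \<Longrightarrow> s \<le> x' \<Longrightarrow> x' \<le> y' \<Longrightarrow> y' \<le> t \<Longrightarrow>
       t \<le> T \<Longrightarrow> t - s < \<delta> \<Longrightarrow> \<bar>f y - f x\<bar> * \<bar>g y' - g x'\<bar> \<le> e / young_const \<theta> * (v t - v s) powr \<theta>"
      unfolding \<theta>_def by (rule young_local[OF fg e'[unfolded \<theta>_def]]) blast
    have "\<bar>?J t - ?J s - f s * (g t - g s)\<bar> \<le> e * (v t - v s) powr \<theta>"
      if st: "0 \<le> s" "s \<le> t" "t \<le> T" "t - s < \<delta>" for s t
    proof -
      have "\<bar>?J t - ?J s - f s * (g t - g s)\<bar> \<le> e / young_const \<theta> * young_const \<theta> * (v t - v s) powr \<theta>"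
      proof (rule young_estimate[OF J])
        fix x y z assume "s \<le> x" "x \<le> y" "y \<le> z" "z \<le> t"
        then show "\<bar>f y - f x\<bar> * \<bar>g z - g y\<bar> \<le> e / young_const \<theta> * (v z - v x) powr \<theta>"
          using st by (intro \<delta>(2)) auto
      qed (use st e' \<theta> in auto)
      then show ?thesis using Y by simp
    qed
    then show "\<exists>\<delta>>0. \<forall>s t. 0 \<le> s \<longrightarrow> s \<le> t \<longrightarrow> t \<le> T \<longrightarrow> t - s < \<delta> \<longrightarrow>
        \<bar>?J t - ?J s - f s * (g t - g s)\<bar> \<le> e * (v t - v s) powr \<theta>"
      using \<delta>(1) by (intro exI[of _ \<delta>]) auto
  qed (use \<theta> in auto)
qed

text \<open>Such a \<open>D\<close> is a primitive for the integral of 0 against 0, whose value is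
  unique.\<close>

lemma negligible_increment_const:
  assumes "negligible (\<lambda>s t. D t - D s)" "0 \<le> t" "t \<le> T"
  shows "D t = D 0"
proof -
  have "rs_diff (\<lambda>x. 0) (\<lambda>x. 0) D" using assms(1) by (simp add: rs_diff_def)
  from has_RS_integral_of_rs_diff[OF H_const H_const this _ assms(2,3)]
  have "has_RS_integral (\<lambda>x. 0) (\<lambda>x. 0) 0 t (D t - D 0)" by simp
  from has_RS_integral_unique[OF this has_RS_integral_const_right assms(2)] show ?thesis by simp
qed

section \<open>Associativity, product rule and linearity of \<open>rs_diff\<close>\<close>

lemma rs_diff_cong:
  assumes "rs_diff f g J" "\<And>r. 0 \<le> r \<Longrightarrow> r \<le> T \<Longrightarrow> f r = f' r"
  shows "rs_diff f' g J"
proof -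
  have "negligible (\<lambda>s t. (J t - J s - f s * (g t - g s)) - (f' s - f s) * (g t - g s))"
    unfolding negligible_def
  proof (intro allI impI)
    fix e :: real assume "e > 0"
    obtain d where "d > 0" "\<And>s t. 0 \<le> s \<Longrightarrow> s \<le> t \<Longrightarrow> t \<le> T \<Longrightarrow> t - s < d \<Longrightarrow>
        \<bar>J t - J s - f s * (g t - g s)\<bar> \<le> e * (v t - v s)"
      by (rule negligibleE[OF assms(1)[unfolded rs_diff_def] \<open>e > 0\<close>]) blast
    then show "\<exists>d>0. \<forall>s t. 0 \<le> s \<longrightarrow> s \<le> t \<longrightarrow> t \<le> T \<longrightarrow> t - s < d \<longrightarrow>
        \<bar>(J t - J s - f s * (g t - g s)) - (f' s - f s) * (g t - g s)\<bar> \<le> e * (v t - v s)"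
      by (intro exI[of _ d]) (simp add: assms(2)[symmetric])
  qed
  then show ?thesis unfolding rs_diff_def by (simp add: algebra_simps)
qed

text \<open>Associativity \<open>h dJ = h f dg\<close>: the two errors differ by the bounded factor
  \<open>h\<close> times the error in \<open>dJ = f dg\<close>.\<close>

lemma rs_diff_comp:
  assumes "h \<in> H" "rs_diff f g J"
  shows "rs_diff h J K \<longleftrightarrow> rs_diff (\<lambda>x. h x * f x) g K"
proof -
  obtain M where M: "M > 0" "\<And>s. 0 \<le> s \<Longrightarrow> s \<le> T \<Longrightarrow> \<bar>h s\<bar> \<le> M"
    by (rule H_bounded[OF assms(1)]) blast
  have n: "negligible (\<lambda>s t. h s * (J t - J s - f s * (g t - g s)))"
    by (rule negligible_mult[OF assms(2)[unfolded rs_diff_def] M(1)]) (rule M(2))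
  have eq: "K t - K s - h s * (J t - J s) = K t - K s - h s * f s * (g t - g s)
      - h s * (J t - J s - f s * (g t - g s))" for s t by (simp add: algebra_simps)
  show ?thesis
  proof
    assume "rs_diff h J K"
    from negligible_add[OF this[unfolded rs_diff_def] n] show "rs_diff (\<lambda>x. h x * f x) g K"
      unfolding eq rs_diff_def by simp
  next
    assume "rs_diff (\<lambda>x. h x * f x) g K"
    from negligible_diff[OF this[unfolded rs_diff_def] n] show "rs_diff h J K"
      unfolding eq rs_diff_def by simp
  qed
qed

text \<open>The product minus both primitives has increments composed of negligible errors and of
  the product of the increments of \<open>f\<close> and \<open>g\<close>, which is negligible too;
  hence it is constant.\<close>

lemma rs_diff_prod_rule:
  assumes fg: "f \<in> H" "g \<in> H" and K: "rs_diff f g K" "rs_diff g f L" and t: "0 \<le> t" "t \<le> T"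
  shows "f t * g t - f 0 * g 0 = K t - K 0 + (L t - L 0)"
proof -
  have "negligible (\<lambda>s t. (f t - f s) * (g t - g s) - (K t - K s - f s * (g t - g s))
      - (L t - L s - g s * (f t - f s)))"
    by (rule negligible_diff[OF negligible_diff[OF negligible_product[OF fg]
          K(1)[unfolded rs_diff_def]] K(2)[unfolded rs_diff_def]])
  also have "(\<lambda>s t. (f t - f s) * (g t - g s) - (K t - K s - f s * (g t - g s))
      - (L t - L s - g s * (f t - f s))) =
      (\<lambda>s t. (f t * g t - K t - L t) - (f s * g s - K s - L s))"
    by (simp add: fun_eq_iff algebra_simps)
  finally have "f t * g t - K t - L t = f 0 * g 0 - K 0 - L 0"
    by (rule negligible_increment_const) (use t in auto)
  then show ?thesis by simp
qed

lemma rs_diff_add: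
  "rs_diff f g J \<Longrightarrow> rs_diff f' g K \<Longrightarrow> rs_diff (\<lambda>x. f x + f' x) g (\<lambda>x. J x + K x)"
  unfolding rs_diff_def by (drule (1) negligible_add) (simp add: algebra_simps)

lemma rs_diff_add_right:
  "rs_diff f g J \<Longrightarrow> rs_diff f g' K \<Longrightarrow> rs_diff f (\<lambda>x. g x + g' x) (\<lambda>x. J x + K x)"
  unfolding rs_diff_def by (drule (1) negligible_add) (simp add: algebra_simps)

lemma rs_diff_cmult: "rs_diff f g J \<Longrightarrow> rs_diff (\<lambda>x. c * f x) g (\<lambda>x. c * J x)"
  unfolding rs_diff_def by (drule negligible_cmult[of _ c]) (simp add: algebra_simps)

lemma rs_diff_cmult_right: "rs_diff f g J \<Longrightarrow> rs_diff f (\<lambda>x. c * g x) (\<lambda>x. c * J x)"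
  unfolding rs_diff_def by (drule negligible_cmult[of _ c]) (simp add: algebra_simps)

lemma negligible_0: "negligible (\<lambda>s t. 0)"
  using negligible_cmult[OF negligible_product[OF H_const H_const], of 0] by simp

lemma rs_diff_const: "rs_diff f (\<lambda>x. c) (\<lambda>x. c')"
  unfolding rs_diff_def using negligible_0 by simp

lemma rs_diff_sum:
  "(\<And>j. j \<in> S \<Longrightarrow> rs_diff (f j) g (J j)) \<Longrightarrow> rs_diff (\<lambda>x. \<Sum>j\<in>S. f j x) g (\<lambda>x. \<Sum>j\<in>S. J j x)"
proof (induction S rule: infinite_finite_induct)
  case empty then show ?case unfolding rs_diff_def using negligible_0 by simp
next
  case (infinite A) then show ?case unfolding rs_diff_def using negligible_0 by simp
qed (auto intro: rs_diff_add)

lemma rs_diff_sum_right: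
  "(\<And>j. j \<in> S \<Longrightarrow> rs_diff f (g j) (J j)) \<Longrightarrow> rs_diff f (\<lambda>x. \<Sum>j\<in>S. g j x) (\<lambda>x. \<Sum>j\<in>S. J j x)"
proof (induction S rule: infinite_finite_induct)
  case empty then show ?case unfolding rs_diff_def using negligible_0 by simp
next
  case (infinite A) then show ?case unfolding rs_diff_def using negligible_0 by simp
qed (auto intro: rs_diff_add_right)

end


section \<open>Linear algebra of words\<close>

lemma lookup_scaleR [simp]: "Poly_Mapping.lookup (c *\<^sub>R x) w = c *\<^sub>R Poly_Mapping.lookup x w"
  by transfer simp

lemma lookup_word: "Poly_Mapping.lookup (word u) w = (if u = w then 1 else 0)"
  by (simp add: word_def lookup_single when_def)

lemma lin_ext_superset:
  assumes "finite S" "Poly_Mapping.keys x \<subseteq> S"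
  shows "lin_ext g x = (\<Sum>w\<in>S. Poly_Mapping.lookup x w *\<^sub>R g w)"
  unfolding lin_ext_def using assms
  by (intro sum.mono_neutral_left) (auto simp: in_keys_iff)

lemma linear_lin_ext: "linear (lin_ext g)"
proof (rule linearI)
  fix x y :: tensor
  let ?S = "Poly_Mapping.keys x \<union> Poly_Mapping.keys y"
  have "lin_ext g (x + y) = (\<Sum>w\<in>?S. Poly_Mapping.lookup (x + y) w *\<^sub>R g w)"
    using keys_add[of x y] by (intro lin_ext_superset) auto
  also have "\<dots> = (\<Sum>w\<in>?S. Poly_Mapping.lookup x w *\<^sub>R g w) + (\<Sum>w\<in>?S. Poly_Mapping.lookup y w *\<^sub>R g w)"
    by (simp add: lookup_add scaleR_add_left sum.distrib)
  also have "\<dots> = lin_ext g x + lin_ext g y"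
    by (simp add: lin_ext_superset[of ?S])
  finally show "lin_ext g (x + y) = lin_ext g x + lin_ext g y" .
next
  fix c :: real and x :: tensor
  have "lin_ext g (c *\<^sub>R x) = (\<Sum>w\<in>Poly_Mapping.keys x. Poly_Mapping.lookup (c *\<^sub>R x) w *\<^sub>R g w)"
    by (intro lin_ext_superset) (auto simp: in_keys_iff)
  then show "lin_ext g (c *\<^sub>R x) = c *\<^sub>R lin_ext g x"
    by (simp add: lin_ext_def scaleR_sum_right)
qed

lemma lin_ext_word [simp]: "lin_ext g (word w) = g w"
  by (subst lin_ext_superset[of "{w}"]) (auto simp: in_keys_iff lookup_word split: if_splits)

lemma tensor_expand: "(\<Sum>w\<in>Poly_Mapping.keys x. Poly_Mapping.lookup x w *\<^sub>R word w) = x"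
  by (rule poly_mapping_eqI) (auto simp: lookup_sum lookup_word if_distrib sum.delta in_keys_iff cong: if_cong)

lemma linear_eq_lin_ext:
  assumes "linear f"
  shows "f x = lin_ext (\<lambda>w. f (word w)) x"
  unfolding lin_ext_def
  by (subst tensor_expand[of x, symmetric])
    (simp only: linear_sum[OF assms] linear_scale[OF assms])

lemma lin_ext_cong: "(\<And>w. w \<in> Poly_Mapping.keys x \<Longrightarrow> g w = h w) \<Longrightarrow> lin_ext g x = lin_ext h x"
  unfolding lin_ext_def by (rule sum.cong) auto

lemma linear_eq_on_keys:
  assumes "linear f" "linear g" "\<And>w. w \<in> Poly_Mapping.keys x \<Longrightarrow> f (word w) = g (word w)"
  shows "f x = g x"
  unfolding linear_eq_lin_ext[OF assms(1), of x] linear_eq_lin_ext[OF assms(2), of x]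
  by (rule lin_ext_cong) (rule assms(3))

lemma linear_eq_on_words:
  assumes "linear f" "linear g" "\<And>w. f (word w) = g (word w)"
  shows "f x = g x"
  by (rule linear_eq_on_keys) (use assms in auto)

lemma linear_lin_ext_param:
  assumes "\<And>w. linear (\<lambda>y. g y w)"
  shows "linear (\<lambda>y. lin_ext (g y) x)"
proof (rule linearI)
  fix y z show "lin_ext (g (y + z)) x = lin_ext (g y) x + lin_ext (g z) x"
    by (simp add: lin_ext_def linear_add[OF assms] scaleR_add_right sum.distrib)
next
  fix c y show "lin_ext (g (c *\<^sub>R y)) x = c *\<^sub>R lin_ext (g y) x"
    by (simp add: lin_ext_def linear_scale[OF assms] scaleR_sum_right mult.commute)
qed

text \<open>Distinct words are linearly independent, so a span of words is visible in the support.
  Membership in \<open>T_alg\<close>, \<open>T_ge1\<close> and \<open>letters\<close> thereby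
  becomes a condition on \<open>keys\<close>.\<close>

lemma span_words_iff: "x \<in> span {word w |w. P w} \<longleftrightarrow> (\<forall>w\<in>Poly_Mapping.keys x. P w)"
proof
  assume "x \<in> span {word w |w. P w}"
  then show "\<forall>w\<in>Poly_Mapping.keys x. P w"
  proof (induction rule: span_induct_alt)
    case (step c x y)
    then obtain u where u: "x = word u" "P u" by auto
    have "Poly_Mapping.keys (c *\<^sub>R x + y) \<subseteq> insert u (Poly_Mapping.keys y)"
      by (auto simp: in_keys_iff lookup_add u lookup_word split: if_splits)
    then show ?case using step u by auto
  qed simp
next
  assume "\<forall>w\<in>Poly_Mapping.keys x. P w"
  then have "(\<Sum>w\<in>Poly_Mapping.keys x. Poly_Mapping.lookup x w *\<^sub>R word w) \<in> span {word w |w. P w}"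
    by (intro span_sum span_scale span_base) auto
  then show "x \<in> span {word w |w. P w}" by (simp only: tensor_expand)
qed

lemma T_alg_iff: "x \<in> T_alg d \<longleftrightarrow> (\<forall>w\<in>Poly_Mapping.keys x. set w \<subseteq> {1..d})"
  unfolding T_alg_def by (rule span_words_iff)

lemma T_ge1_iff: "x \<in> T_ge1 d \<longleftrightarrow> (\<forall>w\<in>Poly_Mapping.keys x. set w \<subseteq> {1..d} \<and> w \<noteq> [])"
  unfolding T_ge1_def by (rule span_words_iff)

lemma T_algD: "x \<in> T_alg d \<Longrightarrow> w \<in> Poly_Mapping.keys x \<Longrightarrow> set w \<subseteq> {1..d}"
  by (simp add: T_alg_iff)

lemma T_ge1D: "x \<in> T_ge1 d \<Longrightarrow> w \<in> Poly_Mapping.keys x \<Longrightarrow> set w \<subseteq> {1..d} \<and> w \<noteq> []"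
  by (simp add: T_ge1_iff)

lemma letters_iff: "x \<in> letters d \<longleftrightarrow> (\<forall>w\<in>Poly_Mapping.keys x. \<exists>i\<in>{1..d}. w = [i])"
proof -
  have "{word [i] |i. i \<in> {1..d}} = {word w |w. \<exists>i\<in>{1..d}. w = [i]}" by auto
  then show ?thesis unfolding letters_def using span_words_iff by simp
qed

lemma keys_word [simp]: "Poly_Mapping.keys (word w) = {w}"
  by (simp add: word_def)

lemma subspace_T_alg: "subspace (T_alg d)"
  and subspace_T_ge1: "subspace (T_ge1 d)"
  and subspace_letters: "subspace (letters d)"
  unfolding T_alg_def T_ge1_def letters_def by simp_all

lemma letters_subset_T_ge1: "letters d \<subseteq> T_ge1 d"
  by (force simp: letters_iff T_ge1_iff)

lemma T_ge1_subset_T_alg: "T_ge1 d \<subseteq> T_alg d"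
  by (auto simp: T_ge1_iff T_alg_iff)

lemma word_in_T_alg: "word w \<in> T_alg d \<longleftrightarrow> set w \<subseteq> {1..d}"
  by (simp add: T_alg_iff)

lemma lin_ext_in_subspace:
  assumes "subspace U" "\<And>w. w \<in> Poly_Mapping.keys x \<Longrightarrow> g w \<in> U"
  shows "lin_ext g x \<in> U"
  unfolding lin_ext_def using assms by (intro subspace_sum subspace_scale) auto

lemma linear_image_letters:
  assumes "linear B" "subspace U" "\<And>i. i \<in> {1..m} \<Longrightarrow> B (word [i]) \<in> U" "x \<in> letters m"
  shows "B x \<in> U"
  unfolding linear_eq_lin_ext[OF assms(1), of x]
  by (rule lin_ext_in_subspace) (use assms in \<open>auto simp: letters_iff\<close>)

lemma linear_on_letters:
  assumes "linear (f :: tensor \<Rightarrow> 'a::real_vector)" "x \<in> letters m"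
  shows "f x = (\<Sum>i\<in>{1..m}. Poly_Mapping.lookup x [i] *\<^sub>R f (word [i]))"
proof -
  have "f x = (\<Sum>w\<in>(\<lambda>i. [i]) ` {1..m}. Poly_Mapping.lookup x w *\<^sub>R f (word w))"
    using assms(2) by (subst linear_eq_lin_ext[OF assms(1)], intro lin_ext_superset)
      (auto simp: letters_iff)
  also have "\<dots> = (\<Sum>i\<in>{1..m}. Poly_Mapping.lookup x [i] *\<^sub>R f (word [i]))"
    by (subst sum.reindex) (auto simp: inj_on_def)
  finally show ?thesis .
qed


section \<open>The shuffle product\<close>

definition cons_letter :: "nat \<Rightarrow> tensor \<Rightarrow> tensor"
  where "cons_letter i = lin_ext (\<lambda>w. word (i # w))"

text \<open>Appending a letter corresponds to one more outer integration, see
  \<open>rs_diff_snoc\<close>.\<close>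

definition snoc_letter :: "nat \<Rightarrow> tensor \<Rightarrow> tensor"
  where "snoc_letter i = lin_ext (\<lambda>w. word (w @ [i]))"

lemma linear_cons_letter: "linear (cons_letter i)"
  and linear_snoc_letter: "linear (snoc_letter i)"
  unfolding cons_letter_def snoc_letter_def by (rule linear_lin_ext)+

lemma cons_letter_word [simp]: "cons_letter i (word w) = word (i # w)"
  and snoc_letter_word [simp]: "snoc_letter i (word w) = word (w @ [i])"
  by (simp_all add: cons_letter_def snoc_letter_def)

lemma snoc_cons_letter: "snoc_letter i (cons_letter j x) = cons_letter j (snoc_letter i x)"
  using linear_eq_on_words[OF linear_compose[OF linear_cons_letter linear_snoc_letter]
      linear_compose[OF linear_snoc_letter linear_cons_letter], of i j j i x] by simp

lemma shuffle_words_Cons_Cons: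
  "shuffle_words (a # u) (b # v) =
     cons_letter a (shuffle_words u (b # v)) + cons_letter b (shuffle_words (a # u) v)"
  by (simp add: cons_letter_def)

lemma shuffle_words_Nil_right [simp]: "shuffle_words u [] = word u"
  by (cases u) auto

text \<open>The definition peels off first letters, whereas iterated integrals are differentiated
  with respect to last letters.\<close>

lemma shuffle_words_snoc_snoc:
  "shuffle_words (u @ [a]) (v @ [b]) =
     snoc_letter a (shuffle_words u (v @ [b])) + snoc_letter b (shuffle_words (u @ [a]) v)"
proof (induction "length u + length v" arbitrary: u v rule: less_induct)
  case less
  note lin = linear_add[OF linear_cons_letter] linear_add[OF linear_snoc_letter]
  show ?case
  proof (cases u; cases v)
    assume [simp]: "u = []" "v = []"
    show ?thesis by (simp add: shuffle_words_Cons_Cons del: shuffle_words.simps(3))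
  next
    fix d v' assume [simp]: "u = []" "v = d # v'"
    from less[of u v'] show ?thesis
      by (simp add: shuffle_words_Cons_Cons lin snoc_cons_letter del: shuffle_words.simps(3))
  next
    fix c u' assume [simp]: "u = c # u'" "v = []"
    from less[of u' v] show ?thesis
      by (simp add: shuffle_words_Cons_Cons lin snoc_cons_letter del: shuffle_words.simps(3))
  next
    fix c u' d v' assume [simp]: "u = c # u'" "v = d # v'"
    from less[of u' v] less[of u v'] show ?thesis
      by (simp add: shuffle_words_Cons_Cons lin snoc_cons_letter del: shuffle_words.simps(3))
  qed
qed

lemma linear_shuffle_left: "linear (\<lambda>x. shuffle x y)"
  unfolding shuffle_def by (rule linear_lin_ext)

lemma linear_shuffle_right: "linear (shuffle x)"
  unfolding shuffle_def by (intro linear_lin_ext_param linear_lin_ext)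

lemma shuffle_word_word [simp]: "shuffle (word u) (word v) = shuffle_words u v"
  by (simp add: shuffle_def)

lemma shuffle_words_in_T_alg:
  "set u \<subseteq> {1..d} \<Longrightarrow> set v \<subseteq> {1..d} \<Longrightarrow> shuffle_words u v \<in> T_alg d"
proof (induction u v rule: shuffle_words.induct)
  case (3 a u b v)
  have "cons_letter i x \<in> T_alg d" if "x \<in> T_alg d" "i \<in> {1..d}" for i x
    unfolding cons_letter_def by (rule lin_ext_in_subspace[OF subspace_T_alg])
      (use that in \<open>auto simp: word_in_T_alg T_alg_iff\<close>)
  then show ?case using 3 unfolding shuffle_words_Cons_Cons
    by (intro subspace_add[OF subspace_T_alg]) auto
qed (auto simp: word_in_T_alg)

lemma shuffle_in_T_alg: "x \<in> T_alg d \<Longrightarrow> y \<in> T_alg d \<Longrightarrow> shuffle x y \<in> T_alg d"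
  unfolding shuffle_def
  by (intro lin_ext_in_subspace[OF subspace_T_alg] shuffle_words_in_T_alg) (auto simp: T_alg_iff)

lemma snoc_letter_in_T_ge1: "x \<in> T_alg d \<Longrightarrow> i \<in> {1..d} \<Longrightarrow> snoc_letter i x \<in> T_ge1 d"
  unfolding snoc_letter_def
  by (intro lin_ext_in_subspace[OF subspace_T_ge1]) (auto simp: T_alg_iff T_ge1_iff)

text \<open>The half-shuffle or Zinbiel product, the algebraic counterpart of integrating the
  coordinate \<open>x\<close> against the second coordinate. The empty word is a constant coordinate
  with zero differential, hence the value 0.\<close>

definition half_shuffle :: "tensor \<Rightarrow> tensor \<Rightarrow> tensor"
  where "half_shuffle x = lin_ext (\<lambda>w. if w = [] then 0
     else snoc_letter (last w) (shuffle x (word (butlast w))))"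

lemma linear_half_shuffle_right: "linear (half_shuffle x)"
  unfolding half_shuffle_def by (rule linear_lin_ext)

lemma linear_zero_fun: "linear (\<lambda>x. 0)"
  by (rule linearI) auto

lemma linear_half_shuffle_left: "linear (\<lambda>x. half_shuffle x y)"
  unfolding half_shuffle_def
proof (rule linear_lin_ext_param)
  fix w :: "nat list"
  show "linear (\<lambda>x. if w = [] then 0 else snoc_letter (last w) (shuffle x (word (butlast w))))"
    using linear_compose[OF linear_shuffle_left linear_snoc_letter, unfolded o_def]
    by (cases "w = []") (auto intro: linear_zero_fun)
qed

lemma half_shuffle_snoc [simp]:
  "half_shuffle x (word (w @ [i])) = snoc_letter i (shuffle x (word w))"
  by (simp add: half_shuffle_def)

lemma half_shuffle_Nil [simp]: "half_shuffle x (word []) = 0"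
  by (simp add: half_shuffle_def)

lemma half_shuffle_in_T_ge1:
  assumes "x \<in> T_alg d" "y \<in> T_alg d"
  shows "half_shuffle x y \<in> T_ge1 d"
  unfolding half_shuffle_def
proof (rule lin_ext_in_subspace[OF subspace_T_ge1])
  fix w assume "w \<in> Poly_Mapping.keys y"
  then have w: "set w \<subseteq> {1..d}" using assms by (auto simp: T_alg_iff)
  show "(if w = [] then 0 else snoc_letter (last w) (shuffle x (word (butlast w)))) \<in> T_ge1 d"
  proof (cases "w = []")
    case False
    then have "last w \<in> {1..d}" using w last_in_set by blast
    moreover have "set (butlast w) \<subseteq> {1..d}" using w by (meson in_set_butlastD subset_iff)
    ultimately show ?thesis using False assms
      by (auto intro!: snoc_letter_in_T_ge1 shuffle_in_T_alg simp: word_in_T_alg)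
  qed (simp add: subspace_0[OF subspace_T_ge1])
qed

text \<open>\<open>Lambda_word B (rev w)\<close> is the pullback of the word \<open>w\<close> under \<open>\<Lambda>\<^sup>*\<^sub>B\<close>.\<close>

primrec Lambda_word :: "(tensor \<Rightarrow> tensor) \<Rightarrow> nat list \<Rightarrow> tensor" where
  "Lambda_word B [] = word []"
| "Lambda_word B (i # w) = half_shuffle (Lambda_word B w) (B (word [i]))"

definition Lambda_hom :: "(tensor \<Rightarrow> tensor) \<Rightarrow> tensor \<Rightarrow> tensor"
  where "Lambda_hom B = lin_ext (\<lambda>w. Lambda_word B (rev w))"

lemma linear_Lambda_hom: "linear (Lambda_hom B)"
  unfolding Lambda_hom_def by (rule linear_lin_ext)

section \<open>Paths of finite variation and their controls\<close>

text \<open>The bound \<open>\<alpha> \<le> 1\<close> makes \<open>1 / \<alpha>\<close> an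
  admissible exponent of variation when returning to \<open>paths\<close>.\<close>

locale controlled_path = control "dur X" v \<alpha> for X v \<alpha> +
  assumes pos_H: "(\<lambda>s. pos X s i) \<in> H"
    and alpha_le: "\<alpha> \<le> 1"

lemma pathsD:
  assumes "X \<in> paths d"
  shows "dur X > 0" "s \<notin> {0..dur X} \<Longrightarrow> pos X s i = 0" "i \<notin> {1..d} \<Longrightarrow> pos X s i = 0"
    "pos X 0 i = 0" "continuous_on {0..dur X} (\<lambda>s. pos X s i)"
  using assms unfolding paths_def by auto

text \<open>The control is the \<open>p\<close>-variation on \<open>[0, t]\<close> as a function of \<open>t\<close>.\<close>

lemma paths_controlled:
  assumes X: "X \<in> paths d"
  obtains v \<alpha> where "controlled_path X v \<alpha>"
proof -
  obtain p where p: "1 \<le> p" "p < 2" "finite_pvar d p X" using X unfolding paths_def by auto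
  define N where "N s t = L2_set (\<lambda>i. pos X t i - pos X s i) {1..d} powr p" for s t
  have N0: "N s t \<ge> 0" for s t by (simp add: N_def)
  obtain C where C: "\<And>n u. mono_on {0..n} u \<Longrightarrow> u ` {0..n} \<subseteq> {0..dur X} \<Longrightarrow>
       (\<Sum>k<n. N (u k) (u (Suc k))) \<le> C"
    using p(3) unfolding finite_pvar_def N_def by blast
  define S where "S t = {(\<Sum>k<n. N (u k) (u (Suc k))) |n (u :: nat \<Rightarrow> real).
      mono_on {0..n} u \<and> u ` {0..n} \<subseteq> {0..t}}" for t
  define v where "v t = Sup (S t)" for t
  have bdd: "bdd_above (S t)" if "t \<le> dur X" for t
  proof (rule bdd_aboveI)
    fix y assume "y \<in> S t"
    then obtain n u where u: "y = (\<Sum>k<n. N (u k) (u (Suc k)))" "mono_on {0..n} u" "u ` {0..n} \<subseteq> {0..t}"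
      unfolding S_def by auto
    have "{0..t} \<subseteq> {0..dur X}" using that by auto
    then show "y \<le> C" using C[OF u(2) subset_trans[OF u(3)]] u(1) by simp
  qed
  have ne: "S t \<noteq> {}" if "0 \<le> t" for t
  proof -
    have "(\<Sum>k<0. N ((\<lambda>_. 0) k) ((\<lambda>_. 0) (Suc k))) \<in> S t"
      unfolding S_def mem_Collect_eq using that
      by (intro exI[of _ 0] exI[of _ "\<lambda>_. 0"]) (auto simp: monotone_on_def)
    then show ?thesis by blast
  qed
  have super: "v s + N s t \<le> v t" if st: "0 \<le> s" "s \<le> t" "t \<le> dur X" for s t
  proof -
    have "v s \<le> v t - N s t"
      unfolding v_def[of s]
    proof (rule cSup_least[OF ne[OF st(1)]])
      fix y assume "y \<in> S s"
      then obtain n u where y: "y = (\<Sum>k<n. N (u k) (u (Suc k)))" and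
        u: "mono_on {0..n} u" "u ` {0..n} \<subseteq> {0..s}"
        unfolding S_def by auto
      \<comment> \<open>A partition of \<open>[0, s]\<close> continued by \<open>s\<close> and
        \<open>t\<close>; the step into \<open>s\<close> only adds a nonnegative term.\<close>
      define w where "w k = (if k \<le> n then u k else if k = Suc n then s else t)" for k
      have "mono_on {0..Suc (Suc n)} w"
      proof (rule mono_onI)
        fix i j assume "i \<in> {0..Suc (Suc n)}" "j \<in> {0..Suc (Suc n)}" "i \<le> j"
        moreover have "u i \<le> s" if "i \<le> n" for i using u(2) that by (auto simp: image_subset_iff)
        ultimately show "w i \<le> w j"
          using mono_onD[OF u(1), of i j] st unfolding w_def by (auto intro: order_trans)
      qed
      moreover have "w ` {0..Suc (Suc n)} \<subseteq> {0..t}"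
        using u(2) st by (fastforce simp: w_def)
      ultimately have "(\<Sum>k<Suc (Suc n). N (w k) (w (Suc k))) \<in> S t" unfolding S_def by blast
      then have "(\<Sum>k<Suc (Suc n). N (w k) (w (Suc k))) \<le> v t"
        unfolding v_def using bdd st by (intro cSup_upper) auto
      moreover have "(\<Sum>k<n. N (w k) (w (Suc k))) = y"
        unfolding y by (intro sum.cong) (auto simp: w_def)
      moreover have "N (w (Suc n)) (w (Suc (Suc n))) = N s t" by (simp add: w_def)
      ultimately show "y \<le> v t - N s t" using N0[of "w n" "w (Suc n)"] by simp
    qed
    then show ?thesis by simp
  qed
  \<comment> \<open>The condition \<open>p < 2\<close> on paths enters here, as
    \<open>1 / p > 1 / 2\<close>.\<close>
  interpret control "dur X" v "1 / p"
  proof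
    show "v s \<le> v t" if "0 \<le> s" "s \<le> t" "t \<le> dur X" for s t
      using super[OF that] N0[of s t] by linarith
  qed (use p pathsD(1)[OF X] in \<open>auto simp: field_simps\<close>)
  have "(\<lambda>s. pos X s i) \<in> H" for i
  proof (rule HI[of _ 1])
    fix s t assume st: "0 \<le> s" "s \<le> t" "t \<le> dur X"
    show "\<bar>pos X t i - pos X s i\<bar> \<le> 1 * (v t - v s) powr (1 / p)"
    proof (cases "i \<in> {1..d}")
      case True
      have "\<bar>pos X t i - pos X s i\<bar> \<le> L2_set (\<lambda>i. \<bar>pos X t i - pos X s i\<bar>) {1..d}"
        using True by (intro member_le_L2_set) auto
      then have L2: "\<bar>pos X t i - pos X s i\<bar> \<le> L2_set (\<lambda>i. pos X t i - pos X s i) {1..d}"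
        by (simp add: L2_set_def)
      have "\<bar>pos X t i - pos X s i\<bar> = (\<bar>pos X t i - pos X s i\<bar> powr p) powr (1 / p)"
        using p by (simp add: powr_powr)
      also have "\<dots> \<le> N s t powr (1 / p)"
        unfolding N_def using L2 p by (intro powr_mono2) auto
      also have "\<dots> \<le> (v t - v s) powr (1 / p)"
        using super[OF st] N0[of s t] p by (intro powr_mono2) auto
      finally show ?thesis by simp
    qed (use pathsD(3)[OF X] in auto)
  qed (use pathsD(5)[OF X] in auto)
  then have "controlled_path X v (1 / p)"
    using p by unfold_locales auto
  then show thesis by (rule that)
qed

text \<open>With \<open>p = 1 / \<alpha>\<close> the power \<open>p\<close> of the norm of an
  increment is bounded by a multiple of the increment of \<open>v\<close>, and these
  telescope.\<close>

lemma (in control) controlled_imp_paths: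
  assumes "\<alpha> \<le> 1" "dur X = T" "T > 0"
    and H: "\<And>i. i \<in> {1..d} \<Longrightarrow> (\<lambda>s. pos X s i) \<in> H"
    and out: "\<And>s i. s \<notin> {0..T} \<or> i \<notin> {1..d} \<Longrightarrow> pos X s i = 0"
    and zero: "\<And>i. i \<in> {1..d} \<Longrightarrow> pos X 0 i = 0"
  shows "X \<in> paths d"
proof -
  have "\<forall>i\<in>{1..d}. \<exists>C\<ge>0. \<forall>s t. 0 \<le> s \<longrightarrow> s \<le> t \<longrightarrow> t \<le> T \<longrightarrow>
      \<bar>pos X t i - pos X s i\<bar> \<le> C * (v t - v s) powr \<alpha>"
    using H unfolding H_def by blast
  then obtain C where C: "\<And>i. i \<in> {1..d} \<Longrightarrow> C i \<ge> 0"
    "\<And>i s t. i \<in> {1..d} \<Longrightarrow> 0 \<le> s \<Longrightarrow> s \<le> t \<Longrightarrow> t \<le> T \<Longrightarrow> \<bar>pos X t i - pos X s i\<bar> \<le> C i * (v t - v s) powr \<alpha>"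
    by metis
  define D where "D = (\<Sum>i\<in>{1..d}. C i)"
  define p where "p = 1 / \<alpha>"
  have p: "1 \<le> p" "p < 2" "\<alpha> * p = 1" using alpha assms(1) by (auto simp: p_def field_simps)
  have L2: "L2_set (\<lambda>i. pos X t i - pos X s i) {1..d} powr p \<le> D powr p * (v t - v s)"
    if st: "0 \<le> s" "s \<le> t" "t \<le> T" for s t
  proof -
    have "L2_set (\<lambda>i. pos X t i - pos X s i) {1..d} \<le> (\<Sum>i\<in>{1..d}. \<bar>pos X t i - pos X s i\<bar>)"
      by (rule L2_set_le_sum_abs)
    also have "\<dots> \<le> (\<Sum>i\<in>{1..d}. C i * (v t - v s) powr \<alpha>)"
      using C(2)[OF _ st] by (intro sum_mono) auto
    also have "\<dots> = D * (v t - v s) powr \<alpha>" by (simp add: D_def sum_distrib_right)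
    finally have "L2_set (\<lambda>i. pos X t i - pos X s i) {1..d} powr p \<le> (D * (v t - v s) powr \<alpha>) powr p"
      using p by (intro powr_mono2) auto
    also have "\<dots> = D powr p * (v t - v s)"
      using v_mono[OF st] C(1) p by (simp add: powr_mult powr_powr D_def sum_nonneg)
    finally show ?thesis .
  qed
  have "finite_pvar d p X"
    unfolding finite_pvar_def assms(2)
  proof (intro exI[of _ "D powr p * (v T - v 0)"] allI impI)
    fix n and u :: "nat \<Rightarrow> real" assume u: "mono_on {0..n} u \<and> u ` {0..n} \<subseteq> {0..T}"
    then have r: "0 \<le> u k" "u k \<le> T" if "k \<le> n" for k
      using that by (auto simp: image_subset_iff)
    have m: "u k \<le> u (Suc k)" if "k < n" for k
      using u that by (auto simp: monotone_on_def)
    have "(\<Sum>k<n. L2_set (\<lambda>i. pos X (u (Suc k)) i - pos X (u k) i) {1..d} powr p)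
        \<le> (\<Sum>k<n. D powr p * (v (u (Suc k)) - v (u k)))"
      using r m by (intro sum_mono L2) auto
    also have "\<dots> = D powr p * (v (u n) - v (u 0))"
      using sum_lessThan_telescope[of "\<lambda>k. v (u k)" n] by (simp add: sum_distrib_left[symmetric])
    also have "\<dots> \<le> D powr p * (v T - v 0)"
      using v_mono[of 0 "u 0"] v_mono[of "u n" T] r[of 0] r[of n] T_nonneg by (intro mult_left_mono) auto
    finally show "(\<Sum>k<n. L2_set (\<lambda>i. pos X (u (Suc k)) i - pos X (u k) i) {1..d} powr p)
        \<le> D powr p * (v T - v 0)" .
  qed
  moreover have "continuous_on {0..T} (\<lambda>s. pos X s i)" for i
  proof (cases "i \<in> {1..d}")
    case False then show ?thesis using out by simp
  qed (use H HD_cont in blast)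
  moreover have "pos X 0 i = 0" for i
    using zero out by (cases "i \<in> {1..d}") auto
  ultimately show ?thesis
    unfolding paths_def mem_Collect_eq assms(2) using assms(3) out p(1,2) by blast
qed


section \<open>The signature as a function of time\<close>

text \<open>Replaces restricted paths: the signature over \<open>[0, s]\<close> becomes a function
  of \<open>s\<close> to which the calculus of \<open>control\<close> applies;
  \<open>sig_restrict\<close> translates.\<close>

definition sig_at :: "path \<Rightarrow> real \<Rightarrow> tensor \<Rightarrow> real"
  where "sig_at X s = lin_ext (\<lambda>w. iter_int X (rev w) s)"

lemma sig_eq_sig_at: "sig X = sig_at X (dur X)"
  by (simp add: sig_def sig_at_def)

lemma sig_at_word [simp]: "sig_at X s (word w) = iter_int X (rev w) s"
  by (simp add: sig_at_def)

lemma linear_sig_at: "linear (sig_at X s)"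
  unfolding sig_at_def by (rule linear_lin_ext)

lemmas sig_at_add = linear_add[OF linear_sig_at]
  and sig_at_scaleR = linear_scale[OF linear_sig_at]
  and sig_at_0 [simp] = linear_0[OF linear_sig_at]
  and sig_at_sum = linear_sum[OF linear_sig_at]

lemma linear_sig: "linear (sig X)"
  unfolding sig_eq_sig_at by (rule linear_sig_at)

lemma iter_int_0: "iter_int X (i # w) 0 = 0"
proof -
  have "has_RS_integral (iter_int X w) (\<lambda>r. pos X r i) 0 0 0"
    using has_RS_integral_const_right[of "iter_int X w" "pos X 0 i" 0 0]
    by (subst has_RS_integral_cong[where f' = "iter_int X w" and g' = "\<lambda>r. pos X 0 i"]) auto
  then show ?thesis by (simp add: RS_integral_eq)
qed

lemma sig_at_time_0: "sig_at X 0 x = Poly_Mapping.lookup x []"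
proof -
  have "linear (\<lambda>x :: tensor. Poly_Mapping.lookup x [])"
    by (rule linearI) (auto simp: lookup_add)
  moreover have "sig_at X 0 (word w) = Poly_Mapping.lookup (word w) []" for w
    by (cases w rule: rev_cases) (auto simp: iter_int_0 lookup_word simp del: iter_int.simps(2))
  ultimately show ?thesis using linear_eq_on_words[OF linear_sig_at] by blast
qed

lemma T_ge1_lookup_Nil: "x \<in> T_ge1 d \<Longrightarrow> Poly_Mapping.lookup x [] = 0"
  by (auto simp: T_ge1_iff in_keys_iff)

lemma iter_int_restrict:
  "0 \<le> r \<Longrightarrow> r \<le> s \<Longrightarrow> iter_int (restrict_path X s) w r = iter_int X w r"
proof (induction w arbitrary: r)
  case (Cons i w)
  show ?case unfolding iter_int.simps
    by (rule RS_integral_cong) (use Cons in \<open>auto simp: restrict_path_def mk_path_def\<close>)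
qed simp

lemma dur_restrict: "dur (restrict_path X s) = s"
  by (simp add: restrict_path_def mk_path_def)

lemma sig_restrict: "0 \<le> s \<Longrightarrow> sig (restrict_path X s) x = sig_at X s x"
  unfolding sig_def sig_at_def by (intro lin_ext_cong) (simp add: dur_restrict iter_int_restrict)

lemma dur_mk_path [simp]: "dur (mk_path T f) = T"
  and pos_mk_path: "pos (mk_path T f) s i = (if s \<in> {0..T} then f s i else 0)"
  by (simp_all add: mk_path_def)

lemma dur_Lambda [simp]: "dur (Lambda m B X) = dur X"
  by (simp add: Lambda_def)

lemma pos_Lambda: "pos (Lambda m B X) s i =
    (if 0 \<le> s \<and> s \<le> dur X \<and> i \<in> {1..m} then sig_at X s (B (word [i])) else 0)"
  by (auto simp: Lambda_def pos_mk_path sig_restrict)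

context controlled_path
begin

lemma iter_int_H: "iter_int X w \<in> H"
  and rs_diff_iter_int: "rs_diff (iter_int X w) (\<lambda>s. pos X s i) (iter_int X (i # w))"
proof -
  show *: "iter_int X w \<in> H"
  proof (induction w)
    case Nil then show ?case by (simp add: H_const)
  next
    case (Cons i w)
    from rs_diff_imp_H[OF this pos_H rs_diff_exists[OF this pos_H]] show ?case by simp
  qed
  show "rs_diff (iter_int X w) (\<lambda>s. pos X s i) (iter_int X (i # w))"
    using rs_diff_exists[OF * pos_H] by simp
qed

lemma sig_at_H: "(\<lambda>s. sig_at X s x) \<in> H"
  unfolding sig_at_def lin_ext_def real_scaleR_def by (intro H_sum H_cmult iter_int_H)

lemma rs_diff_snoc:
  "rs_diff (\<lambda>s. sig_at X s x) (\<lambda>s. pos X s i) (\<lambda>s. sig_at X s (snoc_letter i x))"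
proof -
  have "sig_at X s (snoc_letter i x) =
      (\<Sum>w\<in>Poly_Mapping.keys x. Poly_Mapping.lookup x w * iter_int X (i # rev w) s)" for s
    unfolding snoc_letter_def lin_ext_def[of _ x] by (simp add: sig_at_sum sig_at_scaleR)
  moreover have "sig_at X s x =
      (\<Sum>w\<in>Poly_Mapping.keys x. Poly_Mapping.lookup x w * iter_int X (rev w) s)" for s
    by (simp add: sig_at_def lin_ext_def)
  ultimately show ?thesis
    by (simp only:) (intro rs_diff_sum rs_diff_cmult rs_diff_iter_int)
qed

lemma lookup_snoc_letter_Nil: "Poly_Mapping.lookup (snoc_letter i x) [] = 0"
proof -
  have "snoc_letter i x \<in> span {word w |w. w \<noteq> []}"
    unfolding snoc_letter_def by (rule lin_ext_in_subspace) (auto intro: span_base)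
  then show ?thesis by (auto simp: span_words_iff in_keys_iff)
qed

text \<open>Product rule for the two coordinates: removing the last letter of one factor exposes its
  differential, and by induction the integrands are shuffles of shorter words. Coordinates of
  nonempty words vanish at time 0.\<close>

lemma sig_at_shuffle_words:
  "0 \<le> s \<Longrightarrow> s \<le> dur X \<Longrightarrow>
    sig_at X s (shuffle_words us vs) = sig_at X s (word us) * sig_at X s (word vs)"
proof (induction "length us + length vs" arbitrary: us vs s rule: less_induct)
  case less
  show ?case
  proof (cases us rule: rev_cases)
    case Nil then show ?thesis by simp
  next
    case us: (snoc us' a)
    show ?thesis
    proof (cases vs rule: rev_cases)
      case Nil then show ?thesis by simp
    next
      case vs: (snoc vs' b)
      let ?f = "\<lambda>r. sig_at X r (word us)" and ?g = "\<lambda>r. sig_at X r (word vs)"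
      let ?F = "\<lambda>r. sig_at X r (snoc_letter a (shuffle_words us' vs))"
      let ?G = "\<lambda>r. sig_at X r (snoc_letter b (shuffle_words us vs'))"
      have f: "rs_diff (\<lambda>r. sig_at X r (word us')) (\<lambda>r. pos X r a) ?f"
        using rs_diff_snoc[of "word us'" a] by (simp add: us)
      have g: "rs_diff (\<lambda>r. sig_at X r (word vs')) (\<lambda>r. pos X r b) ?g"
        using rs_diff_snoc[of "word vs'" b] by (simp add: vs)
      have "rs_diff ?g ?f ?F"
        unfolding rs_diff_comp[OF sig_at_H f]
      proof (rule rs_diff_cong[OF rs_diff_snoc])
        fix r assume "0 \<le> r" "r \<le> dur X"
        then show "sig_at X r (shuffle_words us' vs) = ?g r * sig_at X r (word us')"
          using less(1)[of us' vs r] by (simp add: us mult.commute del: sig_at_word)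
      qed
      moreover have "rs_diff ?f ?g ?G"
        unfolding rs_diff_comp[OF sig_at_H g]
      proof (rule rs_diff_cong[OF rs_diff_snoc])
        fix r assume "0 \<le> r" "r \<le> dur X"
        then show "sig_at X r (shuffle_words us vs') = ?f r * sig_at X r (word vs')"
          using less(1)[of us vs' r] by (simp add: vs del: sig_at_word)
      qed
      ultimately have "?f s * ?g s - ?f 0 * ?g 0 = ?G s - ?G 0 + (?F s - ?F 0)"
        using less(2,3) by (intro rs_diff_prod_rule sig_at_H)
      moreover have "sig_at X s (shuffle_words us vs) = ?F s + ?G s"
        unfolding us vs shuffle_words_snoc_snoc by (simp add: sig_at_add)
      moreover have "?f 0 = 0" "?F 0 = 0" "?G 0 = 0"
        by (simp_all add: sig_at_time_0 lookup_snoc_letter_Nil lookup_word us del: sig_at_word)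
      ultimately show ?thesis by simp
    qed
  qed
qed

lemma sig_at_shuffle:
  assumes "0 \<le> s" "s \<le> dur X"
  shows "sig_at X s (shuffle x y) = sig_at X s x * sig_at X s y"
proof (rule linear_eq_on_words[of "\<lambda>x. sig_at X s (shuffle x y)"])
  show "linear (\<lambda>x. sig_at X s (shuffle x y))"
    by (rule linear_compose[OF linear_shuffle_left linear_sig_at, unfolded o_def])
  show "linear (\<lambda>x. sig_at X s x * sig_at X s y)"
    by (rule linearI) (simp_all add: sig_at_add sig_at_scaleR algebra_simps)
  fix u
  show "sig_at X s (shuffle (word u) y) = sig_at X s (word u) * sig_at X s y"
  proof (rule linear_eq_on_words[of "\<lambda>y. sig_at X s (shuffle (word u) y)"])
    show "linear (\<lambda>y. sig_at X s (shuffle (word u) y))"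
      by (rule linear_compose[OF linear_shuffle_right linear_sig_at, unfolded o_def])
    show "linear (\<lambda>y. sig_at X s (word u) * sig_at X s y)"
      by (rule linearI) (simp_all add: sig_at_add sig_at_scaleR algebra_simps)
  qed (simp add: sig_at_shuffle_words assms del: sig_at_word)
qed

text \<open>The differential of a word coordinate is the coordinate of its initial part times the
  differential of the component named by its last letter. Associativity moves the factor
  \<open>x\<close> inside, and the shuffle identity combines it with the initial part.\<close>

lemma rs_diff_half_shuffle:
  "rs_diff (\<lambda>s. sig_at X s x) (\<lambda>s. sig_at X s y) (\<lambda>s. sig_at X s (half_shuffle x y))"
proof -
  have word: "rs_diff (\<lambda>s. sig_at X s x) (\<lambda>s. sig_at X s (word w))
      (\<lambda>s. sig_at X s (half_shuffle x (word w)))" for w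
  proof (cases w rule: rev_cases)
    case Nil then show ?thesis by (simp add: rs_diff_const)
  next
    case (snoc w' i)
    have f: "rs_diff (\<lambda>r. sig_at X r (word w')) (\<lambda>r. pos X r i) (\<lambda>r. sig_at X r (word w))"
      using rs_diff_snoc[of "word w'" i] by (simp add: snoc)
    show ?thesis
      unfolding rs_diff_comp[OF sig_at_H f] unfolding snoc half_shuffle_snoc
      by (rule rs_diff_cong[OF rs_diff_snoc]) (simp add: sig_at_shuffle del: sig_at_word)
  qed
  have "sig_at X s y = (\<Sum>w\<in>Poly_Mapping.keys y. Poly_Mapping.lookup y w * sig_at X s (word w))" for s
    using linear_eq_lin_ext[OF linear_sig_at, of X s y] by (simp add: lin_ext_def)
  moreover have "sig_at X s (half_shuffle x y) =
      (\<Sum>w\<in>Poly_Mapping.keys y. Poly_Mapping.lookup y w * sig_at X s (half_shuffle x (word w)))" for s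
  proof -
    have "linear (\<lambda>y. sig_at X s (half_shuffle x y))"
      by (rule linear_compose[OF linear_half_shuffle_right linear_sig_at, unfolded o_def])
    from linear_eq_lin_ext[OF this, of y] show ?thesis by (simp add: lin_ext_def)
  qed
  ultimately show ?thesis
    by (simp only:) (intro rs_diff_sum_right rs_diff_cmult_right word)
qed

lemma lookup_half_shuffle_Nil: "Poly_Mapping.lookup (half_shuffle x y) [] = 0"
proof -
  have "half_shuffle x y \<in> span {word w |w. w \<noteq> []}"
    unfolding half_shuffle_def
  proof (rule lin_ext_in_subspace)
    fix w
    have "snoc_letter i z \<in> span {word w |w. w \<noteq> []}" for i z
      using lookup_snoc_letter_Nil[of i z] by (auto simp: span_words_iff in_keys_iff)
    then show "(if w = [] then 0 else snoc_letter (last w) (shuffle x (word (butlast w))))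
        \<in> span {word w |w. w \<noteq> []}" by (simp add: span_zero)
  qed simp
  then show ?thesis by (auto simp: span_words_iff in_keys_iff)
qed

text \<open>The components of \<open>Lambda m B X\<close> are signature coordinates in time, so each
  integration against one of them is a half-shuffle; half-shuffles have no constant part and
  therefore start at 0.\<close>

lemma iter_int_Lambda:
  "0 \<le> s \<Longrightarrow> s \<le> dur X \<Longrightarrow> set w \<subseteq> {1..m} \<Longrightarrow>
    iter_int (Lambda m B X) w s = sig_at X s (Lambda_word B w)"
proof (induction w arbitrary: s)
  case Nil then show ?case by simp
next
  case (Cons i w)
  have "iter_int (Lambda m B X) (i # w) s =
      RS_integral (\<lambda>r. sig_at X r (Lambda_word B w)) (\<lambda>r. sig_at X r (B (word [i]))) 0 s"
    unfolding iter_int.simps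
    by (rule RS_integral_cong) (use Cons in \<open>auto simp: pos_Lambda simp del: iter_int.simps\<close>)
  also have "\<dots> = sig_at X s (Lambda_word B (i # w)) - sig_at X 0 (Lambda_word B (i # w))"
    unfolding Lambda_word.simps using Cons
    by (intro RS_integral_eq has_RS_integral_of_rs_diff sig_at_H rs_diff_half_shuffle) auto
  finally show ?case by (simp add: sig_at_time_0 lookup_half_shuffle_Nil)
qed

lemma Lambda_in_paths:
  assumes "dur X > 0" "\<And>i. i \<in> {1..m} \<Longrightarrow> Poly_Mapping.lookup (B (word [i])) [] = 0"
  shows "Lambda m B X \<in> paths m"
proof (rule controlled_imp_paths[OF alpha_le])
  fix i assume i: "i \<in> {1..m}"
  show "(\<lambda>s. pos (Lambda m B X) s i) \<in> H"
    by (rule H_cong[OF sig_at_H[of "B (word [i])"]]) (use i in \<open>simp add: pos_Lambda\<close>)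
  show "pos (Lambda m B X) 0 i = 0"
    using assms(2)[OF i] by (simp add: pos_Lambda sig_at_time_0)
qed (use assms in \<open>auto simp: pos_Lambda\<close>)

end


section \<open>Concatenation and time reversal\<close>

lemma path_eqI:
  assumes "dur X = dur Y" "\<And>s i. pos X s i = pos Y s i"
  shows "X = Y"
  using assms by (cases X; cases Y) (auto simp: fun_eq_iff)

lemma dur_concat [simp]: "dur (X \<squnion>\<^sub>p Y) = dur X + dur Y"
  by (simp add: concat_path_def)

text \<open>With clamped times the path is a sum of two functions on the whole interval, so that
  regularity can be read off each summand without gluing.\<close>

lemma pos_concat:
  assumes "X \<in> paths d" "Y \<in> paths d"
  shows "pos (X \<squnion>\<^sub>p Y) s i = (if 0 \<le> s \<and> s \<le> dur X + dur Y
    then pos X (min s (dur X)) i + pos Y (max 0 (s - dur X)) i else 0)"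
  using pathsD(4)[OF assms(2)] by (auto simp: concat_path_def pos_mk_path min_def max_def)

lemma pos_concat_if: "pos (X \<squnion>\<^sub>p Y) s i = (if 0 \<le> s \<and> s \<le> dur X + dur Y then
    if s \<le> dur X then pos X s i else pos Y (s - dur X) i + pos X (dur X) i - pos Y 0 i else 0)"
  by (auto simp: concat_path_def pos_mk_path)

lemma pos_concat_left:
  assumes "Y \<in> paths d" "0 \<le> s" "s \<le> dur X"
  shows "pos (X \<squnion>\<^sub>p Y) s i = pos X s i"
  using assms pathsD(1)[OF assms(1)] by (simp add: pos_concat_if)

lemma dur_reversal [simp]: "dur (reversal X) = dur X"
  by (simp add: reversal_def)

lemma pos_reversal: "pos (reversal X) s i =
    (if 0 \<le> s \<and> s \<le> dur X then pos X (dur X - s) i - pos X (dur X) i else 0)"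
  by (simp add: reversal_def pos_mk_path)

text \<open>A smaller exponent costs only a power of the total increase of \<open>v\<close>. In this
  way two paths are brought to a common exponent before they are concatenated.\<close>

lemma paths_bound:
  assumes X: "X \<in> paths d"
  obtains v \<alpha> where "1 / 2 < \<alpha>" "\<alpha> \<le> 1"
    "\<And>s t. 0 \<le> s \<Longrightarrow> s \<le> t \<Longrightarrow> t \<le> dur X \<Longrightarrow> v s \<le> v t"
    "\<And>\<beta> i. 0 \<le> \<beta> \<Longrightarrow> \<beta> \<le> \<alpha> \<Longrightarrow> \<exists>C\<ge>0. \<forall>s t. 0 \<le> s \<longrightarrow> s \<le> t \<longrightarrow> t \<le> dur X \<longrightarrow>
       \<bar>pos X t i - pos X s i\<bar> \<le> C * (v t - v s) powr \<beta>"
proof -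
  obtain v \<alpha> where c: "controlled_path X v \<alpha>" by (rule paths_controlled[OF X])
  interpret controlled_path X v \<alpha> by (rule c)
  show thesis
  proof (rule that[of \<alpha> v])
    fix \<beta> i assume \<beta>: "0 \<le> \<beta>" "\<beta> \<le> \<alpha>"
    obtain C where C: "C \<ge> 0" "\<And>s t. 0 \<le> s \<Longrightarrow> s \<le> t \<Longrightarrow> t \<le> dur X \<Longrightarrow>
        \<bar>pos X t i - pos X s i\<bar> \<le> C * (v t - v s) powr \<alpha>"
      by (rule HE[OF pos_H[of i]]) blast
    let ?M = "(v (dur X) - v 0) powr (\<alpha> - \<beta>)"
    have "\<bar>pos X t i - pos X s i\<bar> \<le> (C * ?M) * (v t - v s) powr \<beta>"
      if st: "0 \<le> s" "s \<le> t" "t \<le> dur X" for s t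
    proof -
      have "(v t - v s) powr \<alpha> = (v t - v s) powr (\<alpha> - \<beta>) * (v t - v s) powr \<beta>"
        by (simp add: powr_add[symmetric])
      also have "\<dots> \<le> ?M * (v t - v s) powr \<beta>"
        using v_diff_mono[of 0 s t "dur X"] st \<beta> by (intro mult_right_mono powr_mono2) auto
      finally have "C * (v t - v s) powr \<alpha> \<le> C * (?M * (v t - v s) powr \<beta>)"
        using C(1) by (rule mult_left_mono)
      then show ?thesis using C(2)[OF st] by simp
    qed
    then show "\<exists>C\<ge>0. \<forall>s t. 0 \<le> s \<longrightarrow> s \<le> t \<longrightarrow> t \<le> dur X \<longrightarrow>
       \<bar>pos X t i - pos X s i\<bar> \<le> C * (v t - v s) powr \<beta>"
      using C(1) by (intro exI[of _ "C * ?M"]) auto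
  qed (use alpha alpha_le v_mono in auto)
qed

lemma concat_in_paths:
  assumes X: "X \<in> paths d" and Y: "Y \<in> paths d"
  shows "X \<squnion>\<^sub>p Y \<in> paths d"
proof -
  obtain v1 \<alpha>1 where 1: "1 / 2 < \<alpha>1" "\<alpha>1 \<le> 1"
    "\<And>s t. 0 \<le> s \<Longrightarrow> s \<le> t \<Longrightarrow> t \<le> dur X \<Longrightarrow> v1 s \<le> v1 t"
    "\<And>\<beta> i. 0 \<le> \<beta> \<Longrightarrow> \<beta> \<le> \<alpha>1 \<Longrightarrow> \<exists>C\<ge>0. \<forall>s t. 0 \<le> s \<longrightarrow> s \<le> t \<longrightarrow> t \<le> dur X \<longrightarrow>
       \<bar>pos X t i - pos X s i\<bar> \<le> C * (v1 t - v1 s) powr \<beta>"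
    by (rule paths_bound[OF X]) blast
  obtain v2 \<alpha>2 where 2: "1 / 2 < \<alpha>2" "\<alpha>2 \<le> 1"
    "\<And>s t. 0 \<le> s \<Longrightarrow> s \<le> t \<Longrightarrow> t \<le> dur Y \<Longrightarrow> v2 s \<le> v2 t"
    "\<And>\<beta> i. 0 \<le> \<beta> \<Longrightarrow> \<beta> \<le> \<alpha>2 \<Longrightarrow> \<exists>C\<ge>0. \<forall>s t. 0 \<le> s \<longrightarrow> s \<le> t \<longrightarrow> t \<le> dur Y \<longrightarrow>
       \<bar>pos Y t i - pos Y s i\<bar> \<le> C * (v2 t - v2 s) powr \<beta>"
    by (rule paths_bound[OF Y]) blast
  note dX = pathsD(1)[OF X] and dY = pathsD(1)[OF Y]
  define \<alpha> where "\<alpha> = min \<alpha>1 \<alpha>2"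
  define a where "a s = min s (dur X)" for s
  define b where "b s = max 0 (s - dur X)" for s
  \<comment> \<open>Each summand is constant while the other path runs, so either path is controlled
    by its own summand.\<close>
  define v where "v s = v1 (a s) + v2 (b s)" for s
  have ab: "0 \<le> a s" "a s \<le> a t" "a t \<le> dur X" "0 \<le> b s" "b s \<le> b t" "b t \<le> dur Y"
    if "0 \<le> s" "s \<le> t" "t \<le> dur X + dur Y" for s t
    using that dX dY by (auto simp: a_def b_def)
  interpret control "dur X + dur Y" v \<alpha>
  proof
    show "v s \<le> v t" if "0 \<le> s" "s \<le> t" "t \<le> dur X + dur Y" for s t
      unfolding v_def using ab[OF that] by (intro add_mono 1(3) 2(3)) auto
  qed (use 1 2 dX dY in \<open>auto simp: \<alpha>_def\<close>)
  show ?thesis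
  proof (rule controlled_imp_paths)
    fix i
    obtain C where C: "C \<ge> 0" "\<And>s t. 0 \<le> s \<Longrightarrow> s \<le> t \<Longrightarrow> t \<le> dur X \<Longrightarrow>
        \<bar>pos X t i - pos X s i\<bar> \<le> C * (v1 t - v1 s) powr \<alpha>"
      using 1(4)[of \<alpha> i] alpha by (auto simp: \<alpha>_def)
    obtain D where D: "D \<ge> 0" "\<And>s t. 0 \<le> s \<Longrightarrow> s \<le> t \<Longrightarrow> t \<le> dur Y \<Longrightarrow>
        \<bar>pos Y t i - pos Y s i\<bar> \<le> D * (v2 t - v2 s) powr \<alpha>"
      using 2(4)[of \<alpha> i] alpha by (auto simp: \<alpha>_def)
    have "(\<lambda>s. pos X (a s) i + pos Y (b s) i) \<in> H"
    proof (rule HI[of _ "C + D"])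
      show "continuous_on {0..dur X + dur Y} (\<lambda>s. pos X (a s) i + pos Y (b s) i)"
      proof (intro continuous_on_add)
        show "continuous_on {0..dur X + dur Y} (\<lambda>s. pos X (a s) i)"
          by (rule continuous_on_compose2[OF pathsD(5)[OF X]])
            (use ab(1,3) in \<open>auto simp: a_def intro!: continuous_intros\<close>)
        show "continuous_on {0..dur X + dur Y} (\<lambda>s. pos Y (b s) i)"
          by (rule continuous_on_compose2[OF pathsD(5)[OF Y]])
            (use ab(4,6) in \<open>auto simp: b_def intro!: continuous_intros\<close>)
      qed
      fix s t assume st: "0 \<le> s" "s \<le> t" "t \<le> dur X + dur Y"
      note r = ab[OF st]
      have le: "v1 (a s) \<le> v1 (a t)" "v2 (b s) \<le> v2 (b t)" using r by (intro 1(3) 2(3); simp)+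
      have "\<bar>pos X (a t) i - pos X (a s) i\<bar> \<le> C * (v1 (a t) - v1 (a s)) powr \<alpha>"
        using r by (intro C(2))
      also have "\<dots> \<le> C * (v t - v s) powr \<alpha>"
        using le C(1) alpha by (intro mult_left_mono powr_mono2) (auto simp: v_def)
      finally have *: "\<bar>pos X (a t) i - pos X (a s) i\<bar> \<le> C * (v t - v s) powr \<alpha>" .
      have "\<bar>pos Y (b t) i - pos Y (b s) i\<bar> \<le> D * (v2 (b t) - v2 (b s)) powr \<alpha>"
        using r by (intro D(2))
      also have "\<dots> \<le> D * (v t - v s) powr \<alpha>"
        using le D(1) alpha by (intro mult_left_mono powr_mono2) (auto simp: v_def)
      finally have **: "\<bar>pos Y (b t) i - pos Y (b s) i\<bar> \<le> D * (v t - v s) powr \<alpha>" .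
      show "\<bar>pos X (a t) i + pos Y (b t) i - (pos X (a s) i + pos Y (b s) i)\<bar>
          \<le> (C + D) * (v t - v s) powr \<alpha>"
        using * ** unfolding distrib_right by linarith
    qed (use C D in auto)
    then show "(\<lambda>s. pos (X \<squnion>\<^sub>p Y) s i) \<in> H"
      by (rule H_cong) (simp add: pos_concat[OF X Y] a_def b_def)
    show "pos (X \<squnion>\<^sub>p Y) 0 i = 0"
      using dX dY pathsD(4)[OF X] pathsD(4)[OF Y] by (simp add: pos_concat[OF X Y])
  next
    fix s i assume "s \<notin> {0..dur X + dur Y} \<or> i \<notin> {1..d}"
    then show "pos (X \<squnion>\<^sub>p Y) s i = 0"
      using pathsD(3)[OF X] pathsD(3)[OF Y] by (auto simp: pos_concat[OF X Y])
  qed (use 1 2 dX dY in \<open>auto simp: \<alpha>_def\<close>)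
qed

lemma reversal_in_paths:
  assumes X: "X \<in> paths d"
  shows "reversal X \<in> paths d"
proof -
  obtain v1 \<alpha> where c: "controlled_path X v1 \<alpha>" by (rule paths_controlled[OF X])
  interpret c: controlled_path X v1 \<alpha> by (rule c)
  \<comment> \<open>The control of \<open>X\<close> reflected in time; the sign restores
    monotonicity.\<close>
  define v where "v s = - v1 (dur X - s)" for s
  interpret control "dur X" v \<alpha>
    by unfold_locales (use c.v_mono c.alpha c.T_nonneg in \<open>auto simp: v_def\<close>)
  show ?thesis
  proof (rule controlled_imp_paths)
    fix i
    obtain C where C: "C \<ge> 0" "\<And>s t. 0 \<le> s \<Longrightarrow> s \<le> t \<Longrightarrow> t \<le> dur X \<Longrightarrow>
        \<bar>pos X t i - pos X s i\<bar> \<le> C * (v1 t - v1 s) powr \<alpha>"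
      by (rule c.HE[OF c.pos_H[of i]]) blast
    have "(\<lambda>s. pos X (dur X - s) i - pos X (dur X) i) \<in> H"
    proof (rule HI[OF _ C(1)])
      show "continuous_on {0..dur X} (\<lambda>s. pos X (dur X - s) i - pos X (dur X) i)"
        by (intro continuous_intros continuous_on_compose2[OF pathsD(5)[OF X]]) auto
      fix s t assume "0 \<le> s" "s \<le> t" "t \<le> dur X"
      then have "\<bar>pos X (dur X - s) i - pos X (dur X - t) i\<bar>
          \<le> C * (v1 (dur X - s) - v1 (dur X - t)) powr \<alpha>" by (intro C(2)) auto
      then show "\<bar>pos X (dur X - t) i - pos X (dur X) i - (pos X (dur X - s) i - pos X (dur X) i)\<bar>
          \<le> C * (v t - v s) powr \<alpha>" by (simp add: v_def abs_minus_commute)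
    qed
    then show "(\<lambda>s. pos (reversal X) s i) \<in> H" by (rule H_cong) (simp add: pos_reversal)
    show "pos (reversal X) 0 i = 0" by (simp add: pos_reversal)
  next
    fix s i assume "s \<notin> {0..dur X} \<or> i \<notin> {1..d}"
    then show "pos (reversal X) s i = 0" using pathsD(3)[OF X] by (auto simp: pos_reversal)
  qed (use c.alpha_le pathsD(1)[OF X] in auto)
qed

lemma reversal_reversal:
  assumes "X \<in> paths d"
  shows "reversal (reversal X) = X"
  by (rule path_eqI) (use pathsD(2,4)[OF assms] in \<open>auto simp: pos_reversal\<close>)

lemma reversal_concat:
  assumes X: "X \<in> paths d" and Y: "Y \<in> paths d"
  shows "reversal (X \<squnion>\<^sub>p Y) = reversal Y \<squnion>\<^sub>p reversal X"
proof (rule path_eqI)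
  fix s i
  note p = pos_concat[OF X Y] pos_concat[OF Y[THEN reversal_in_paths] X[THEN reversal_in_paths]]
    pos_reversal pathsD(4)[OF X] pathsD(4)[OF Y]
  show "pos (reversal (X \<squnion>\<^sub>p Y)) s i = pos (reversal Y \<squnion>\<^sub>p reversal X) s i"
    using pathsD(1)[OF X] pathsD(1)[OF Y]
    by (cases "s \<le> dur Y") (auto simp: p min_def max_def algebra_simps)
qed simp

lemma concat_assoc:
  assumes X: "X \<in> paths d" and Y: "Y \<in> paths d" and Z: "Z \<in> paths d"
  shows "X \<squnion>\<^sub>p Y \<squnion>\<^sub>p Z = X \<squnion>\<^sub>p (Y \<squnion>\<^sub>p Z)"
proof (rule path_eqI)
  fix s i
  note p = pos_concat[OF X Y] pos_concat[OF Y Z] pos_concat[OF concat_in_paths[OF X Y] Z]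
    pos_concat[OF X concat_in_paths[OF Y Z]]
    pathsD(4)[OF X] pathsD(4)[OF Y] pathsD(4)[OF Z]
  show "pos (X \<squnion>\<^sub>p Y \<squnion>\<^sub>p Z) s i = pos (X \<squnion>\<^sub>p (Y \<squnion>\<^sub>p Z)) s i"
    using pathsD(1)[OF X] pathsD(1)[OF Y] pathsD(1)[OF Z]
    by (cases "s \<le> dur X"; cases "s \<le> dur X + dur Y")
      (auto simp: p min_def max_def algebra_simps)
qed simp

lemma (in controlled_path) has_RS_integral_iter_int:
  assumes "0 \<le> a" "a \<le> b" "b \<le> dur X"
  shows "has_RS_integral (iter_int X w) (\<lambda>s. pos X s i) a b
    (iter_int X (i # w) b - iter_int X (i # w) a)"
  by (rule has_RS_integral_of_rs_diff[OF iter_int_H pos_H rs_diff_iter_int assms])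

lemma has_RS_integral_iter_int:
  assumes "X \<in> paths d" "0 \<le> a" "a \<le> b" "b \<le> dur X"
  shows "has_RS_integral (iter_int X w) (\<lambda>s. pos X s i) a b
    (iter_int X (i # w) b - iter_int X (i # w) a)"
proof -
  obtain v \<alpha> where c: "controlled_path X v \<alpha>" by (rule paths_controlled[OF assms(1)])
  show ?thesis by (rule controlled_path.has_RS_integral_iter_int[OF c assms(2-)])
qed

lemma iter_int_concat_left:
  assumes X: "X \<in> paths d" and Y: "Y \<in> paths d"
  shows "0 \<le> s \<Longrightarrow> s \<le> dur X \<Longrightarrow> iter_int (X \<squnion>\<^sub>p Y) w s = iter_int X w s"
proof (induction w arbitrary: s)
  case (Cons i w)
  show ?case unfolding iter_int.simps
    by (rule RS_integral_cong) (use Cons in \<open>auto simp: pos_concat_left[OF Y]\<close>)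
qed simp

text \<open>Chen's identity; words are reversed as in \<open>iter_int\<close>.\<close>

lemma iter_int_concat_right:
  assumes X: "X \<in> paths d" and Y: "Y \<in> paths d"
  shows "0 \<le> s \<Longrightarrow> s \<le> dur Y \<Longrightarrow> iter_int (X \<squnion>\<^sub>p Y) w (dur X + s) =
    (\<Sum>k\<le>length w. iter_int X (drop k w) (dur X) * iter_int Y (take k w) s)"
proof (induction w arbitrary: s)
  case (Cons i w)
  let ?Z = "X \<squnion>\<^sub>p Y"
  note dX = pathsD(1)[OF X] and dY = pathsD(1)[OF Y]
  have 0: "has_RS_integral (iter_int ?Z w) (\<lambda>r. pos ?Z r i) 0 (dur X + s)
      (iter_int ?Z (i # w) (dur X + s) - iter_int ?Z (i # w) 0)"
    using Cons dX by (intro has_RS_integral_iter_int[OF concat_in_paths[OF X Y]]) auto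
  have 1: "has_RS_integral (iter_int ?Z w) (\<lambda>r. pos ?Z r i) 0 (dur X)
      (iter_int ?Z (i # w) (dur X) - iter_int ?Z (i # w) 0)"
    using dX dY by (intro has_RS_integral_iter_int[OF concat_in_paths[OF X Y]]) auto
  \<comment> \<open>By induction the integrand is a combination of time-shifted iterated integrals
    of \<open>Y\<close>; the constant \<open>pos X (dur X) i\<close> drops out of the increments of
    the integrator.\<close>
  have 2: "has_RS_integral (iter_int ?Z w) (\<lambda>r. pos ?Z r i) (dur X) (dur X + s)
      (\<Sum>k\<le>length w. iter_int X (drop k w) (dur X) * (iter_int Y (i # take k w) s - iter_int Y (i # take k w) 0))"
  proof -
    have "has_RS_integral
       (\<lambda>r. \<Sum>k\<le>length w. iter_int X (drop k w) (dur X) * iter_int Y (take k w) (r - dur X))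
       (\<lambda>r. pos Y (r - dur X) i + pos X (dur X) i) (0 + dur X) (s + dur X)
       (\<Sum>k\<le>length w. iter_int X (drop k w) (dur X) * (iter_int Y (i # take k w) s - iter_int Y (i # take k w) 0))"
      using Cons.prems
      by (intro has_RS_integral_add_const_right has_RS_integral_sum_left has_RS_integral_cmult_left
          has_RS_integral_shift has_RS_integral_iter_int[OF Y]) auto
    then show ?thesis
    proof (subst has_RS_integral_cong[where
          f' = "\<lambda>r. \<Sum>k\<le>length w. iter_int X (drop k w) (dur X) * iter_int Y (take k w) (r - dur X)" and
          g' = "\<lambda>r. pos Y (r - dur X) i + pos X (dur X) i"])
      fix r assume r: "dur X \<le> r" "r \<le> dur X + s"
      then show "iter_int ?Z w r =
          (\<Sum>k\<le>length w. iter_int X (drop k w) (dur X) * iter_int Y (take k w) (r - dur X))"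
        using Cons.IH[of "r - dur X"] Cons.prems by simp
      show "pos ?Z r i = pos Y (r - dur X) i + pos X (dur X) i"
        using r Cons.prems dX by (simp add: pos_concat[OF X Y])
    qed (simp add: add.commute)
  qed
  have "iter_int ?Z (i # w) (dur X + s) - iter_int ?Z (i # w) 0 =
     (iter_int ?Z (i # w) (dur X) - iter_int ?Z (i # w) 0) +
     (\<Sum>k\<le>length w. iter_int X (drop k w) (dur X) * (iter_int Y (i # take k w) s - iter_int Y (i # take k w) 0))"
    using has_RS_integral_combine[OF 0 1 2] Cons.prems dX by simp
  moreover have "iter_int ?Z (i # w) (dur X) = iter_int X (i # w) (dur X)"
    using dX by (intro iter_int_concat_left[OF X Y]) auto
  ultimately have "iter_int ?Z (i # w) (dur X + s) = iter_int X (i # w) (dur X) +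
     (\<Sum>k\<le>length w. iter_int X (drop k w) (dur X) * iter_int Y (i # take k w) s)"
    by (simp add: iter_int_0 del: iter_int.simps(2))
  \<comment> \<open>The summand \<open>k = 0\<close> is the integral over \<open>X\<close> alone;
    the others are the sum above with its index shifted by one.\<close>
  then show ?case
    by (subst length_Cons, subst sum.atMost_Suc_shift) (simp del: iter_int.simps(2))
qed simp

text \<open>Dual to left multiplication by the signature of \<open>X\<close>, without the term in
  which the whole word is spent on \<open>X\<close>. That term is the plain value
  \<open>sig X x\<close>; leaving it out keeps the result in \<open>T_ge1\<close>.\<close>

definition chop :: "path \<Rightarrow> tensor \<Rightarrow> tensor"
  where "chop X = lin_ext (\<lambda>w. \<Sum>k<length w. sig X (word (take k w)) *\<^sub>R word (drop k w))"

lemma linear_chop: "linear (chop X)"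
  unfolding chop_def by (rule linear_lin_ext)

lemma sig_at_concat_right:
  assumes X: "X \<in> paths d" and Y: "Y \<in> paths d" and s: "0 \<le> s" "s \<le> dur Y"
  shows "sig_at (X \<squnion>\<^sub>p Y) (dur X + s) x = sig X x + sig_at Y s (chop X x)"
proof (rule linear_eq_on_words[of "sig_at (X \<squnion>\<^sub>p Y) (dur X + s)"])
  show "linear (\<lambda>x. sig X x + sig_at Y s (chop X x))"
    using linear_sig linear_compose[OF linear_chop linear_sig_at, unfolded o_def]
    by (rule linear_compose_add)
  fix w :: "nat list"
  let ?n = "length w"
  have "sig_at (X \<squnion>\<^sub>p Y) (dur X + s) (word w) =
      (\<Sum>k\<le>?n. iter_int X (drop k (rev w)) (dur X) * iter_int Y (take k (rev w)) s)"
    using iter_int_concat_right[OF X Y s, of "rev w"] by simp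
  also have "\<dots> = (\<Sum>k\<le>?n. iter_int X (rev (take (?n - k) w)) (dur X) * iter_int Y (rev (drop (?n - k) w)) s)"
    by (simp add: take_rev drop_rev)
  also have "\<dots> = (\<Sum>k\<le>?n. iter_int X (rev (take k w)) (dur X) * iter_int Y (rev (drop k w)) s)"
    using sum.atLeastAtMost_rev[of "\<lambda>k. iter_int X (rev (take k w)) (dur X) * iter_int Y (rev (drop k w)) s" 0 ?n]
    by (simp add: atLeast0AtMost)
  also have "\<dots> = sig X (word w) + sig_at Y s (chop X (word w))"
    by (simp add: chop_def sig_at_sum sig_at_scaleR sig_eq_sig_at lessThan_Suc_atMost[symmetric])
  finally show "sig_at (X \<squnion>\<^sub>p Y) (dur X + s) (word w) = sig X (word w) + sig_at Y s (chop X (word w))" .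
qed (rule linear_sig_at)

lemma sig_at_concat_left:
  assumes "X \<in> paths d" "Y \<in> paths d" "0 \<le> s" "s \<le> dur X"
  shows "sig_at (X \<squnion>\<^sub>p Y) s x = sig_at X s x"
  unfolding sig_at_def by (intro lin_ext_cong iter_int_concat_left[OF assms])

lemma chop_in_T_ge1:
  assumes "x \<in> T_alg n"
  shows "chop X x \<in> T_ge1 n"
  unfolding chop_def
proof (rule lin_ext_in_subspace[OF subspace_T_ge1])
  fix w assume "w \<in> Poly_Mapping.keys x"
  then have "set w \<subseteq> {1..n}" using assms by (auto simp: T_alg_iff)
  then show "(\<Sum>k<length w. sig X (word (take k w)) *\<^sub>R word (drop k w)) \<in> T_ge1 n"
    using set_drop_subset[of _ w]
    by (intro subspace_sum subspace_scale subspace_T_ge1) (fastforce simp: T_ge1_iff)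
qed

text \<open>Past \<open>dur X\<close> a component equals its end value on \<open>X\<close> plus a
  coordinate of \<open>Y\<close> at the chopped tensor. The end value is what concatenation adds by
  itself.\<close>

lemma Lambda_concat:
  assumes X: "X \<in> paths n" and Y: "Y \<in> paths n"
    and B: "\<And>i. i \<in> {1..m} \<Longrightarrow> B (word [i]) \<in> T_alg n"
  shows "Lambda m B (X \<squnion>\<^sub>p Y) = Lambda m B X \<squnion>\<^sub>p Lambda m (\<lambda>u. chop X (B u)) Y"
proof (rule path_eqI)
  fix s i
  note dX = pathsD(1)[OF X] and dY = pathsD(1)[OF Y]
  show "pos (Lambda m B (X \<squnion>\<^sub>p Y)) s i = pos (Lambda m B X \<squnion>\<^sub>p Lambda m (\<lambda>u. chop X (B u)) Y) s i"
  proof (cases "i \<in> {1..m} \<and> 0 \<le> s \<and> s \<le> dur X + dur Y")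
    case True
    have 0: "sig_at Y 0 (chop X (B (word [i]))) = 0"
      using T_ge1_lookup_Nil[OF chop_in_T_ge1[OF B]] True by (simp add: sig_at_time_0)
    show ?thesis
    proof (cases "s \<le> dur X")
      case le: True
      then show ?thesis using True 0 dY
        by (simp add: pos_Lambda pos_concat_if sig_at_concat_left[OF X Y])
    next
      case False
      then show ?thesis using True 0 dX dY sig_at_concat_right[OF X Y, of "s - dur X"]
        by (simp add: pos_Lambda pos_concat_if sig_eq_sig_at)
    qed
  qed (auto simp: pos_Lambda pos_concat_if)
qed simp

text \<open>Coefficients of the inverse of the signature, determined by the requirement that the
  product with \<open>iter_int X\<close> vanish on nonempty words. The recursion exhibits them as
  polynomials in signature coordinates.\<close>

function sig_inv :: "path \<Rightarrow> nat list \<Rightarrow> real" where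
  "sig_inv X w = (if w = [] then 1
     else - (\<Sum>k\<in>{1..length w}. iter_int X (take k w) (dur X) * sig_inv X (drop k w)))"
  by pat_completeness auto
termination by (relation "Wellfounded.measure (\<lambda>(X, w). length w)") auto

declare sig_inv.simps [simp del]

text \<open>The signature of the reversed path on \<open>[0, s]\<close> is the product, in the tensor algebra, of the
  inverse of the signature of \<open>X\<close> and the signature of \<open>X\<close> on \<open>[0, T - s]\<close>.\<close>

lemma iter_int_reversal:
  assumes X: "X \<in> paths d"
  shows "0 \<le> s \<Longrightarrow> s \<le> dur X \<Longrightarrow> iter_int (reversal X) w s =
    (\<Sum>k\<le>length w. sig_inv X (drop k w) * iter_int X (take k w) (dur X - s))"
proof (induction w arbitrary: s)
  case Nil then show ?case by (simp add: sig_inv.simps)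
next
  case (Cons i w)
  let ?T = "dur X"
  \<comment> \<open>Reflection carries the integral over \<open>[dur X - s, dur X]\<close> to
    \<open>[0, s]\<close> with a change of sign.\<close>
  have "has_RS_integral (\<lambda>r. \<Sum>k\<le>length w. sig_inv X (drop k w) * iter_int X (take k w) (?T - r))
      (\<lambda>r. pos X (?T - r) i + (- pos X ?T i)) (?T - ?T) (?T - (?T - s))
      (\<Sum>k\<le>length w. sig_inv X (drop k w) *
        - (iter_int X (i # take k w) ?T - iter_int X (i # take k w) (?T - s)))"
    using Cons.prems
    by (intro has_RS_integral_add_const_right has_RS_integral_sum_left has_RS_integral_cmult_left
        has_RS_integral_reflect has_RS_integral_iter_int[OF X]) auto
  then have "has_RS_integral (iter_int (reversal X) w) (\<lambda>r. pos (reversal X) r i) 0 s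
      (\<Sum>k\<le>length w. sig_inv X (drop k w) *
        - (iter_int X (i # take k w) ?T - iter_int X (i # take k w) (?T - s)))"
    using Cons
    by (subst has_RS_integral_cong[where
          f' = "\<lambda>r. \<Sum>k\<le>length w. sig_inv X (drop k w) * iter_int X (take k w) (?T - r)" and
          g' = "\<lambda>r. pos X (?T - r) i + (- pos X ?T i)"]) (auto simp: pos_reversal)
  then have "iter_int (reversal X) (i # w) s =
      (\<Sum>k\<le>length w. sig_inv X (drop k w) *
        - (iter_int X (i # take k w) ?T - iter_int X (i # take k w) (?T - s)))"
    unfolding iter_int.simps(2)[of "reversal X"] using Cons.prems by (intro RS_integral_eq)
  also have "\<dots> = - (\<Sum>k\<le>length w. iter_int X (i # take k w) ?T * sig_inv X (drop k w)) +
      (\<Sum>k\<le>length w. sig_inv X (drop k w) * iter_int X (i # take k w) (?T - s))"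
    by (simp add: sum.distrib[symmetric] sum_negf[symmetric] algebra_simps del: iter_int.simps(2))
  \<comment> \<open>The boundary values at the end of \<open>X\<close> make up the recursion of
    \<open>sig_inv\<close> at \<open>i # w\<close>.\<close>
  also have "- (\<Sum>k\<le>length w. iter_int X (i # take k w) ?T * sig_inv X (drop k w)) = sig_inv X (i # w)"
  proof -
    have "(\<Sum>k\<in>{1..length (i # w)}. iter_int X (take k (i # w)) ?T * sig_inv X (drop k (i # w)))
       = (\<Sum>k\<le>length w. iter_int X (i # take k w) ?T * sig_inv X (drop k w))"
      using sum.shift_bounds_cl_Suc_ivl[of "\<lambda>k. iter_int X (take k (i # w)) ?T * sig_inv X (drop k (i # w))" 0 "length w"]
      by (simp add: atLeast0AtMost del: iter_int.simps(2))
    then show ?thesis by (subst (2) sig_inv.simps) (simp del: iter_int.simps(2))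
  qed
  finally show ?case
    by (subst length_Cons, subst sum.atMost_Suc_shift) (simp del: iter_int.simps(2))
qed

lemma sig_reversal:
  assumes X: "X \<in> paths d"
  shows "sig (reversal X) (word w) = sig_inv X (rev w)"
proof -
  have "sig (reversal X) (word w) =
      (\<Sum>k\<le>length w. sig_inv X (drop k (rev w)) * iter_int X (take k (rev w)) 0)"
    using iter_int_reversal[OF X, of "dur X" "rev w"] pathsD(1)[OF X] by (simp add: sig_eq_sig_at)
  \<comment> \<open>At time \<open>dur X\<close> what is left of \<open>X\<close> is a point, where
    only the empty word contributes.\<close>
  also have "\<dots> = (\<Sum>k\<in>{0}. sig_inv X (drop k (rev w)) * iter_int X (take k (rev w)) 0)"
  proof (rule sum.mono_neutral_right)
    have "iter_int X u 0 = 0" if "u \<noteq> []" for u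
      using that iter_int_0 by (cases u) (auto simp del: iter_int.simps(2))
    then have "iter_int X (take k (rev w)) 0 = 0" if "k \<in> {..length w} - {0}" for k
    proof -
      have "take k (rev w) \<noteq> []" using that by (cases w) auto
      with \<open>\<And>u. u \<noteq> [] \<Longrightarrow> iter_int X u 0 = 0\<close> show ?thesis by blast
    qed
    then show "\<forall>k\<in>{..length w} - {0}. sig_inv X (drop k (rev w)) * iter_int X (take k (rev w)) 0 = 0"
      by simp
  qed auto
  finally show ?thesis by simp
qed

section \<open>Coordinates of single letters\<close>

lemma iter_int_singleton:
  assumes "X \<in> paths d" "0 \<le> s"
  shows "iter_int X [j] s = pos X s j"
proof -
  have "has_RS_integral (\<lambda>_. 1) (\<lambda>r. pos X r j) 0 s (pos X s j - pos X 0 j)"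
    unfolding has_RS_integral_iff_tendsto
  proof (rule tendsto_eventually)
    have "RS_sum (\<lambda>_. 1) (\<lambda>r. pos X r j) P = pos X s j - pos X 0 j" if "tagged_seq 1 0 s P" for P
    proof -
      obtain n u \<xi> where P: "P = (n, u, \<xi>)" by (cases P)
      show ?thesis
        using tagged_seqD(1,2)[OF that[unfolded P]] sum_lessThan_telescope[of "\<lambda>k. pos X (u k) j" n]
        by (simp add: P RS_sum_def)
    qed
    then show "\<forall>\<^sub>F P in RS_filter 0 s. RS_sum (\<lambda>_. 1) (\<lambda>r. pos X r j) P = pos X s j - pos X 0 j"
      unfolding eventually_RS_filter by (intro exI[of _ 1]) auto
  qed
  then show ?thesis using RS_integral_eq assms pathsD(4)[OF assms(1)] by fastforce
qed

lemma sig_at_letters: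
  assumes "X \<in> paths d" "0 \<le> s" "x \<in> letters n"
  shows "sig_at X s x = (\<Sum>j\<in>{1..n}. Poly_Mapping.lookup x [j] * pos X s j)"
  using linear_on_letters[OF linear_sig_at assms(3), of X s] iter_int_singleton[OF assms(1,2)]
  by (simp del: iter_int.simps(2))

text \<open>On letters \<open>Lambda\<close> applies a fixed linear map to the values of the path
  and thus commutes with reversal; for longer words it does not in general.\<close>

lemma reversal_Lambda_letters:
  assumes Y: "Y \<in> paths n" and A: "\<And>i. i \<in> {1..t} \<Longrightarrow> A (word [i]) \<in> letters n"
  shows "reversal (Lambda t A Y) = Lambda t A (reversal Y)"
proof (rule path_eqI)
  fix s i
  have "0 \<le> dur Y" using pathsD(1)[OF Y] by simp
  then show "pos (reversal (Lambda t A Y)) s i = pos (Lambda t A (reversal Y)) s i"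
    using A[of i] by (auto simp: pos_reversal pos_Lambda sig_at_letters[OF Y]
      sig_at_letters[OF reversal_in_paths[OF Y]] right_diff_distrib sum_subtractf)
qed simp


section \<open>Regular maps\<close>

text \<open>One term \<open>sig X x *\<^sub>R z\<close> is added at a time, so closure properties
  become inductions without numbered terms; only values on \<open>paths d\<close> count.\<close>

inductive regular_map :: "nat \<Rightarrow> 'a::real_vector set \<Rightarrow> (path \<Rightarrow> 'a) \<Rightarrow> bool"
  for d U where
  zero: "(\<And>X. X \<in> paths d \<Longrightarrow> h X = 0) \<Longrightarrow> regular_map d U h"
| step: "regular_map d U h \<Longrightarrow> x \<in> T_alg d \<Longrightarrow> z \<in> U \<Longrightarrow>
    (\<And>X. X \<in> paths d \<Longrightarrow> k X = h X + sig X x *\<^sub>R z) \<Longrightarrow> regular_map d U k"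

abbreviation regular_fun :: "nat \<Rightarrow> (path \<Rightarrow> real) \<Rightarrow> bool"
  where "regular_fun d \<equiv> regular_map d UNIV"

lemma sig_word_Nil [simp]: "sig X (word []) = 1"
  by (simp add: sig_eq_sig_at)

lemma sig_shuffle:
  assumes "X \<in> paths d"
  shows "sig X (shuffle x y) = sig X x * sig X y"
proof -
  obtain v \<alpha> where c: "controlled_path X v \<alpha>" by (rule paths_controlled[OF assms])
  show ?thesis unfolding sig_eq_sig_at
    by (rule controlled_path.sig_at_shuffle[OF c]) (use pathsD(1)[OF assms] in auto)
qed

lemma regular_map_cong:
  assumes "regular_map d U h" "\<And>X. X \<in> paths d \<Longrightarrow> k X = h X"
  shows "regular_map d U k"
  using assms
proof (induction arbitrary: k rule: regular_map.induct)
  case (zero h) then show ?case by (auto intro: regular_map.zero)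
next
  case (step h x z h') then show ?case by (intro regular_map.step[OF step(1-3)]) auto
qed

lemma regular_map_monom: "x \<in> T_alg d \<Longrightarrow> z \<in> U \<Longrightarrow> regular_map d U (\<lambda>X. sig X x *\<^sub>R z)"
  by (rule regular_map.step[OF regular_map.zero[of d "\<lambda>_. 0"]]) auto

lemma regular_map_const: "z \<in> U \<Longrightarrow> regular_map d U (\<lambda>X. z)"
  using regular_map_monom[of "word []" d z U] by (simp add: word_in_T_alg)

lemma regular_fun_sig: "x \<in> T_alg d \<Longrightarrow> regular_fun d (\<lambda>X. sig X x)"
  using regular_map_monom[of x d "1 :: real" UNIV] by simp

lemma regular_map_add:
  assumes "regular_map d U h" "regular_map d U k"
  shows "regular_map d U (\<lambda>X. h X + k X)"
  using assms(2)
proof (induction rule: regular_map.induct)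
  case (zero k)
  then show ?case by (intro regular_map_cong[OF assms(1)]) auto
next
  case (step k x z k')
  show ?case by (rule regular_map.step[OF step(5,2,3)]) (simp add: step(4))
qed

lemma regular_map_sum:
  "(\<And>j. j \<in> S \<Longrightarrow> regular_map d U (h j)) \<Longrightarrow> regular_map d U (\<lambda>X. \<Sum>j\<in>S. h j X)"
  by (induction S rule: infinite_finite_induct) (auto intro: regular_map_add regular_map.zero)

lemma regular_map_linear:
  assumes "regular_map d U h" "linear L" "\<And>z. z \<in> U \<Longrightarrow> L z \<in> V"
  shows "regular_map d V (\<lambda>X. L (h X))"
  using assms(1)
proof (induction rule: regular_map.induct)
  case (zero h)
  then show ?case by (intro regular_map.zero) (simp add: linear_0[OF assms(2)])
next
  case (step h x z k)
  show ?case by (rule regular_map.step[OF step(5,2) assms(3)[OF step(3)]])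
    (simp add: step(4) linear_add[OF assms(2)] linear_scale[OF assms(2)])
qed

lemma regular_map_mono: "regular_map d U h \<Longrightarrow> U \<subseteq> V \<Longrightarrow> regular_map d V h"
  by (rule regular_map_linear[where U = U, OF _ linear_ident]) auto

text \<open>Products of signature coordinates are coordinates of shuffles, so regular functions act
  on regular maps.\<close>

lemma regular_map_scaleR:
  assumes f: "regular_fun d f" and h: "regular_map d U h" and U: "subspace U"
  shows "regular_map d U (\<lambda>X. f X *\<^sub>R h X)"
  using h
proof (induction rule: regular_map.induct)
  case (zero h) then show ?case by (intro regular_map.zero) simp
next
  case (step h x z k)
  have "regular_map d U (\<lambda>X. f X *\<^sub>R (sig X x *\<^sub>R z))"
    using f
  proof (induction rule: regular_map.induct)
    case (zero f) then show ?case by (intro regular_map.zero) simp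
  next
    case (step f y c g)
    show ?case
    proof (rule regular_map.step[OF step(5)])
      show "shuffle y x \<in> T_alg d" using step \<open>x \<in> T_alg d\<close> by (intro shuffle_in_T_alg)
      show "c *\<^sub>R z \<in> U" using U \<open>z \<in> U\<close> by (intro subspace_scale)
      fix X assume "X \<in> paths d"
      then show "g X *\<^sub>R (sig X x *\<^sub>R z) = f X *\<^sub>R (sig X x *\<^sub>R z) + sig X (shuffle y x) *\<^sub>R (c *\<^sub>R z)"
        using step(4) by (simp add: sig_shuffle algebra_simps)
    qed
  qed
  from regular_map_add[OF step(5) this] show ?case
    by (rule regular_map_cong) (simp add: step(4) scaleR_add_right)
qed

lemma regular_fun_mult:
  "regular_fun d f \<Longrightarrow> regular_fun d g \<Longrightarrow> regular_fun d (\<lambda>X. f X * g X)"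
  using regular_map_scaleR[of d f UNIV g] by simp

lemma regular_fun_uminus: "regular_fun d f \<Longrightarrow> regular_fun d (\<lambda>X. - f X)"
  using regular_map_linear[of d UNIV f "\<lambda>x. - x" UNIV] linear_compose_neg[OF linear_ident] by simp

text \<open>Both the linear map and its argument depend on \<open>X\<close>. Expanding the argument
  into fixed vectors with coefficients \<open>sig X x\<close> leaves only the maps
  \<open>L X z\<close> with fixed \<open>z\<close>. The typical \<open>L X\<close> is
  \<open>sig\<close>, \<open>chop\<close> or \<open>Lambda_hom\<close> of something varying with
  \<open>X\<close>.\<close>

lemma regular_map_apply:
  assumes U: "subspace U" and h: "regular_map d V h"
    and L: "\<And>z. z \<in> V \<Longrightarrow> regular_map d U (\<lambda>X. L X z)"
    and lin: "\<And>X. X \<in> paths d \<Longrightarrow> linear (L X)"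
  shows "regular_map d U (\<lambda>X. L X (h X))"
  using h
proof (induction rule: regular_map.induct)
  case (zero h) then show ?case by (intro regular_map.zero) (simp add: linear_0[OF lin])
next
  case (step h x z k)
  have "regular_map d U (\<lambda>X. L X (h X) + sig X x *\<^sub>R L X z)"
    using step by (intro regular_map_add regular_map_scaleR regular_fun_sig L U)
  then show ?case
    by (rule regular_map_cong) (simp add: step(4) linear_add[OF lin] linear_scale[OF lin])
qed

lemma regular_map_lin_ext:
  assumes "subspace U" "\<And>w. w \<in> Poly_Mapping.keys x \<Longrightarrow> regular_map d U (\<lambda>X. g X w)"
  shows "regular_map d U (\<lambda>X. lin_ext (g X) x)"
  unfolding lin_ext_def
  by (intro regular_map_sum regular_map_linear[OF assms(2)] linearI)
    (auto simp: scaleR_add_right intro: subspace_scale[OF assms(1)])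

lemma regular_map_list:
  assumes "regular_map d U h"
  obtains ps where "\<And>p. p \<in> set ps \<Longrightarrow> fst p \<in> T_alg d \<and> snd p \<in> U"
    "\<And>X. X \<in> paths d \<Longrightarrow> h X = (\<Sum>p\<leftarrow>ps. sig X (fst p) *\<^sub>R snd p)"
proof -
  have "\<exists>ps. (\<forall>p\<in>set ps. fst p \<in> T_alg d \<and> snd p \<in> U) \<and>
      (\<forall>X\<in>paths d. h X = (\<Sum>p\<leftarrow>ps. sig X (fst p) *\<^sub>R snd p))"
    using assms
  proof (induction rule: regular_map.induct)
    case (zero h) then show ?case by (intro exI[of _ "[]"]) simp
  next
    case (step h x z k)
    then obtain ps where "\<forall>p\<in>set ps. fst p \<in> T_alg d \<and> snd p \<in> U"
      "\<forall>X\<in>paths d. h X = (\<Sum>p\<leftarrow>ps. sig X (fst p) *\<^sub>R snd p)" by blast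
    then show ?case using step by (intro exI[of _ "(x, z) # ps"]) (simp add: add.commute)
  qed
  then show thesis using that by blast
qed

text \<open>Scalar target vectors can be absorbed into the tensor, which leaves a single
  coordinate.\<close>

lemma regular_fun_single:
  assumes "regular_fun d f"
  obtains x where "x \<in> T_alg d" "\<And>X. X \<in> paths d \<Longrightarrow> f X = sig X x"
proof -
  have "\<exists>x\<in>T_alg d. \<forall>X\<in>paths d. f X = sig X x"
    using assms
  proof (induction rule: regular_map.induct)
    case (zero h)
    then show ?case by (intro bexI[of _ 0]) (auto simp: linear_0[OF linear_sig] subspace_0[OF subspace_T_alg])
  next
    case (step h x z k)
    then obtain y where "y \<in> T_alg d" "\<forall>X\<in>paths d. h X = sig X y" by blast
    then show ?case using step
      by (intro bexI[of _ "y + z *\<^sub>R x"])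
        (auto simp: linear_add[OF linear_sig] linear_scale[OF linear_sig]
          intro: subspace_add[OF subspace_T_alg] subspace_scale[OF subspace_T_alg])
  qed
  then show thesis using that by blast
qed

section \<open>Regular maps into spaces of linear maps\<close>

lemma regular_lin_mapD:
  assumes A: "regular_lin_map d (letters m) U A"
  shows "X \<in> paths d \<Longrightarrow> linear (A X)"
    "X \<in> paths d \<Longrightarrow> i \<in> {1..m} \<Longrightarrow> A X (word [i]) \<in> U"
    "i \<in> {1..m} \<Longrightarrow> regular_map d U (\<lambda>X. A X (word [i]))"
proof -
  have l: "word [i] \<in> letters m" if "i \<in> {1..m}" for i using that by (simp add: letters_iff)
  show "X \<in> paths d \<Longrightarrow> linear (A X)" using A by (simp add: regular_lin_map_def lin_maps_def)
  show "X \<in> paths d \<Longrightarrow> i \<in> {1..m} \<Longrightarrow> A X (word [i]) \<in> U"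
    using A l unfolding regular_lin_map_def lin_maps_def by blast
  assume i: "i \<in> {1..m}"
  define P where "P r x v \<longleftrightarrow> (\<forall>j\<in>{1..r}. x j \<in> T_alg d \<and> v j \<in> lin_maps (letters m) U) \<and>
      (\<forall>X\<in>paths d. \<forall>u\<in>letters m. A X u = (\<Sum>j=1..r. sig X (x j) *\<^sub>R v j u))" for r :: nat and x v
  have "\<exists>r x v. P r x v" using A unfolding regular_lin_map_def P_def by (elim conjE ex_forward) auto
  then obtain r x v where "P r x v" by blast
  then have r: "\<forall>j\<in>{1..r}. x j \<in> T_alg d \<and> v j \<in> lin_maps (letters m) U"
    "\<forall>X\<in>paths d. \<forall>u\<in>letters m. A X u = (\<Sum>j=1..r. sig X (x j) *\<^sub>R v j u)"
    unfolding P_def by auto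
  have "regular_map d U (\<lambda>X. \<Sum>j=1..r. sig X (x j) *\<^sub>R v j (word [i]))"
    using r(1) l[OF i] unfolding lin_maps_def by (intro regular_map_sum regular_map_monom) blast+
  then show "regular_map d U (\<lambda>X. A X (word [i]))"
    by (rule regular_map_cong) (use r(2) l[OF i] in blast)
qed

text \<open>An expansion of the image of the letter \<open>i\<close> becomes one of linear maps when
  every vector is multiplied with the coordinate functional of \<open>i\<close>; the expansions for
  all letters are strung together in one list.\<close>

lemma regular_lin_mapI:
  assumes lin: "\<And>X. X \<in> paths d \<Longrightarrow> linear (A X)" and U: "subspace U"
    and reg: "\<And>i. i \<in> {1..m} \<Longrightarrow> regular_map d U (\<lambda>X. A X (word [i]))"
  shows "regular_lin_map d (letters m) U A"
proof -
  have "\<exists>ps. (\<forall>p\<in>set ps. fst p \<in> T_alg d \<and> snd p \<in> U) \<and>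
      (\<forall>X\<in>paths d. A X (word [i]) = (\<Sum>p\<leftarrow>ps. sig X (fst p) *\<^sub>R snd p))" if i: "i \<in> {1..m}" for i
  proof -
    obtain ps where "\<And>p. p \<in> set ps \<Longrightarrow> fst p \<in> T_alg d \<and> snd p \<in> U"
      "\<And>X. X \<in> paths d \<Longrightarrow> A X (word [i]) = (\<Sum>p\<leftarrow>ps. sig X (fst p) *\<^sub>R snd p)"
      by (rule regular_map_list[OF reg[OF i]]) blast
    then show ?thesis by blast
  qed
  then have "\<forall>i\<in>{1..m}. \<exists>ps. (\<forall>p\<in>set ps. fst p \<in> T_alg d \<and> snd p \<in> U) \<and>
      (\<forall>X\<in>paths d. A X (word [i]) = (\<Sum>p\<leftarrow>ps. sig X (fst p) *\<^sub>R snd p))" by (rule ballI)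
  from bchoice[OF this] obtain ps where "\<forall>i\<in>{1..m}. (\<forall>p\<in>set (ps i). fst p \<in> T_alg d \<and> snd p \<in> U) \<and>
      (\<forall>X\<in>paths d. A X (word [i]) = (\<Sum>p\<leftarrow>ps i. sig X (fst p) *\<^sub>R snd p))" ..
  then have ps: "\<And>i p. i \<in> {1..m} \<Longrightarrow> p \<in> set (ps i) \<Longrightarrow> fst p \<in> T_alg d \<and> snd p \<in> U"
    "\<And>i X. i \<in> {1..m} \<Longrightarrow> X \<in> paths d \<Longrightarrow> A X (word [i]) = (\<Sum>p\<leftarrow>ps i. sig X (fst p) *\<^sub>R snd p)"
    by blast+
  define e where "e i p = (fst p, \<lambda>u. Poly_Mapping.lookup u [i] *\<^sub>R snd p)" for i :: nat and p :: "tensor \<times> tensor"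
  \<comment> \<open>The zero term guarantees the condition \<open>r \<ge> 1\<close>, also when all
    expansions are empty.\<close>
  define L where "L = (0, \<lambda>u. 0) # concat (map (\<lambda>i. map (e i) (ps i)) [1..<Suc m])"
  have L_mem: "fst p \<in> T_alg d \<and> snd p \<in> lin_maps (letters m) U" if "p \<in> set L" for p
  proof -
    have "linear (\<lambda>u :: tensor. Poly_Mapping.lookup u [i] *\<^sub>R z)" for i and z :: tensor
      by (rule linearI) (auto simp: lookup_add scaleR_add_left)
    then have *: "fst (e i q) \<in> T_alg d \<and> snd (e i q) \<in> lin_maps (letters m) U"
      if "i \<in> {1..m}" "q \<in> set (ps i)" for i q
      using ps(1)[OF that] subspace_scale[OF U] by (auto simp: e_def lin_maps_def)
    have "set L = insert (0, \<lambda>u. 0) (\<Union>i\<in>{1..m}. e i ` set (ps i))"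
      by (simp add: L_def atLeastLessThanSuc_atLeastAtMost del: upt_Suc)
    with that have "p \<in> insert (0, \<lambda>u. 0) (\<Union>i\<in>{1..m}. e i ` set (ps i))" by simp
    then show ?thesis
    proof (elim insertE UN_E imageE)
      assume "p = (0, \<lambda>u. 0)"
      then show ?thesis using linear_zero_fun subspace_0[OF U] subspace_0[OF subspace_T_alg]
        by (auto simp: lin_maps_def)
    next
      fix i q assume "i \<in> {1..m}" "p = e i q" "q \<in> set (ps i)"
      then show ?thesis using *[of i q] by simp
    qed
  qed
  have L_sum: "A X u = (\<Sum>p\<leftarrow>L. sig X (fst p) *\<^sub>R snd p u)" if X: "X \<in> paths d" and u: "u \<in> letters m" for X u
  proof -
    have "A X u = (\<Sum>i\<in>{1..m}. Poly_Mapping.lookup u [i] *\<^sub>R A X (word [i]))"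
      by (rule linear_on_letters[OF lin[OF X] u])
    also have "\<dots> = (\<Sum>i\<in>{1..m}. \<Sum>p\<leftarrow>ps i. sig X (fst (e i p)) *\<^sub>R snd (e i p) u)"
    proof (rule sum.cong)
      fix i assume i: "i \<in> {1..m}"
      have "c *\<^sub>R (\<Sum>p\<leftarrow>qs. sig X (fst p) *\<^sub>R snd p) = (\<Sum>p\<leftarrow>qs. sig X (fst p) *\<^sub>R c *\<^sub>R snd p)"
        for c and qs :: "(tensor \<times> tensor) list"
        by (induction qs) (auto simp: scaleR_add_right mult.commute)
      then show "Poly_Mapping.lookup u [i] *\<^sub>R A X (word [i]) =
          (\<Sum>p\<leftarrow>ps i. sig X (fst (e i p)) *\<^sub>R snd (e i p) u)"
        unfolding ps(2)[OF i X] e_def by simp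
    qed simp
    also have "\<dots> = (\<Sum>i\<leftarrow>[1..<Suc m]. \<Sum>p\<leftarrow>ps i. sig X (fst (e i p)) *\<^sub>R snd (e i p) u)"
      unfolding interv_sum_list_conv_sum_set_nat by (simp only: set_upt atLeastLessThanSuc_atLeastAtMost)
    also have "\<dots> = (\<Sum>p\<leftarrow>L. sig X (fst p) *\<^sub>R snd p u)"
    proof -
      have "(\<Sum>i\<leftarrow>xs. \<Sum>p\<leftarrow>ps i. sig X (fst (e i p)) *\<^sub>R snd (e i p) u) =
          (\<Sum>p\<leftarrow>concat (map (\<lambda>i. map (e i) (ps i)) xs). sig X (fst p) *\<^sub>R snd p u)" for xs
        by (induction xs) (auto simp: o_def)
      then show ?thesis by (simp only: L_def) simp
    qed
    finally show ?thesis .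
  qed
  \<comment> \<open>Terms are numbered from 1 in \<open>regular_lin_map_def\<close> but from 0 in
    the list.\<close>
  have "(\<Sum>p\<leftarrow>L. g p) = (\<Sum>j=1..length L. g (L ! (j - 1)))" for g :: "_ \<Rightarrow> tensor"
  proof -
    have "(\<Sum>p\<leftarrow>L. g p) = (\<Sum>j\<in>{0..<length L}. g (L ! j))" by (simp add: sum_list_sum_nth)
    also have "\<dots> = (\<Sum>j=1..length L. g (L ! (j - 1)))"
      by (rule sum.reindex_bij_witness[of _ "\<lambda>j. j - 1" Suc]) auto
    finally show ?thesis .
  qed
  then have *: "A X u = (\<Sum>j=1..length L. sig X (fst (L ! (j - 1))) *\<^sub>R snd (L ! (j - 1)) u)"
    if "X \<in> paths d" "u \<in> letters m" for X u
    using L_sum[OF that] by simp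
  have L_nth: "fst (L ! (j - 1)) \<in> T_alg d \<and> snd (L ! (j - 1)) \<in> lin_maps (letters m) U"
    if "j \<in> {1..length L}" for j
    using that by (intro L_mem nth_mem) auto
  have U_mem: "snd (L ! (j - 1)) u \<in> U" if "j \<in> {1..length L}" "u \<in> letters m" for j u
    using L_nth[OF that(1)] that(2) unfolding lin_maps_def by blast
  have "A X \<in> lin_maps (letters m) U" if X: "X \<in> paths d" for X
  proof -
    have "A X u \<in> U" if "u \<in> letters m" for u
      unfolding *[OF X that] using U_mem[OF _ that]
      by (intro subspace_sum[OF U] subspace_scale[OF U])
    then show ?thesis using lin[OF X] by (auto simp: lin_maps_def)
  qed
  moreover have "1 \<le> length L" by (simp add: L_def)
  ultimately show ?thesis
    unfolding regular_lin_map_def using conjunct1[OF L_nth] conjunct2[OF L_nth] *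
    by (intro conjI exI[of _ "length L"] exI[of _ "\<lambda>j. fst (L ! (j - 1))"] exI[of _ "\<lambda>j. snd (L ! (j - 1))"] ballI)
qed

text \<open>Regularity word by word. Each operation on paths preserves it by a formula for
  coordinates, while compatibility with shuffles is recovered only in
  \<open>regular_family_imp_regular_path_map\<close>.\<close>

definition regular_family :: "nat \<Rightarrow> nat \<Rightarrow> (path \<Rightarrow> path) \<Rightarrow> bool"
  where "regular_family d t Z \<longleftrightarrow> Z \<in> paths d \<rightarrow> paths t \<and>
    (\<forall>w. set w \<subseteq> {1..t} \<longrightarrow> regular_fun d (\<lambda>X. sig (Z X) (word w)))"

lemma regular_family_paths: "regular_family d t Z \<Longrightarrow> X \<in> paths d \<Longrightarrow> Z X \<in> paths t"
  by (auto simp: regular_family_def)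

lemma regular_family_word:
  "regular_family d t Z \<Longrightarrow> set w \<subseteq> {1..t} \<Longrightarrow> regular_fun d (\<lambda>X. sig (Z X) (word w))"
  by (auto simp: regular_family_def)

lemma regular_familyI:
  assumes "\<And>X. X \<in> paths d \<Longrightarrow> Z X \<in> paths t"
    and "\<And>w. set w \<subseteq> {1..t} \<Longrightarrow> regular_fun d (\<lambda>X. sig (Z X) (word w))"
  shows "regular_family d t Z"
  using assms by (auto simp: regular_family_def)

lemma regular_family_cong:
  assumes "regular_family d t Z" "\<And>X. X \<in> paths d \<Longrightarrow> Z' X = Z X"
  shows "regular_family d t Z'"
proof (rule regular_familyI)
  fix w assume "set w \<subseteq> {1..t}"
  from regular_family_word[OF assms(1) this] show "regular_fun d (\<lambda>X. sig (Z' X) (word w))"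
    by (rule regular_map_cong) (simp add: assms(2))
qed (use assms regular_family_paths in auto)

lemma regular_family_sig:
  assumes "regular_family d t Z" "x \<in> T_alg t"
  shows "regular_fun d (\<lambda>X. sig (Z X) x)"
proof -
  have "regular_fun d (\<lambda>X. lin_ext (\<lambda>w. sig (Z X) (word w)) x)"
    by (intro regular_map_lin_ext[OF subspace_UNIV] regular_family_word[OF assms(1)] T_algD[OF assms(2)])
  then show ?thesis by (simp only: linear_eq_lin_ext[OF linear_sig, symmetric])
qed

lemma regular_map_compose:
  assumes "regular_map t U h" "regular_family d t Z" "subspace U"
  shows "regular_map d U (\<lambda>X. h (Z X))"
  using assms(1)
proof (induction rule: regular_map.induct)
  case (zero h)
  then show ?case using regular_family_paths[OF assms(2)] by (intro regular_map.zero) auto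
next
  case (step h x z k)
  from regular_map_add[OF step(5) regular_map_scaleR[OF regular_family_sig[OF assms(2) step(2)]
        regular_map_const[OF step(3)] assms(3)]]
  show ?case by (rule regular_map_cong) (use step(4) regular_family_paths[OF assms(2)] in auto)
qed

lemma regular_lin_map_compose:
  assumes "regular_lin_map t (letters m) U A" "regular_family d t Z" "subspace U"
  shows "regular_lin_map d (letters m) U (\<lambda>X. A (Z X))"
proof (rule regular_lin_mapI)
  fix i assume "i \<in> {1..m}"
  from regular_map_compose[OF regular_lin_mapD(3)[OF assms(1) this] assms(2,3)]
  show "regular_map d U (\<lambda>X. A (Z X) (word [i]))" .
qed (use assms regular_lin_mapD(1)[OF assms(1)] regular_family_paths in auto)

lemma regular_lin_map_mono:
  assumes "regular_lin_map d (letters m) U A" "U \<subseteq> V" "subspace V"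
  shows "regular_lin_map d (letters m) V A"
  by (intro regular_lin_mapI assms(3) regular_lin_mapD(1)[OF assms(1)]
      regular_map_mono[OF regular_lin_mapD(3)[OF assms(1)] assms(2)])

section \<open>Operations that preserve regularity\<close>

lemma regular_map_half_shuffle:
  assumes f: "regular_map d (T_alg n) f" and g: "regular_map d (T_alg n) g"
  shows "regular_map d (T_ge1 n) (\<lambda>X. half_shuffle (f X) (g X))"
proof (rule regular_map_apply[OF subspace_T_ge1 g])
  fix z assume z: "z \<in> T_alg n"
  show "regular_map d (T_ge1 n) (\<lambda>X. half_shuffle (f X) z)"
    by (rule regular_map_linear[OF f linear_half_shuffle_left]) (rule half_shuffle_in_T_ge1[OF _ z])
qed (rule linear_half_shuffle_right)

text \<open>The empty word pulls back to the unit, which lies outside \<open>T_ge1\<close>; hence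
  two claims. The second lets the pullback of a tensor in \<open>T_ge1\<close> serve again as data
  for \<open>Lambda\<close>.\<close>

lemma regular_map_Lambda_word:
  assumes B: "regular_lin_map d (letters m) (T_ge1 n) B" and w: "set w \<subseteq> {1..m}"
  shows "regular_map d (T_alg n) (\<lambda>X. Lambda_word (B X) w)"
    and "w \<noteq> [] \<Longrightarrow> regular_map d (T_ge1 n) (\<lambda>X. Lambda_word (B X) w)"
  using w
proof (induction w)
  case Nil
  { case 1 then show ?case by (simp add: regular_map_const word_in_T_alg) }
  { case 2 then show ?case by simp }
next
  case (Cons i w)
  have *: "regular_map d (T_ge1 n) (\<lambda>X. Lambda_word (B X) (i # w))" if "set (i # w) \<subseteq> {1..m}"
    unfolding Lambda_word.simps using that Cons.IH(1)
      regular_map_mono[OF regular_lin_mapD(3)[OF B, of i] T_ge1_subset_T_alg]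
    by (intro regular_map_half_shuffle) auto
  { case 1 then show ?case using * T_ge1_subset_T_alg by (blast intro: regular_map_mono) }
  { case 2 then show ?case using * by blast }
qed

lemma sig_Lambda:
  assumes X: "X \<in> paths n" and w: "set w \<subseteq> {1..m}" and s: "0 \<le> s" "s \<le> dur X"
  shows "iter_int (Lambda m B X) w s = sig_at X s (Lambda_word B w)"
proof -
  obtain v \<alpha> where c: "controlled_path X v \<alpha>" by (rule paths_controlled[OF X])
  show ?thesis by (rule controlled_path.iter_int_Lambda[OF c s w])
qed

lemma Lambda_in_paths:
  assumes X: "X \<in> paths n" and B: "\<And>i. i \<in> {1..m} \<Longrightarrow> B (word [i]) \<in> T_ge1 n"
  shows "Lambda m B X \<in> paths m"
proof -
  obtain v \<alpha> where c: "controlled_path X v \<alpha>" by (rule paths_controlled[OF X])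
  show ?thesis
    by (rule controlled_path.Lambda_in_paths[OF c pathsD(1)[OF X]]) (rule T_ge1_lookup_Nil[OF B])
qed

lemma regular_family_id: "regular_family d d (\<lambda>X. X)"
  by (rule regular_familyI) (auto intro: regular_fun_sig simp: word_in_T_alg)

lemma regular_family_const: "Y \<in> paths t \<Longrightarrow> regular_family d t (\<lambda>X. Y)"
  by (rule regular_familyI) (auto intro: regular_map_const)

text \<open>The pulled back word varies with \<open>X\<close>, and so does the path whose signature
  is evaluated at it; \<open>regular_map_apply\<close> handles both at once.\<close>

lemma regular_family_Lambda:
  assumes Z: "regular_family d n Z" and B: "regular_lin_map d (letters m) (T_ge1 n) B"
  shows "regular_family d m (\<lambda>X. Lambda m (B X) (Z X))"
proof (rule regular_familyI)
  fix X assume "X \<in> paths d"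
  then show "Lambda m (B X) (Z X) \<in> paths m"
    using regular_family_paths[OF Z] regular_lin_mapD(2)[OF B] by (intro Lambda_in_paths) auto
next
  fix w assume w: "set w \<subseteq> {1..m}"
  have "regular_fun d (\<lambda>X. sig (Z X) (Lambda_word (B X) (rev w)))"
  proof (rule regular_map_apply[OF subspace_UNIV, where L = "\<lambda>X. sig (Z X)" and V = "T_alg n"])
    show "regular_map d (T_alg n) (\<lambda>X. Lambda_word (B X) (rev w))"
      using w by (intro regular_map_Lambda_word(1)[OF B]) simp
    show "regular_fun d (\<lambda>X. sig (Z X) z)" if "z \<in> T_alg n" for z
      by (rule regular_family_sig[OF Z that])
  qed (rule linear_sig)
  then show "regular_fun d (\<lambda>X. sig (Lambda m (B X) (Z X)) (word w))"
  proof (rule regular_map_cong)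
    fix X assume "X \<in> paths d"
    then have "Z X \<in> paths n" by (rule regular_family_paths[OF Z])
    then show "sig (Lambda m (B X) (Z X)) (word w) = sig (Z X) (Lambda_word (B X) (rev w))"
      using sig_Lambda[of "Z X" n "rev w" m "dur (Z X)" "B X"] w pathsD(1)[of "Z X" n]
      by (simp add: sig_eq_sig_at)
  qed
qed

text \<open>\<open>sig_inv\<close> writes a coordinate of the reversed path as a polynomial in
  coordinates of the path, and products of regular functions are regular.\<close>

lemma regular_family_reversal:
  assumes Z: "regular_family d n Z"
  shows "regular_family d n (\<lambda>X. reversal (Z X))"
proof (rule regular_familyI)
  fix X assume "X \<in> paths d"
  then show "reversal (Z X) \<in> paths n" using regular_family_paths[OF Z] reversal_in_paths by blast
next
  fix w assume w: "set w \<subseteq> {1..n}"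
  have "regular_fun d (\<lambda>X. sig_inv (Z X) w)" if "set w \<subseteq> {1..n}" for w
    using that
  proof (induction "length w" arbitrary: w rule: less_induct)
    case less
    show ?case
    proof (cases "w = []")
      case True then show ?thesis by (simp add: sig_inv.simps regular_map_const)
    next
      case False
      have "regular_fun d (\<lambda>X. iter_int (Z X) (take k w) (dur (Z X)) * sig_inv (Z X) (drop k w))"
        if k: "k \<in> {1..length w}" for k
      proof (rule regular_fun_mult)
        show "regular_fun d (\<lambda>X. sig_inv (Z X) (drop k w))"
          using k less set_drop_subset[of k w] by (intro less(1)) auto
        have "set (rev (take k w)) \<subseteq> {1..n}" using less(2) set_take_subset[of k w] by auto
        from regular_family_word[OF Z this]
        show "regular_fun d (\<lambda>X. iter_int (Z X) (take k w) (dur (Z X)))"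
          by (simp add: sig_eq_sig_at)
      qed
      then show ?thesis unfolding sig_inv.simps[of _ w] using False
        by (simp only: if_False) (intro regular_fun_uminus regular_map_sum)
    qed
  qed
  then have "regular_fun d (\<lambda>X. sig_inv (Z X) (rev w))" using w by simp
  then show "regular_fun d (\<lambda>X. sig (reversal (Z X)) (word w))"
    by (rule regular_map_cong) (rule sig_reversal[OF regular_family_paths[OF Z]])
qed

lemma regular_map_chop:
  assumes P: "regular_family d n P" and h: "regular_map d (T_alg n) h"
  shows "regular_map d (T_ge1 n) (\<lambda>X. chop (P X) (h X))"
proof (rule regular_map_apply[OF subspace_T_ge1 h])
  fix z assume z: "z \<in> T_alg n"
  show "regular_map d (T_ge1 n) (\<lambda>X. chop (P X) z)"
    unfolding chop_def
  proof (rule regular_map_lin_ext[OF subspace_T_ge1])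
    fix w assume "w \<in> Poly_Mapping.keys z"
    then have w: "set w \<subseteq> {1..n}" by (rule T_algD[OF z])
    have "word (drop k w) \<in> T_ge1 n" if "k < length w" for k
      using w that set_drop_subset[of k w] by (auto simp: T_ge1_iff)
    moreover have "set (take k w) \<subseteq> {1..n}" for k using w set_take_subset[of k w] by auto
    ultimately show "regular_map d (T_ge1 n) (\<lambda>X. \<Sum>k<length w. sig (P X) (word (take k w)) *\<^sub>R word (drop k w))"
      by (intro regular_map_sum regular_map_scaleR regular_map_const regular_family_word[OF P] subspace_T_ge1) auto
  qed
qed (rule linear_chop)

lemma regular_lin_map_chop:
  assumes P: "regular_family d n P" and B: "regular_lin_map d (letters m) (T_ge1 n) B"
  shows "regular_lin_map d (letters m) (T_ge1 n) (\<lambda>X u. chop (P X) (B X u))"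
proof (rule regular_lin_mapI)
  fix X assume "X \<in> paths d"
  then show "linear (\<lambda>u. chop (P X) (B X u))"
    using linear_compose[OF regular_lin_mapD(1)[OF B] linear_chop] by (simp add: o_def)
next
  fix i assume "i \<in> {1..m}"
  from regular_map_mono[OF regular_lin_mapD(3)[OF B this] T_ge1_subset_T_alg]
  show "regular_map d (T_ge1 n) (\<lambda>X. chop (P X) (B X (word [i])))" by (rule regular_map_chop[OF P])
qed (rule subspace_T_ge1)

text \<open>Chen's identity in the form with \<open>chop\<close>: the second path is evaluated at a
  tensor that depends regularly on \<open>X\<close>.\<close>

lemma regular_family_concat:
  assumes P: "regular_family d n P" and Q: "regular_family d n Q"
  shows "regular_family d n (\<lambda>X. P X \<squnion>\<^sub>p Q X)"
proof (rule regular_familyI)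
  fix X assume "X \<in> paths d"
  then show "P X \<squnion>\<^sub>p Q X \<in> paths n" using regular_family_paths P Q concat_in_paths by blast
next
  fix w assume w: "set w \<subseteq> {1..n}"
  have "regular_map d (T_alg n) (\<lambda>X. chop (P X) (word w))"
    using regular_map_mono[OF regular_map_chop[OF P regular_map_const] T_ge1_subset_T_alg] w
    by (simp add: word_in_T_alg)
  then have "regular_fun d (\<lambda>X. sig (Q X) (chop (P X) (word w)))"
  proof (rule regular_map_apply[OF subspace_UNIV, where L = "\<lambda>X. sig (Q X)" and V = "T_alg n"])
    show "regular_fun d (\<lambda>X. sig (Q X) z)" if "z \<in> T_alg n" for z
      by (rule regular_family_sig[OF Q that])
  qed (rule linear_sig)
  from regular_map_add[OF regular_family_word[OF P w] this]
  have "regular_fun d (\<lambda>X. sig (P X) (word w) + sig (Q X) (chop (P X) (word w)))" .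
  then show "regular_fun d (\<lambda>X. sig (P X \<squnion>\<^sub>p Q X) (word w))"
  proof (rule regular_map_cong)
    fix X assume "X \<in> paths d"
    then have "P X \<in> paths n" "Q X \<in> paths n" using regular_family_paths P Q by auto
    from sig_at_concat_right[OF this, of "dur (Q X)"] pathsD(1)[OF this(2)]
    show "sig (P X \<squnion>\<^sub>p Q X) (word w) = sig (P X) (word w) + sig (Q X) (chop (P X) (word w))"
      by (simp add: sig_eq_sig_at del: sig_at_word)
  qed
qed

text \<open>Coordinates of the inner path over \<open>[0, s]\<close> are coordinates of
  \<open>X\<close> over the same interval, word by word through \<open>Lambda_hom\<close>. A
  reversal in between would destroy this matching of intervals.\<close>

lemma Lambda_Lambda:
  assumes X: "X \<in> paths n" and B': "\<And>j. j \<in> {1..e} \<Longrightarrow> B' (word [j]) \<in> T_alg m"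
  shows "Lambda e B' (Lambda m B X) = Lambda e (\<lambda>u. Lambda_hom B (B' u)) X"
proof (rule path_eqI)
  fix s i
  have "sig_at (Lambda m B X) s (B' (word [i])) = sig_at X s (Lambda_hom B (B' (word [i])))"
    if "0 \<le> s" "s \<le> dur X" "i \<in> {1..e}"
  proof (rule linear_eq_on_keys[OF linear_sig_at linear_compose[OF linear_Lambda_hom linear_sig_at, unfolded o_def]])
    fix w assume "w \<in> Poly_Mapping.keys (B' (word [i]))"
    then have "set (rev w) \<subseteq> {1..m}" using T_algD[OF B'[OF that(3)]] by simp
    from sig_Lambda[OF X this that(1,2)]
    show "sig_at (Lambda m B X) s (word w) = sig_at X s (Lambda_hom B (word w))"
      by (simp add: Lambda_hom_def)
  qed
  then show "pos (Lambda e B' (Lambda m B X)) s i = pos (Lambda e (\<lambda>u. Lambda_hom B (B' u)) X) s i"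
    by (simp add: pos_Lambda)
qed simp

lemma regular_lin_map_Lambda_hom:
  assumes B: "regular_lin_map d (letters m) (T_ge1 n) B" and B': "regular_lin_map d (letters e) (T_ge1 m) B'"
  shows "regular_lin_map d (letters e) (T_ge1 n) (\<lambda>X u. Lambda_hom (B X) (B' X u))"
proof (rule regular_lin_mapI)
  fix X assume "X \<in> paths d"
  then show "linear (\<lambda>u. Lambda_hom (B X) (B' X u))"
    using linear_compose[OF regular_lin_mapD(1)[OF B'] linear_Lambda_hom] by (simp add: o_def)
next
  fix i assume "i \<in> {1..e}"
  from subspace_T_ge1 regular_lin_mapD(3)[OF B' this]
  show "regular_map d (T_ge1 n) (\<lambda>X. Lambda_hom (B X) (B' X (word [i])))"
  proof (rule regular_map_apply)
    fix z assume z: "z \<in> T_ge1 m"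
    show "regular_map d (T_ge1 n) (\<lambda>X. Lambda_hom (B X) z)"
      unfolding Lambda_hom_def
    proof (rule regular_map_lin_ext[OF subspace_T_ge1])
      fix w assume "w \<in> Poly_Mapping.keys z"
      from T_ge1D[OF z this] show "regular_map d (T_ge1 n) (\<lambda>X. Lambda_word (B X) (rev w))"
        by (intro regular_map_Lambda_word(2)[OF B]) auto
    qed
  qed (rule linear_Lambda_hom)
qed (rule subspace_T_ge1)


section \<open>Signatures separate the tensor algebra\<close>

text \<open>Slope 0 is allowed and gives the constant path, whose signature is the empty
  word.\<close>

definition line_path :: "nat \<Rightarrow> real \<Rightarrow> path"
  where "line_path i a = mk_path 1 (\<lambda>s j. if j = i then a * s else 0)"

lemma pos_line_path: "pos (line_path i a) s j = (if 0 \<le> s \<and> s \<le> 1 \<and> j = i then a * s else 0)"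
  and dur_line_path [simp]: "dur (line_path i a) = 1"
  by (simp_all add: line_path_def pos_mk_path)

lemma line_path_in_paths:
  assumes "i \<in> {1..d}"
  shows "line_path i a \<in> paths d"
proof -
  interpret control 1 "\<lambda>s. s" 1 by unfold_locales auto
  show ?thesis
  proof (rule controlled_imp_paths)
    fix j
    have "(\<lambda>s. (if j = i then a else 0) * s) \<in> H"
    proof (rule HI[of _ "\<bar>a\<bar>"])
      fix s t :: real assume "0 \<le> s" "s \<le> t" "t \<le> 1"
      then show "\<bar>(if j = i then a else 0) * t - (if j = i then a else 0) * s\<bar> \<le> \<bar>a\<bar> * (t - s) powr 1"
        by (simp add: abs_mult right_diff_distrib[symmetric])
    qed (auto intro!: continuous_intros)
    then show "(\<lambda>s. pos (line_path i a) s j) \<in> H" by (rule H_cong) (auto simp: pos_line_path)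
  qed (use assms in \<open>auto simp: pos_line_path\<close>)
qed

text \<open>Every letter contributes one factor \<open>a\<close> through the integrator, so
  coordinates are monomials in \<open>a\<close> and can be differentiated by hand.\<close>

lemma iter_int_line_path_scale:
  assumes "i \<in> {1..d}"
  shows "0 \<le> s \<Longrightarrow> s \<le> 1 \<Longrightarrow>
    iter_int (line_path i a) w s = a ^ length w * iter_int (line_path i 1) w s"
proof (induction w arbitrary: s)
  case (Cons j w)
  have "has_RS_integral (\<lambda>r. a ^ length w * iter_int (line_path i 1) w r)
      (\<lambda>r. a * pos (line_path i 1) r j) 0 s
      (a * (a ^ length w * (iter_int (line_path i 1) (j # w) s - iter_int (line_path i 1) (j # w) 0)))"
    using Cons.prems
    by (intro has_RS_integral_cmult_left has_RS_integral_cmult_right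
        has_RS_integral_iter_int[OF line_path_in_paths[OF assms]]) auto
  then have "has_RS_integral (iter_int (line_path i a) w) (\<lambda>r. pos (line_path i a) r j) 0 s
      (a * (a ^ length w * (iter_int (line_path i 1) (j # w) s - iter_int (line_path i 1) (j # w) 0)))"
    using Cons
    by (subst has_RS_integral_cong[where
        f' = "\<lambda>r. a ^ length w * iter_int (line_path i 1) w r" and
        g' = "\<lambda>r. a * pos (line_path i 1) r j"]) (auto simp: pos_line_path)
  from RS_integral_eq[OF this Cons.prems(1)] show ?case
    unfolding iter_int.simps(2)[of "line_path i a"] by (simp add: iter_int_0 del: iter_int.simps(2))
qed simp

text \<open>Transpose of \<open>snoc_letter\<close>; it arises as the derivative when a segment in
  direction \<open>i\<close> is attached at the end of a path.\<close>

definition drop_last_letter :: "nat \<Rightarrow> tensor \<Rightarrow> tensor"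
  where "drop_last_letter i = lin_ext (\<lambda>w. if w \<noteq> [] \<and> last w = i then word (butlast w) else 0)"

lemma lookup_drop_last_letter:
  "Poly_Mapping.lookup (drop_last_letter i z) u = Poly_Mapping.lookup z (u @ [i])"
proof -
  have lin: "linear (\<lambda>z :: tensor. Poly_Mapping.lookup z u)" for u
    by (rule linearI) (auto simp: lookup_add)
  show ?thesis
  proof (rule linear_eq_on_words[of "\<lambda>z. Poly_Mapping.lookup (drop_last_letter i z) u"])
    show "linear (\<lambda>z. Poly_Mapping.lookup (drop_last_letter i z) u)"
      unfolding drop_last_letter_def using linear_compose[OF linear_lin_ext lin] by (simp add: o_def)
    fix w
    show "Poly_Mapping.lookup (drop_last_letter i (word w)) u = Poly_Mapping.lookup (word w) (u @ [i])"
      by (cases w rule: rev_cases) (auto simp: drop_last_letter_def lookup_word)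
  qed (rule lin)
qed

text \<open>Append a segment of length \<open>a\<close> in direction \<open>i\<close> and differentiate at \<open>a = 0\<close>.\<close>

lemma sig_drop_last_letter:
  assumes i: "i \<in> {1..d}" and P: "P \<in> paths d" and zero: "\<And>X. X \<in> paths d \<Longrightarrow> sig X z = 0"
  shows "sig P (drop_last_letter i z) = 0"
proof -
  define c where "c w = iter_int (line_path i 1) (rev w) 1" for w
  have sig_line: "sig_at (line_path i a) 1 (word w) = a ^ length w * c w" for a w
    using iter_int_line_path_scale[OF i, of 1 a "rev w"] by (simp add: c_def)
  define f where "f a w = sig P (word w) + (\<Sum>k<length w. sig P (word (take k w)) * (a ^ length (drop k w) * c (drop k w)))" for a w
  have sig_f: "sig (P \<squnion>\<^sub>p line_path i a) (word w) = f a w" for a w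
    using sig_at_concat_right[OF P line_path_in_paths[OF i, of a], of 1 "word w"]
    by (simp add: sig_eq_sig_at chop_def sig_at_sum sig_at_scaleR f_def sig_line del: sig_at_word)
  \<comment> \<open>The segment moves only in component \<open>i\<close>, so to first order it sees
    exactly the words that end in \<open>i\<close>.\<close>
  have c1: "c [j] = (if j = i then 1 else 0)" for j
    unfolding c_def using iter_int_singleton[OF line_path_in_paths[OF i], of 1 1 j]
    by (simp add: pos_line_path del: iter_int.simps(2))
  have "((\<lambda>a. a ^ n) has_real_derivative (if n = 1 then 1 else 0)) (at 0)" for n
  proof -
    have "((\<lambda>a. a ^ n) has_real_derivative real n * 0 ^ (n - 1)) (at (0::real))"
      by (auto intro!: derivative_eq_intros)
    also have "real n * 0 ^ (n - 1) = (if n = 1 then 1 else 0 :: real)" by (auto simp: power_0_left)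
    finally show ?thesis .
  qed
  note pow = this
  have der: "((\<lambda>a. f a w) has_real_derivative sig P (drop_last_letter i (word w))) (at 0)" for w
  proof -
    have "((\<lambda>a. f a w) has_real_derivative (0 + (\<Sum>k<length w. sig P (word (take k w)) *
        ((if length (drop k w) = 1 then 1 else 0) * c (drop k w))))) (at 0)"
      unfolding f_def
      by (intro DERIV_add DERIV_const DERIV_sum DERIV_cmult DERIV_cmult_right pow)
    also have "0 + (\<Sum>k<length w. sig P (word (take k w)) *
        ((if length (drop k w) = 1 then 1 else 0) * c (drop k w))) = sig P (drop_last_letter i (word w))"
    proof (cases w rule: rev_cases)
      case Nil then show ?thesis by (simp add: drop_last_letter_def linear_0[OF linear_sig])
    next
      case (snoc u j)
      \<comment> \<open>Only the suffix of length 1 has a nonzero derivative at 0; longer suffixes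
        carry higher powers of \<open>a\<close>.\<close>
      have "(\<Sum>k<length w. sig P (word (take k w)) *
        ((if length (drop k w) = 1 then 1 else 0) * c (drop k w))) =
        (\<Sum>k\<in>{length u}. sig P (word (take k w)) *
        ((if length (drop k w) = 1 then 1 else 0) * c (drop k w)))"
        by (rule sum.mono_neutral_right) (auto simp: snoc)
      then show ?thesis by (simp add: snoc drop_last_letter_def c1 linear_0[OF linear_sig])
    qed
    finally show ?thesis .
  qed
  have "((\<lambda>a. \<Sum>w\<in>Poly_Mapping.keys z. Poly_Mapping.lookup z w * f a w) has_real_derivative
      (\<Sum>w\<in>Poly_Mapping.keys z. Poly_Mapping.lookup z w * sig P (drop_last_letter i (word w)))) (at 0)"
    by (intro DERIV_sum DERIV_cmult der)
  also have "(\<lambda>a. \<Sum>w\<in>Poly_Mapping.keys z. Poly_Mapping.lookup z w * f a w) = (\<lambda>a. 0)"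
  proof
    fix a
    have "(\<Sum>w\<in>Poly_Mapping.keys z. Poly_Mapping.lookup z w * f a w) = sig (P \<squnion>\<^sub>p line_path i a) z"
      using linear_eq_lin_ext[OF linear_sig, of "P \<squnion>\<^sub>p line_path i a" z] by (simp add: lin_ext_def sig_f)
    then show "(\<Sum>w\<in>Poly_Mapping.keys z. Poly_Mapping.lookup z w * f a w) = 0"
      using zero concat_in_paths[OF P line_path_in_paths[OF i]] by simp
  qed
  finally have "(\<Sum>w\<in>Poly_Mapping.keys z. Poly_Mapping.lookup z w * sig P (drop_last_letter i (word w))) = 0"
    by (rule DERIV_unique) (rule DERIV_const)
  moreover have "linear (\<lambda>z. sig P (drop_last_letter i z))"
    unfolding drop_last_letter_def using linear_compose[OF linear_lin_ext linear_sig] by (simp add: o_def)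
  from linear_eq_lin_ext[OF this, of z] have "sig P (drop_last_letter i z) =
      (\<Sum>w\<in>Poly_Mapping.keys z. Poly_Mapping.lookup z w * sig P (drop_last_letter i (word w)))"
    by (simp add: lin_ext_def)
  ultimately show ?thesis by simp
qed

text \<open>The coefficient of \<open>z\<close> at \<open>w @ [i]\<close> is that of
  \<open>drop_last_letter i z\<close> at \<open>w\<close>, a tensor that again pairs to 0 with all
  signatures. Induction reduces to the empty word, whose coefficient is read off a constant
  path.\<close>

lemma sig_separates:
  assumes d: "d \<ge> 1" and z: "z \<in> T_alg d" and zero: "\<And>X. X \<in> paths d \<Longrightarrow> sig X z = 0"
  shows "z = 0"
proof -
  have "Poly_Mapping.lookup z w = 0" if "set w \<subseteq> {1..d}" "\<And>X. X \<in> paths d \<Longrightarrow> sig X z = 0" for w z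
    using that
  proof (induction w arbitrary: z rule: rev_induct)
    case Nil
    have 1: "(1::nat) \<in> {1..d}" using d by simp
    have "sig (line_path 1 0) (word w) = Poly_Mapping.lookup (word w) []" for w
      using iter_int_line_path_scale[OF 1, of 1 0 "rev w"]
      by (cases "w = []") (auto simp: sig_eq_sig_at lookup_word)
    then have "sig (line_path 1 0) z = Poly_Mapping.lookup z []"
      by (rule linear_eq_on_words[OF linear_sig, rotated]) (auto intro!: linearI simp: lookup_add)
    then show ?case using Nil line_path_in_paths[OF 1] by simp
  next
    case (snoc i w)
    then have i: "i \<in> {1..d}" by simp
    have "Poly_Mapping.lookup (drop_last_letter i z) w = 0"
      using snoc.prems by (intro snoc.IH sig_drop_last_letter[OF i]) auto
    then show ?case by (simp add: lookup_drop_last_letter)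
  qed
  then have "Poly_Mapping.lookup z w = 0" for w
    using zero z by (cases "set w \<subseteq> {1..d}") (auto simp: T_alg_iff in_keys_iff)
  then show ?thesis by (intro poly_mapping_eqI) simp
qed

text \<open>The pullback of a word is unique by separation, so that the pullback is a shuffle
  homomorphism because signatures are multiplicative.\<close>

lemma regular_family_imp_regular_path_map:
  assumes d: "d \<ge> 1" and Z: "regular_family d t Z"
  shows "regular_path_map d t Z"
proof -
  have "\<exists>x\<in>T_alg d. \<forall>X\<in>paths d. sig (Z X) (word w) = sig X x" if w: "set w \<subseteq> {1..t}" for w
  proof -
    obtain x where "x \<in> T_alg d" "\<And>X. X \<in> paths d \<Longrightarrow> sig (Z X) (word w) = sig X x"
      by (rule regular_fun_single[OF regular_family_word[OF Z w]]) blast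
    then show ?thesis by blast
  qed
  then have "\<forall>w\<in>{w. set w \<subseteq> {1..t}}. \<exists>x. x \<in> T_alg d \<and> (\<forall>X\<in>paths d. sig (Z X) (word w) = sig X x)"
    by blast
  from bchoice[OF this] obtain h where
    "\<forall>w\<in>{w. set w \<subseteq> {1..t}}. h w \<in> T_alg d \<and> (\<forall>X\<in>paths d. sig (Z X) (word w) = sig X (h w))" ..
  then have h: "\<And>w. set w \<subseteq> {1..t} \<Longrightarrow> h w \<in> T_alg d"
    "\<And>w X. set w \<subseteq> {1..t} \<Longrightarrow> X \<in> paths d \<Longrightarrow> sig (Z X) (word w) = sig X (h w)"
    by auto
  define H where "H = lin_ext h"
  have lin: "linear H" unfolding H_def by (rule linear_lin_ext)
  have mem: "H x \<in> T_alg d" if "x \<in> T_alg t" for x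
    unfolding H_def by (intro lin_ext_in_subspace[OF subspace_T_alg] h(1) T_algD[OF that])
  have sig: "sig (Z X) x = sig X (H x)" if x: "x \<in> T_alg t" and X: "X \<in> paths d" for x X
    by (rule linear_eq_on_keys[OF linear_sig linear_compose[OF lin linear_sig, unfolded o_def]])
      (use T_algD[OF x] h(2)[OF _ X] in \<open>simp add: H_def\<close>)
  have eq: "x = y" if "x \<in> T_alg d" "y \<in> T_alg d" "\<And>X. X \<in> paths d \<Longrightarrow> sig X x = sig X y" for x y
    using sig_separates[OF d subspace_diff[OF subspace_T_alg that(1,2)]] that(3)
    by (simp add: linear_diff[OF linear_sig])
  have "H (word []) = word []"
    using mem[of "word []"] sig[of "word []"] by (intro eq) (auto simp: word_in_T_alg)
  moreover have "H (shuffle x y) = shuffle (H x) (H y)" if "x \<in> T_alg t" "y \<in> T_alg t" for x y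
  proof (rule eq)
    fix X assume X: "X \<in> paths d"
    then show "sig X (H (shuffle x y)) = sig X (shuffle (H x) (H y))"
      using that sig[OF _ X] regular_family_paths[OF Z X]
      by (simp add: sig_shuffle sig[OF _ X, symmetric] shuffle_in_T_alg)
  qed (use that mem shuffle_in_T_alg in auto)
  ultimately have "shuffle_hom t d H"
    using lin mem by (auto simp: shuffle_hom_def lin_maps_def)
  then show ?thesis using sig Z unfolding regular_path_map_def regular_family_def by blast
qed


section \<open>The classes Upsilon and Gamma\<close>

lemma Lambda_cong: "(\<And>i. i \<in> {1..m} \<Longrightarrow> B (word [i]) = B' (word [i])) \<Longrightarrow> Lambda m B X = Lambda m B' X"
  by (rule path_eqI) (auto simp: pos_Lambda)

lemma half_shuffle_unit:
  assumes "y \<in> T_ge1 n"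
  shows "half_shuffle (word []) y = y"
proof (rule linear_eq_on_keys[OF linear_half_shuffle_right linear_ident])
  fix w assume "w \<in> Poly_Mapping.keys y"
  then have "w \<noteq> []" using T_ge1D[OF assms] by blast
  then show "half_shuffle (word []) (word w) = word w" by (cases w rule: rev_cases) auto
qed

text \<open>A letter of the inner path is the component itself, so on letters the pullback is
  \<open>E\<close> and the two linear maps simply compose.\<close>

lemma Lambda_Lambda_letters:
  assumes X: "X \<in> paths n" and lin: "linear E"
    and E: "\<And>i. i \<in> {1..m} \<Longrightarrow> E (word [i]) \<in> T_ge1 n"
    and C: "\<And>i. i \<in> {1..t} \<Longrightarrow> C (word [i]) \<in> letters m"
  shows "Lambda t C (Lambda m E X) = Lambda t (\<lambda>u. E (C u)) X"
proof -
  have "Lambda_hom E y = E y" if "y \<in> letters m" for y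
  proof (rule linear_eq_on_keys[OF linear_Lambda_hom lin])
    fix w assume "w \<in> Poly_Mapping.keys y"
    then obtain i where "i \<in> {1..m}" "w = [i]" using \<open>y \<in> letters m\<close> unfolding letters_iff by blast
    then show "Lambda_hom E (word w) = E (word w)"
      using half_shuffle_unit[OF E] by (simp add: Lambda_hom_def)
  qed
  then have "Lambda t (\<lambda>u. Lambda_hom E (C u)) X = Lambda t (\<lambda>u. E (C u)) X"
    using C by (intro Lambda_cong) simp
  moreover have "Lambda t C (Lambda m E X) = Lambda t (\<lambda>u. Lambda_hom E (C u)) X"
    using C letters_subset_T_ge1 T_ge1_subset_T_alg by (intro Lambda_Lambda[OF X, where m = m]) blast
  ultimately show ?thesis by simp
qed

text \<open>A concrete representative of the linear map given on letters, extended by 0 to all other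
  words.\<close>

definition letter_map :: "(nat \<Rightarrow> tensor) \<Rightarrow> tensor \<Rightarrow> tensor"
  where "letter_map f = lin_ext (\<lambda>w. if length w = 1 then f (hd w) else 0)"

lemma linear_letter_map: "linear (letter_map f)"
  unfolding letter_map_def by (rule linear_lin_ext)

lemma letter_map_word [simp]: "letter_map f (word [i]) = f i"
  by (simp add: letter_map_def)

lemma linear_eq_on_letters:
  assumes "linear f" "linear g" "x \<in> letters n" "\<And>i. i \<in> {1..n} \<Longrightarrow> f (word [i]) = g (word [i])"
  shows "f x = g x"
  by (rule linear_eq_on_keys[OF assms(1,2)]) (use assms(3,4) in \<open>auto simp: letters_iff\<close>)

lemma word_in_letters: "word [i] \<in> letters n \<longleftrightarrow> i \<in> {1..n}"
  by (auto simp: letters_iff)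

text \<open>The blocks of a concatenation in \<open>\<Gamma>\<close> that come from a fixed path.\<close>

definition fixed_block :: "nat \<Rightarrow> nat \<Rightarrow> (path \<Rightarrow> path) \<Rightarrow> bool"
  where "fixed_block d t D \<longleftrightarrow> (\<exists>n Y A. n \<ge> 1 \<and> Y \<in> paths n \<and>
    regular_lin_map d (letters t) (letters n) A \<and> (\<forall>X\<in>paths d. D X = Lambda t (A X) Y))"

lemma fixed_blockI:
  assumes "n \<ge> 1" "Y \<in> paths n" "regular_lin_map d (letters t) (letters n) A"
    "\<And>X. X \<in> paths d \<Longrightarrow> D X = Lambda t (A X) Y"
  shows "fixed_block d t D"
  using assms unfolding fixed_block_def by blast

lemma fixed_blockE:
  assumes "fixed_block d t D"
  obtains n Y A where "n \<ge> 1" "Y \<in> paths n" "regular_lin_map d (letters t) (letters n) A"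
    "\<And>X. X \<in> paths d \<Longrightarrow> D X = Lambda t (A X) Y"
  using assms unfolding fixed_block_def by blast

lemma fixed_block_cong:
  assumes "fixed_block d t D" "\<And>X. X \<in> paths d \<Longrightarrow> D' X = D X"
  shows "fixed_block d t D'"
  using assms by (elim fixed_blockE, intro fixed_blockI) auto

lemma fixed_block_family:
  assumes "fixed_block d t D"
  shows "regular_family d t D"
proof -
  obtain n Y A where D: "n \<ge> 1" "Y \<in> paths n" "regular_lin_map d (letters t) (letters n) A"
    "\<And>X. X \<in> paths d \<Longrightarrow> D X = Lambda t (A X) Y"
    by (rule fixed_blockE[OF assms]) blast
  from regular_family_Lambda[OF regular_family_const[OF D(2)]
      regular_lin_map_mono[OF D(3) letters_subset_T_ge1 subspace_T_ge1]]
  show ?thesis by (rule regular_family_cong) (rule D(4))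
qed

lemma fixed_block_reversal:
  assumes "fixed_block d t D"
  shows "fixed_block d t (\<lambda>X. reversal (D X))"
proof -
  obtain n Y A where D: "n \<ge> 1" "Y \<in> paths n" "regular_lin_map d (letters t) (letters n) A"
    "\<And>X. X \<in> paths d \<Longrightarrow> D X = Lambda t (A X) Y"
    by (rule fixed_blockE[OF assms]) blast
  show ?thesis
  proof (rule fixed_blockI[OF D(1) reversal_in_paths[OF D(2)] D(3)])
    fix X assume X: "X \<in> paths d"
    show "reversal (D X) = Lambda t (A X) (reversal Y)"
      unfolding D(4)[OF X] by (rule reversal_Lambda_letters[OF D(2)]) (rule regular_lin_mapD(2)[OF D(3) X])
  qed
qed

text \<open>Two adjacent blocks are merged by letting the two fixed paths run one after the other in
  complementary coordinates.\<close>

lemma fixed_block_concat: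
  assumes "fixed_block d t D" "fixed_block d t D'"
  shows "fixed_block d t (\<lambda>X. D X \<squnion>\<^sub>p D' X)"
proof -
  obtain n Y A where D: "n \<ge> 1" "Y \<in> paths n" "regular_lin_map d (letters t) (letters n) A"
    "\<And>X. X \<in> paths d \<Longrightarrow> D X = Lambda t (A X) Y"
    by (rule fixed_blockE[OF assms(1)]) blast
  obtain n' Y' A' where D': "n' \<ge> 1" "Y' \<in> paths n'" "regular_lin_map d (letters t) (letters n') A'"
    "\<And>X. X \<in> paths d \<Longrightarrow> D' X = Lambda t (A' X) Y'"
    by (rule fixed_blockE[OF assms(2)]) blast
  define N where "N = n + n'"
  \<comment> \<open>\<open>E\<close> and \<open>E'\<close> read the first and the second group of
    the combined letters and kill the other one; \<open>S\<close> embeds the second group.\<close>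
  define E where "E = letter_map (\<lambda>i. if i \<le> n then word [i] else 0)"
  define E' where "E' = letter_map (\<lambda>i. if i \<le> n then 0 else word [i - n])"
  define S where "S = letter_map (\<lambda>i. word [i + n])"
  have lin: "linear E" "linear E'" "linear S" unfolding E_def E'_def S_def by (rule linear_letter_map)+
  have E: "E (word [i]) \<in> T_ge1 n" if "i \<in> {1..N}" for i
    using that by (auto simp: E_def T_ge1_iff)
  have E': "E' (word [i]) \<in> T_ge1 n'" if "i \<in> {1..N}" for i
    using that by (auto simp: E'_def T_ge1_iff N_def)
  have S: "S y \<in> letters N" if "y \<in> letters n'" for y
    by (rule linear_image_letters[OF lin(3) subspace_letters _ that]) (auto simp: S_def word_in_letters N_def)
  have sub: "letters n \<subseteq> letters N" by (force simp: letters_iff N_def)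
  have id1: "E y = y" if "y \<in> letters n" for y
    by (rule linear_eq_on_letters[OF lin(1) linear_ident that]) (simp add: E_def)
  have id2: "E' (S y) = y" if "y \<in> letters n'" for y
    by (rule linear_eq_on_letters[OF linear_compose[OF lin(3,2), unfolded o_def] linear_ident that])
      (auto simp: E'_def S_def)
  have z1: "E (S y) = 0" if "y \<in> letters n'" for y
    by (rule linear_eq_on_letters[OF linear_compose[OF lin(3,1), unfolded o_def] linear_zero_fun that])
      (auto simp: E_def S_def)
  have z2: "E' y = 0" if "y \<in> letters n" for y
    by (rule linear_eq_on_letters[OF lin(2) linear_zero_fun that]) (simp add: E'_def)
  \<comment> \<open>\<open>P\<close> moves in the first \<open>n\<close> coordinates only,
    \<open>P'\<close> in the remaining ones only.\<close>
  define P where "P = Lambda N E Y"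
  define P' where "P' = Lambda N E' Y'"
  have P: "P \<in> paths N" "P' \<in> paths N"
    unfolding P_def P'_def
    by (rule Lambda_in_paths[OF D(2)], erule E, rule Lambda_in_paths[OF D'(2)], erule E')
  define C where "C X u = A X u + S (A' X u)" for X u
  have C: "C X (word [i]) \<in> letters N" if "X \<in> paths d" "i \<in> {1..t}" for X i
    unfolding C_def using regular_lin_mapD(2)[OF D(3) that] regular_lin_mapD(2)[OF D'(3) that] sub S
    by (intro subspace_add[OF subspace_letters]) auto
  show ?thesis
  proof (rule fixed_blockI[OF _ concat_in_paths[OF P]])
    show "1 \<le> N" using D(1) by (simp add: N_def)
    show "regular_lin_map d (letters t) (letters N) C"
    proof (rule regular_lin_mapI)
      fix X assume X: "X \<in> paths d"
      show "linear (C X)" unfolding C_def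
        using linear_compose_add[OF regular_lin_mapD(1)[OF D(3) X]
            linear_compose[OF regular_lin_mapD(1)[OF D'(3) X] lin(3)]] by (simp add: o_def)
    next
      fix i assume i: "i \<in> {1..t}"
      show "regular_map d (letters N) (\<lambda>X. C X (word [i]))" unfolding C_def
        by (rule regular_map_add[OF regular_map_mono[OF regular_lin_mapD(3)[OF D(3) i] sub]
              regular_map_linear[OF regular_lin_mapD(3)[OF D'(3) i] lin(3)]]) (rule S)
    qed (rule subspace_letters)
    fix X assume X: "X \<in> paths d"
    \<comment> \<open>A letter has only the empty proper prefix, on which every signature is 1; so
      linear blocks keep no trace of the preceding path.\<close>
    have chop: "chop P y = y" if "y \<in> letters N" for y
      by (rule linear_eq_on_letters[OF linear_chop linear_ident that]) (simp add: chop_def)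
    have "Lambda t (C X) (P \<squnion>\<^sub>p P') = Lambda t (C X) P \<squnion>\<^sub>p Lambda t (\<lambda>u. chop P (C X u)) P'"
      using C[OF X] letters_subset_T_ge1 T_ge1_subset_T_alg by (intro Lambda_concat[OF P]) blast
    also have "Lambda t (\<lambda>u. chop P (C X u)) P' = Lambda t (C X) P'"
      by (rule Lambda_cong) (rule chop[OF C[OF X]])
    also have "Lambda t (C X) P' = Lambda t (\<lambda>u. E' (C X u)) Y'"
      unfolding P'_def by (rule Lambda_Lambda_letters[OF D'(2) lin(2)], erule E', erule C[OF X])
    also have "\<dots> = D' X" unfolding D'(4)[OF X]
    proof (rule Lambda_cong)
      fix i assume i: "i \<in> {1..t}"
      show "E' (C X (word [i])) = A' X (word [i])"
        using regular_lin_mapD(2)[OF D(3) X i] regular_lin_mapD(2)[OF D'(3) X i]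
        by (simp add: C_def linear_add[OF lin(2)] z2 id2)
    qed
    also have "Lambda t (C X) P = Lambda t (\<lambda>u. E (C X u)) Y"
      unfolding P_def by (rule Lambda_Lambda_letters[OF D(2) lin(1)], erule E, erule C[OF X])
    also have "\<dots> = D X" unfolding D(4)[OF X]
    proof (rule Lambda_cong)
      fix i assume i: "i \<in> {1..t}"
      show "E (C X (word [i])) = A X (word [i])"
        using regular_lin_mapD(2)[OF D(3) X i] regular_lin_mapD(2)[OF D'(3) X i]
        by (simp add: C_def linear_add[OF lin(1)] z1 id1)
    qed
    finally show "D X \<squnion>\<^sub>p D' X = Lambda t (C X) (P \<squnion>\<^sub>p P')" ..
  qed
qed

text \<open>The finitely many signature coordinates of the fixed path that occur are made the components
  of a new fixed path; a pair \<open>(j, i)\<close> with \<open>1 \<le> j \<le> r\<close>, \<open>1 \<le> i \<le> e\<close> has index \<open>(j - 1) e + i\<close>.\<close>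

lemma fixed_block_Lambda_const:
  assumes Y: "Y \<in> paths n" and K: "regular_lin_map d (letters e) (T_ge1 n) K" and e: "e \<ge> 1"
  shows "fixed_block d e (\<lambda>X. Lambda e (K X) Y)"
proof -
  define P where "P r x v \<longleftrightarrow> r \<ge> 1 \<and> (\<forall>j\<in>{1..r}. x j \<in> T_alg d \<and> v j \<in> lin_maps (letters e) (T_ge1 n)) \<and>
      (\<forall>X\<in>paths d. \<forall>u\<in>letters e. K X u = (\<Sum>j=1..r. sig X (x j) *\<^sub>R v j u))" for r :: nat and x v
  have "\<exists>r x v. P r x v" using K unfolding regular_lin_map_def P_def by (elim conjE)
  then obtain r x v where "P r x v" by blast
  then have r: "r \<ge> 1" "\<And>j. j \<in> {1..r} \<Longrightarrow> x j \<in> T_alg d"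
    "\<And>j. j \<in> {1..r} \<Longrightarrow> v j \<in> lin_maps (letters e) (T_ge1 n)"
    "\<And>X u. X \<in> paths d \<Longrightarrow> u \<in> letters e \<Longrightarrow> K X u = (\<Sum>j=1..r. sig X (x j) *\<^sub>R v j u)"
    unfolding P_def by auto
  \<comment> \<open>\<open>V\<close> decodes the index and puts the coordinate
    \<open>v j (word [i])\<close> of \<open>Y\<close> at position \<open>(j, i)\<close>. The
    coefficients \<open>sig X (x j)\<close> move into \<open>A X\<close>, so that \<open>V\<close>
    after \<open>A X\<close> is \<open>K X\<close> on letters.\<close>
  define V where "V = letter_map (\<lambda>c. v ((c - 1) div e + 1) (word [(c - 1) mod e + 1]))"
  define A where "A X = letter_map (\<lambda>i. \<Sum>j=1..r. sig X (x j) *\<^sub>R word [(j - 1) * e + i])" for X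
  have idx: "(c - 1) div e + 1 \<in> {1..r}" "(c - 1) mod e + 1 \<in> {1..e}" if "c \<in> {1..r * e}" for c
  proof -
    have "c - 1 < r * e" using that by auto
    then have "(c - 1) div e < r" by (simp add: less_mult_imp_div_less)
    then show "(c - 1) div e + 1 \<in> {1..r}" by simp
    show "(c - 1) mod e + 1 \<in> {1..e}" using e by (simp add: Suc_le_eq)
  qed
  have code: "(j - 1) * e + i \<in> {1..r * e}" "((j - 1) * e + i - 1) div e + 1 = j"
    "((j - 1) * e + i - 1) mod e + 1 = i" if jr: "j \<in> {1..r}" and ie: "i \<in> {1..e}" for i j
  proof -
    obtain j' where j: "j = Suc j'" using jr by (cases j) auto
    obtain i' where i: "i = Suc i'" "i' < e" using ie by (cases i) auto
    show "((j - 1) * e + i - 1) div e + 1 = j" "((j - 1) * e + i - 1) mod e + 1 = i"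
      using i by (simp_all add: j)
    have "j' * e + e \<le> r * e" using jr mult_le_mono1[of "Suc j'" r e] by (simp add: j)
    then show "(j - 1) * e + i \<in> {1..r * e}" using i by (simp add: j)
  qed
  have V: "V (word [c]) \<in> T_ge1 n" if "c \<in> {1..r * e}" for c
    using r(3)[OF idx(1)[OF that]] idx(2)[OF that] unfolding V_def lin_maps_def
    by (auto simp: word_in_letters)
  have VY: "Lambda (r * e) V Y \<in> paths (r * e)" by (rule Lambda_in_paths[OF Y]) (rule V)
  have A: "A X (word [i]) \<in> letters (r * e)" if "i \<in> {1..e}" for X i
    unfolding A_def letter_map_word
    by (intro subspace_sum[OF subspace_letters] subspace_scale[OF subspace_letters] word_in_letters[THEN iffD2] code(1)[OF _ that])
  show ?thesis
  proof (rule fixed_blockI[OF _ VY])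
    show "1 \<le> r * e" using r(1) e by simp
    show "regular_lin_map d (letters e) (letters (r * e)) A"
    proof (rule regular_lin_mapI)
      show "linear (A X)" for X unfolding A_def by (rule linear_letter_map)
      fix i assume i: "i \<in> {1..e}"
      show "regular_map d (letters (r * e)) (\<lambda>X. A X (word [i]))"
        unfolding A_def letter_map_word
        by (intro regular_map_sum regular_map_monom r(2) word_in_letters[THEN iffD2] code(1)[OF _ i])
    qed (rule subspace_letters)
    fix X assume X: "X \<in> paths d"
    have linV: "linear V" unfolding V_def by (rule linear_letter_map)
    have "Lambda e (A X) (Lambda (r * e) V Y) = Lambda e (\<lambda>u. V (A X u)) Y"
      by (rule Lambda_Lambda_letters[OF Y linV], erule V, erule A)
    also have "\<dots> = Lambda e (K X) Y"
    proof (rule Lambda_cong)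
      fix i assume i: "i \<in> {1..e}"
      have "V (A X (word [i])) = (\<Sum>j=1..r. sig X (x j) *\<^sub>R V (word [(j - 1) * e + i]))"
        unfolding A_def letter_map_word by (simp only: linear_sum[OF linV] linear_scale[OF linV])
      also have "\<dots> = (\<Sum>j=1..r. sig X (x j) *\<^sub>R v j (word [i]))"
        by (rule sum.cong) (use code[OF _ i] in \<open>auto simp: V_def\<close>)
      also have "\<dots> = K X (word [i])" using i by (intro r(4)[OF X, symmetric]) (simp add: word_in_letters)
      finally show "V (A X (word [i])) = K X (word [i])" .
    qed
    finally show "Lambda e (K X) Y = Lambda e (A X) (Lambda (r * e) V Y)" ..
  qed
qed

text \<open>The two \<Lambda> combine to one that acts on the fixed path through longer words, and
  \<open>fixed_block_Lambda_const\<close> brings it back to letters.\<close>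

lemma fixed_block_Lambda:
  assumes D: "fixed_block d m D" and B: "regular_lin_map d (letters e) (T_ge1 m) B" and e: "e \<ge> 1"
  shows "fixed_block d e (\<lambda>X. Lambda e (B X) (D X))"
proof -
  obtain n Y A where D: "n \<ge> 1" "Y \<in> paths n" "regular_lin_map d (letters m) (letters n) A"
    "\<And>X. X \<in> paths d \<Longrightarrow> D X = Lambda m (A X) Y"
    by (rule fixed_blockE[OF D]) blast
  note A = regular_lin_map_mono[OF D(3) letters_subset_T_ge1 subspace_T_ge1]
  from fixed_block_Lambda_const[OF D(2) regular_lin_map_Lambda_hom[OF A B] e]
  show ?thesis
  proof (rule fixed_block_cong)
    fix X assume X: "X \<in> paths d"
    show "Lambda e (B X) (D X) = Lambda e (\<lambda>u. Lambda_hom (A X) (B X u)) Y"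
      unfolding D(4)[OF X]
      using regular_lin_mapD(2)[OF B X] T_ge1_subset_T_alg by (intro Lambda_Lambda[OF D(2)]) blast
  qed
qed


section \<open>Chains of \<Lambda> and reversals\<close>

definition Upsilon_form ::
    "nat \<Rightarrow> nat \<Rightarrow> (path \<Rightarrow> path) \<Rightarrow> nat \<Rightarrow> (nat \<Rightarrow> nat) \<Rightarrow> (nat \<Rightarrow> path \<Rightarrow> tensor \<Rightarrow> tensor) \<Rightarrow> nat \<Rightarrow> nat \<Rightarrow> bool"
  where "Upsilon_form d t \<Psi> k n B s0 s1 \<longleftrightarrow>
      s0 \<in> {0, 1} \<and> s1 \<in> {0, 1} \<and>
      (\<forall>i\<in>{1..k+1}. n i \<ge> 1) \<and> n 1 = d \<and> n (k + 1) = t \<and>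
      (\<forall>i\<in>{1..k}. regular_lin_map d (letters (n (i + 1))) (T_ge1 (n i)) (B i)) \<and>
      (\<forall>X\<in>paths d. \<Psi> X =
         (reversal ^^ s1) (Lambda_chain n (\<lambda>i. B i X) ((reversal ^^ s0) X) k))"

lemma Upsilon_maps_iff:
  "\<Psi> \<in> Upsilon_maps d t \<longleftrightarrow>
    \<Psi> \<in> paths d \<rightarrow> paths t \<and> (\<exists>k n B s0 s1. Upsilon_form d t \<Psi> k n B s0 s1)"
  unfolding Upsilon_maps_def Upsilon_form_def by simp

lemma Upsilon_formD:
  assumes "Upsilon_form d t \<Psi> k n B s0 s1"
  shows "s0 = 0 \<or> s0 = 1" "s1 = 0 \<or> s1 = 1" "i \<in> {1..k+1} \<Longrightarrow> n i \<ge> 1" "n 1 = d" "n (k + 1) = t"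
    "i \<in> {1..k} \<Longrightarrow> regular_lin_map d (letters (n (i + 1))) (T_ge1 (n i)) (B i)"
    "X \<in> paths d \<Longrightarrow> \<Psi> X = (reversal ^^ s1) (Lambda_chain n (\<lambda>i. B i X) ((reversal ^^ s0) X) k)"
  using assms unfolding Upsilon_form_def by auto

text \<open>The last \<open>\<Lambda>\<close> of a chain acts on this path.\<close>

definition chain_arg :: "(nat \<Rightarrow> nat) \<Rightarrow> (nat \<Rightarrow> tensor \<Rightarrow> tensor) \<Rightarrow> path \<Rightarrow> nat \<Rightarrow> path"
  where "chain_arg n B Z j = (if j = 0 then Z else reversal (Lambda_chain n B Z j))"

text \<open>\<open>chain_arg\<close> absorbs the missing reversal before the first \<Lambda>, so one
  recursion covers both cases.\<close>

lemma Lambda_chain_Suc: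
  "Lambda_chain n B Z (Suc j) = Lambda (n (j + 2)) (B (j + 1)) (chain_arg n B Z j)"
  by (cases j) (auto simp: chain_arg_def numeral_2_eq_2 numeral_3_eq_3)

lemma Lambda_chain_cong:
  "(\<And>i. i \<in> {1..k} \<Longrightarrow> B i = B' i) \<Longrightarrow> (\<And>i. i \<in> {1..k+1} \<Longrightarrow> n i = n' i) \<Longrightarrow>
    Lambda_chain n B Z k = Lambda_chain n' B' Z k"
proof (induction k)
  case (Suc j)
  then have "Lambda_chain n B Z j = Lambda_chain n' B' Z j" by simp
  then show ?case using Suc.prems(1)[of "j + 1"] Suc.prems(2)[of "j + 2"]
    by (simp add: Lambda_chain_Suc chain_arg_def)
qed simp

text \<open>The second conclusion, about the argument of the last \<Lambda>, serves where that
  \<Lambda> is merged with a further one.\<close>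

lemma Lambda_chain_induct:
  assumes form: "Upsilon_form d t \<Psi> k n B s0 s1" and j: "j \<le> k"
    and id: "P d (\<lambda>X. X)"
    and rev: "\<And>m Z. P m Z \<Longrightarrow> P m (\<lambda>X. reversal (Z X))"
    and Lam: "\<And>m e Z B. P m Z \<Longrightarrow> e \<ge> 1 \<Longrightarrow> regular_lin_map d (letters e) (T_ge1 m) B \<Longrightarrow>
        P e (\<lambda>X. Lambda e (B X) (Z X))"
  shows "P (n (j + 1)) (\<lambda>X. Lambda_chain n (\<lambda>i. B i X) ((reversal ^^ s0) X) j)"
    and "P (n (j + 1)) (\<lambda>X. chain_arg n (\<lambda>i. B i X) ((reversal ^^ s0) X) j)"
proof -
  have 0: "P d (\<lambda>X. (reversal ^^ s0) X)"
    using Upsilon_formD(1)[OF form] id rev[OF id] by auto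
  have *: "P (n (j + 1)) (\<lambda>X. Lambda_chain n (\<lambda>i. B i X) ((reversal ^^ s0) X) j)" if "j \<le> k" for j
    using that
  proof (induction j)
    case 0
    then show ?case using \<open>P d (\<lambda>X. (reversal ^^ s0) X)\<close> Upsilon_formD(4)[OF form] by simp
  next
    case (Suc j)
    then have "P (n (j + 1)) (\<lambda>X. chain_arg n (\<lambda>i. B i X) ((reversal ^^ s0) X) j)"
      using rev 0 Upsilon_formD(4)[OF form] by (cases "j = 0") (auto simp: chain_arg_def)
    from Lam[OF this, of "n (j + 2)" "B (j + 1)"]
    show ?case using Suc.prems Upsilon_formD(3)[OF form, of "j + 2"] Upsilon_formD(6)[OF form, of "j + 1"]
      by (simp add: Lambda_chain_Suc)
  qed
  show "P (n (j + 1)) (\<lambda>X. Lambda_chain n (\<lambda>i. B i X) ((reversal ^^ s0) X) j)" using * j .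
  then show "P (n (j + 1)) (\<lambda>X. chain_arg n (\<lambda>i. B i X) ((reversal ^^ s0) X) j)"
    using rev 0 Upsilon_formD(4)[OF form] by (cases "j = 0") (auto simp: chain_arg_def)
qed

text \<open>Reduces statements about \<Upsilon> to identity, reversal and \<Lambda>; the condition
  \<open>cong\<close> enters because the form of a member is prescribed only on
  \<open>paths d\<close>.\<close>

lemma Upsilon_maps_induct:
  assumes "\<Psi> \<in> Upsilon_maps d t"
    and id: "P d (\<lambda>X. X)"
    and rev: "\<And>m Z. P m Z \<Longrightarrow> P m (\<lambda>X. reversal (Z X))"
    and Lam: "\<And>m e Z B. P m Z \<Longrightarrow> e \<ge> 1 \<Longrightarrow> regular_lin_map d (letters e) (T_ge1 m) B \<Longrightarrow>
        P e (\<lambda>X. Lambda e (B X) (Z X))"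
    and cong: "\<And>m Z Z'. P m Z \<Longrightarrow> (\<And>X. X \<in> paths d \<Longrightarrow> Z' X = Z X) \<Longrightarrow> P m Z'"
  shows "P t \<Psi>"
proof -
  obtain k n B s0 s1 where form: "Upsilon_form d t \<Psi> k n B s0 s1"
    using assms(1) Upsilon_maps_iff by blast
  have "P t (\<lambda>X. Lambda_chain n (\<lambda>i. B i X) ((reversal ^^ s0) X) k)"
    using Lambda_chain_induct(1)[OF form order_refl, of P] id rev Lam Upsilon_formD(5)[OF form] by simp
  then have "P t (\<lambda>X. (reversal ^^ s1) (Lambda_chain n (\<lambda>i. B i X) ((reversal ^^ s0) X) k))"
    using Upsilon_formD(2)[OF form] rev by auto
  then show ?thesis by (rule cong) (rule Upsilon_formD(7)[OF form])
qed

lemma Upsilon_family: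
  assumes "\<Psi> \<in> Upsilon_maps d t"
  shows "regular_family d t \<Psi>"
  using assms
  by (rule Upsilon_maps_induct)
    (blast intro: regular_family_id regular_family_reversal regular_family_Lambda regular_family_cong)+

lemma Upsilon_mapsI:
  assumes "Upsilon_form d t \<Psi> k n B s0 s1" "regular_family d t \<Psi>"
  shows "\<Psi> \<in> Upsilon_maps d t"
  using assms unfolding Upsilon_maps_iff regular_family_def by blast

lemma Upsilon_reversal:
  assumes \<Psi>: "\<Psi> \<in> Upsilon_maps d t"
  shows "(\<lambda>X. reversal (\<Psi> X)) \<in> Upsilon_maps d t"
proof -
  obtain k n B s0 s1 where form: "Upsilon_form d t \<Psi> k n B s0 s1"
    using \<Psi> Upsilon_maps_iff by blast
  have fam: "regular_family d t (\<lambda>X. Lambda_chain n (\<lambda>i. B i X) ((reversal ^^ s0) X) k)"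
    using Lambda_chain_induct(1)[OF form order_refl, of "regular_family d"]
      regular_family_id regular_family_reversal regular_family_Lambda Upsilon_formD(5)[OF form] by simp
  \<comment> \<open>The final reversal is switched on or, being an involution, cancelled.\<close>
  have "Upsilon_form d t (\<lambda>X. reversal (\<Psi> X)) k n B s0 (1 - s1)"
    using Upsilon_formD(2)[OF form]
  proof
    assume "s1 = 0" then show ?thesis using form by (simp add: Upsilon_form_def)
  next
    assume "s1 = 1" then show ?thesis
      using form reversal_reversal[OF regular_family_paths[OF fam]] by (simp add: Upsilon_form_def)
  qed
  then show ?thesis by (rule Upsilon_mapsI) (rule regular_family_reversal[OF Upsilon_family[OF \<Psi>]])
qed

text \<open>A chain alternates between \<Lambda> and reversal. A final reversal becomes an inner one
  and the new \<Lambda> is appended; otherwise the new \<Lambda> merges with the last one.\<close>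

lemma Upsilon_Lambda:
  assumes \<Psi>: "\<Psi> \<in> Upsilon_maps d m" and B': "regular_lin_map d (letters e) (T_ge1 m) B'" and e: "e \<ge> 1"
  shows "(\<lambda>X. Lambda e (B' X) (\<Psi> X)) \<in> Upsilon_maps d e"
proof -
  note fam = regular_family_Lambda[OF Upsilon_family[OF \<Psi>] B']
  obtain k n B s0 s1 where form: "Upsilon_form d m \<Psi> k n B s0 s1"
    using \<Psi> Upsilon_maps_iff by blast
  note f = Upsilon_formD[OF form]
  show ?thesis
  proof (cases k)
    case 0
    \<comment> \<open>In an empty chain both flags act on \<open>X\<close> itself, and only the
      parity of the reversals counts.\<close>
    define s where "s = (if s0 = s1 then 0 else 1 :: nat)"
    have dm: "d = m" using f(4,5) 0 by simp
    have "Upsilon_form d e (\<lambda>X. Lambda e (B' X) (\<Psi> X)) 1 (\<lambda>i. if i = 1 then d else e) (\<lambda>i. B') s 0"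
      unfolding Upsilon_form_def
    proof (intro conjI ballI)
      fix X assume X: "X \<in> paths d"
      have "\<Psi> X = (reversal ^^ s) X"
        using f(7)[OF X] f(1,2) reversal_reversal[OF X] 0 by (auto simp: s_def)
      then show "Lambda e (B' X) (\<Psi> X) = (reversal ^^ 0) (Lambda_chain (\<lambda>i. if i = 1 then d else e)
          (\<lambda>i. B' X) ((reversal ^^ s) X) 1)"
        using Lambda_chain_Suc[of "\<lambda>i. if i = 1 then d else e" "\<lambda>i. B' X" "(reversal ^^ s) X" 0]
        by (simp add: chain_arg_def)
    qed (use f(3)[of 1] f(4) B' e dm in \<open>auto simp: s_def\<close>)
    then show ?thesis using fam by (rule Upsilon_mapsI)
  next
    case (Suc j)
    show ?thesis using f(2)
    proof
      assume s1: "s1 = 1"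
      \<comment> \<open>The new map sits at position \<open>k + 1\<close>, its target dimension at
        \<open>k + 2\<close>; the former final reversal now precedes it.\<close>
      define n' where "n' = n(k + 2 := e)"
      define C where "C = B(k + 1 := B')"
      have "Upsilon_form d e (\<lambda>X. Lambda e (B' X) (\<Psi> X)) (Suc k) n' C s0 0"
        unfolding Upsilon_form_def
      proof (intro conjI ballI)
        fix i assume i: "i \<in> {1..Suc k + 1}"
        then show "1 \<le> n' i" using f(3)[of i] e by (cases "i = k + 2") (auto simp: n'_def)
      next
        fix i assume i: "i \<in> {1..Suc k}"
        show "regular_lin_map d (letters (n' (i + 1))) (T_ge1 (n' i)) (C i)"
          using i f(6)[of i] f(5) B' by (cases "i = k + 1") (auto simp: n'_def C_def)
      next
        fix X assume X: "X \<in> paths d"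
        have "Lambda_chain n' (\<lambda>i. C i X) ((reversal ^^ s0) X) k =
            Lambda_chain n (\<lambda>i. B i X) ((reversal ^^ s0) X) k"
          by (rule Lambda_chain_cong) (auto simp: n'_def C_def)
        then show "Lambda e (B' X) (\<Psi> X) =
            (reversal ^^ 0) (Lambda_chain n' (\<lambda>i. C i X) ((reversal ^^ s0) X) (Suc k))"
          using f(7)[OF X] Suc s1 by (simp add: Lambda_chain_Suc[of _ _ _ k] chain_arg_def n'_def C_def)
      qed (use f(1,4) in \<open>auto simp: n'_def\<close>)
      then show ?thesis using fam by (rule Upsilon_mapsI)
    next
      assume s1: "s1 = 0"
      \<comment> \<open>The chain keeps its length: only the last map and its target dimension
        change.\<close>
      define n' where "n' = n(k + 1 := e)"
      define C where "C = B(k := (\<lambda>X u. Lambda_hom (B k X) (B' X u)))"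
      have C: "regular_lin_map d (letters e) (T_ge1 (n k)) (C k)"
        using regular_lin_map_Lambda_hom[OF f(6)[of k], of e B'] B' Suc f(5) by (simp add: C_def)
      have "Upsilon_form d e (\<lambda>X. Lambda e (B' X) (\<Psi> X)) k n' C s0 0"
        unfolding Upsilon_form_def
      proof (intro conjI ballI)
        fix i assume i: "i \<in> {1..k + 1}"
        then show "1 \<le> n' i" using f(3)[of i] e by (cases "i = k + 1") (auto simp: n'_def)
      next
        fix i assume i: "i \<in> {1..k}"
        show "regular_lin_map d (letters (n' (i + 1))) (T_ge1 (n' i)) (C i)"
        proof (cases "i = k")
          case True then show ?thesis using C by (simp add: n'_def)
        next
          case False
          then show ?thesis using i f(6)[of i] by (simp add: n'_def C_def)
        qed
      next
        fix X assume X: "X \<in> paths d"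
        let ?W = "chain_arg n (\<lambda>i. B i X) ((reversal ^^ s0) X) j"
        have "regular_family d (n (j + 1)) (\<lambda>X. chain_arg n (\<lambda>i. B i X) ((reversal ^^ s0) X) j)"
          using Lambda_chain_induct(2)[OF form, of j "regular_family d"] Suc
            regular_family_id regular_family_reversal regular_family_Lambda by simp
        from regular_family_paths[OF this X] have W: "?W \<in> paths (n (j + 1))" .
        have eq: "Lambda_chain n' (\<lambda>i. C i X) ((reversal ^^ s0) X) j =
            Lambda_chain n (\<lambda>i. B i X) ((reversal ^^ s0) X) j"
          by (rule Lambda_chain_cong) (auto simp: n'_def C_def Suc)
        have "\<Psi> X = Lambda m (B (j + 1) X) ?W"
          using f(7)[OF X] f(5) Suc s1 by (simp add: Lambda_chain_Suc)
        then have "Lambda e (B' X) (\<Psi> X) = Lambda e (B' X) (Lambda m (B (j + 1) X) ?W)" by simp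
        also have "\<dots> = Lambda e (\<lambda>u. Lambda_hom (B (j + 1) X) (B' X u)) ?W"
          using regular_lin_mapD(2)[OF B' X] T_ge1_subset_T_alg by (intro Lambda_Lambda[OF W]) blast
        also have "\<dots> = Lambda_chain n' (\<lambda>i. C i X) ((reversal ^^ s0) X) (Suc j)"
          unfolding Lambda_chain_Suc using eq by (simp add: chain_arg_def n'_def C_def Suc)
        finally show "Lambda e (B' X) (\<Psi> X) =
            (reversal ^^ 0) (Lambda_chain n' (\<lambda>i. C i X) ((reversal ^^ s0) X) k)"
          by (simp add: Suc)
      qed (use f(1,4) Suc in \<open>auto simp: n'_def\<close>)
      then show ?thesis using fam by (rule Upsilon_mapsI)
    qed
  qed
qed

text \<open>Growing by one member of \<Upsilon> and one fixed block at a time replaces the numbered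
  blocks of \<open>Gamma_concat\<close>, so that closure properties are inductions.\<close>

inductive Gamma_form :: "nat \<Rightarrow> nat \<Rightarrow> (path \<Rightarrow> path) \<Rightarrow> bool" for d t where
  base: "fixed_block d t F \<Longrightarrow> Gamma_form d t F"
| step: "Gamma_form d t F \<Longrightarrow> \<Psi> \<in> Upsilon_maps d t \<Longrightarrow> fixed_block d t D \<Longrightarrow>
    (\<And>X. X \<in> paths d \<Longrightarrow> G X = F X \<squnion>\<^sub>p \<Psi> X \<squnion>\<^sub>p D X) \<Longrightarrow> Gamma_form d t G"

section \<open>Stability of \<Gamma> under concatenation, reversal, \<Lambda> and
  composition\<close>

lemma Gamma_form_cong:
  assumes "Gamma_form d t F" "\<And>X. X \<in> paths d \<Longrightarrow> G X = F X"
  shows "Gamma_form d t G"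
  using assms
proof (induction arbitrary: G rule: Gamma_form.induct)
  case (base F) then show ?case by (intro Gamma_form.base fixed_block_cong[OF base(1)])
next
  case (step F \<Psi> D F') then show ?case by (intro Gamma_form.step[OF step(1-3)]) simp
qed

lemma Gamma_form_family:
  assumes "Gamma_form d t F"
  shows "regular_family d t F"
  using assms
proof (induction rule: Gamma_form.induct)
  case (base F) then show ?case by (rule fixed_block_family)
next
  case (step F \<Psi> D G)
  from regular_family_concat[OF regular_family_concat[OF step(5) Upsilon_family[OF step(2)]]
      fixed_block_family[OF step(3)]]
  show ?case by (rule regular_family_cong) (rule step(4))
qed

text \<open>The form leaves no room for two adjacent fixed blocks, so the last one absorbs
  \<open>D\<close>.\<close>

lemma Gamma_form_concat_block:
  assumes "Gamma_form d t F" "fixed_block d t D"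
  shows "Gamma_form d t (\<lambda>X. F X \<squnion>\<^sub>p D X)"
  using assms(1)
proof cases
  case base then show ?thesis by (intro Gamma_form.base fixed_block_concat assms(2))
next
  case (step F' \<Psi> D')
  show ?thesis
  proof (rule Gamma_form.step[OF step(1,2) fixed_block_concat[OF step(3) assms(2)]])
    fix X assume X: "X \<in> paths d"
    note p = regular_family_paths[OF _ X]
    show "F X \<squnion>\<^sub>p D X = F' X \<squnion>\<^sub>p \<Psi> X \<squnion>\<^sub>p (D' X \<squnion>\<^sub>p D X)"
      unfolding step(4)[OF X]
      by (intro concat_assoc[of _ t] concat_in_paths p[OF Gamma_form_family[OF step(1)]]
          p[OF Upsilon_family[OF step(2)]] p[OF fixed_block_family[OF step(3)]]
          p[OF fixed_block_family[OF assms(2)]])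
  qed
qed

lemma Gamma_form_concat:
  assumes F: "Gamma_form d t F" and G: "Gamma_form d t G"
  shows "Gamma_form d t (\<lambda>X. F X \<squnion>\<^sub>p G X)"
  using G
proof (induction rule: Gamma_form.induct)
  case (base D) then show ?case by (rule Gamma_form_concat_block[OF F])
next
  case (step G \<Psi> D G')
  show ?case
  proof (rule Gamma_form.step[OF step(5,2,3)])
    fix X assume X: "X \<in> paths d"
    note p = regular_family_paths[OF _ X]
    have m: "F X \<in> paths t" "G X \<in> paths t" "\<Psi> X \<in> paths t" "D X \<in> paths t"
      using p[OF Gamma_form_family[OF F]] p[OF Gamma_form_family[OF step(1)]]
        p[OF Upsilon_family[OF step(2)]] p[OF fixed_block_family[OF step(3)]] by auto
    show "F X \<squnion>\<^sub>p G' X = F X \<squnion>\<^sub>p G X \<squnion>\<^sub>p \<Psi> X \<squnion>\<^sub>p D X"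
      unfolding step(4)[OF X] concat_assoc[OF m(1,2,3)]
      by (rule concat_assoc[OF m(1) concat_in_paths[OF m(2,3)] m(4), symmetric])
  qed
qed

text \<open>Members of \<Gamma> begin and end with fixed blocks, so a member of \<Upsilon> can be
  inserted between two of them without any merging.\<close>

lemma Gamma_form_Upsilon_between:
  assumes F: "Gamma_form d t F" and \<Psi>: "\<Psi> \<in> Upsilon_maps d t" and G: "Gamma_form d t G"
  shows "Gamma_form d t (\<lambda>X. F X \<squnion>\<^sub>p \<Psi> X \<squnion>\<^sub>p G X)"
  using G
proof (induction rule: Gamma_form.induct)
  case (base D) then show ?case by (intro Gamma_form.step[OF F \<Psi> base]) simp
next
  case (step G \<Phi> D G')
  show ?case
  proof (rule Gamma_form.step[OF step(5,2,3)])
    fix X assume X: "X \<in> paths d"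
    note p = regular_family_paths[OF _ X]
    have m: "F X \<in> paths t" "\<Psi> X \<in> paths t" "G X \<in> paths t" "\<Phi> X \<in> paths t" "D X \<in> paths t"
      using p[OF Gamma_form_family[OF F]] p[OF Gamma_form_family[OF step(1)]] p[OF Upsilon_family[OF \<Psi>]]
        p[OF Upsilon_family[OF step(2)]] p[OF fixed_block_family[OF step(3)]] by auto
    note FP = concat_in_paths[OF m(1,2)]
    show "F X \<squnion>\<^sub>p \<Psi> X \<squnion>\<^sub>p G' X = F X \<squnion>\<^sub>p \<Psi> X \<squnion>\<^sub>p G X \<squnion>\<^sub>p \<Phi> X \<squnion>\<^sub>p D X"
      unfolding step(4)[OF X] concat_assoc[OF FP m(3,4)]
      by (rule concat_assoc[OF FP concat_in_paths[OF m(3,4)] m(5), symmetric])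
  qed
qed

text \<open>Reversal acts on each block and turns their order around; the last fixed block comes to
  the front, so blocks have to be added on the left.\<close>

lemma Gamma_form_reversal:
  assumes "Gamma_form d t F"
  shows "Gamma_form d t (\<lambda>X. reversal (F X))"
  using assms
proof (induction rule: Gamma_form.induct)
  case (base D) then show ?case by (intro Gamma_form.base fixed_block_reversal)
next
  case (step F \<Psi> D G)
  from Gamma_form_Upsilon_between[OF Gamma_form.base[OF fixed_block_reversal[OF step(3)]]
      Upsilon_reversal[OF step(2)] step(5)]
  show ?case
  proof (rule Gamma_form_cong)
    fix X assume X: "X \<in> paths d"
    note p = regular_family_paths[OF _ X]
    have m: "F X \<in> paths t" "\<Psi> X \<in> paths t" "D X \<in> paths t"
      using p[OF Gamma_form_family[OF step(1)]]
        p[OF Upsilon_family[OF step(2)]] p[OF fixed_block_family[OF step(3)]] by auto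
    show "reversal (G X) = reversal (D X) \<squnion>\<^sub>p reversal (\<Psi> X) \<squnion>\<^sub>p reversal (F X)"
      unfolding step(4)[OF X] reversal_concat[OF concat_in_paths[OF m(1,2)] m(3)] reversal_concat[OF m(1,2)]
      by (rule concat_assoc[OF m(3,2,1)[THEN reversal_in_paths], symmetric])
  qed
qed

text \<open>Each later block meets \<open>B X\<close> chopped by the signature of all blocks before
  it. These blocks are regular in \<open>X\<close>, so the chopped map is again an admissible
  coefficient.\<close>

lemma Gamma_form_Lambda:
  assumes F: "Gamma_form d m F" and e: "e \<ge> 1" and B: "regular_lin_map d (letters e) (T_ge1 m) B"
  shows "Gamma_form d e (\<lambda>X. Lambda e (B X) (F X))"
  using F
proof (induction rule: Gamma_form.induct)
  case (base D) then show ?case by (rule Gamma_form.base[OF fixed_block_Lambda[OF _ B e]])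
next
  case (step F \<Psi> D G)
  note fam = Gamma_form_family[OF step(1)] Upsilon_family[OF step(2)] fixed_block_family[OF step(3)]
  note fam2 = regular_family_concat[OF fam(1,2)]
  show ?case
  proof (rule Gamma_form.step[OF step(5)
        Upsilon_Lambda[OF step(2) regular_lin_map_chop[OF fam(1) B] e]
        fixed_block_Lambda[OF step(3) regular_lin_map_chop[OF fam2 B] e]])
    fix X assume X: "X \<in> paths d"
    have m: "F X \<in> paths m" "\<Psi> X \<in> paths m" "D X \<in> paths m"
      using regular_family_paths[OF _ X] fam by auto
    have b: "B X (word [i]) \<in> T_alg m" if "i \<in> {1..e}" for i
      using regular_lin_mapD(2)[OF B X that] T_ge1_subset_T_alg by blast
    have 1: "Lambda e (B X) (F X \<squnion>\<^sub>p \<Psi> X \<squnion>\<^sub>p D X) =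
        Lambda e (B X) (F X \<squnion>\<^sub>p \<Psi> X) \<squnion>\<^sub>p Lambda e (\<lambda>u. chop (F X \<squnion>\<^sub>p \<Psi> X) (B X u)) (D X)"
      by (rule Lambda_concat[OF concat_in_paths[OF m(1,2)] m(3)]) (rule b)
    have 2: "Lambda e (B X) (F X \<squnion>\<^sub>p \<Psi> X) =
        Lambda e (B X) (F X) \<squnion>\<^sub>p Lambda e (\<lambda>u. chop (F X) (B X u)) (\<Psi> X)"
      by (rule Lambda_concat[OF m(1,2)]) (rule b)
    show "Lambda e (B X) (G X) = Lambda e (B X) (F X) \<squnion>\<^sub>p
        Lambda e (\<lambda>u. chop (F X) (B X u)) (\<Psi> X) \<squnion>\<^sub>p
        Lambda e (\<lambda>u. chop (F X \<squnion>\<^sub>p \<Psi> X) (B X u)) (D X)"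
      unfolding step(4)[OF X]
      by (simp only: 1 2)
  qed
qed

text \<open>Induction runs over the structure of \<Phi>, not of \<open>F\<close>: every stage of the
  chain, applied to \<open>F\<close>, is again in \<Gamma>. The coefficients \<open>B (F X)\<close>
  stay regular because \<open>F\<close> is regular.\<close>

lemma Gamma_form_Upsilon_comp:
  assumes \<Phi>: "\<Phi> \<in> Upsilon_maps t e" and F: "Gamma_form d t F"
  shows "Gamma_form d e (\<lambda>X. \<Phi> (F X))"
  using \<Phi>
proof (rule Upsilon_maps_induct[where P = "\<lambda>m Z. Gamma_form d m (\<lambda>X. Z (F X))"])
  note Fp = regular_family_paths[OF Gamma_form_family[OF F]]
  show "Gamma_form d t (\<lambda>X. F X)" by (rule F)
  show "Gamma_form d m (\<lambda>X. reversal (Z (F X)))" if "Gamma_form d m (\<lambda>X. Z (F X))" for m Z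
    using that by (rule Gamma_form_reversal)
  show "Gamma_form d e' (\<lambda>X. Lambda e' (B (F X)) (Z (F X)))"
    if "Gamma_form d m (\<lambda>X. Z (F X))" "e' \<ge> 1" "regular_lin_map t (letters e') (T_ge1 m) B" for m e' Z B
    by (rule Gamma_form_Lambda[OF that(1,2)
          regular_lin_map_compose[OF that(3) Gamma_form_family[OF F] subspace_T_ge1]])
  show "Gamma_form d m (\<lambda>X. Z' (F X))"
    if "Gamma_form d m (\<lambda>X. Z (F X))" "\<And>X. X \<in> paths t \<Longrightarrow> Z' X = Z X" for m Z Z'
    using that(1) by (rule Gamma_form_cong) (rule that(2)[OF Fp])
qed

text \<open>Every block of \<open>G\<close>, composed with \<open>F\<close>, is itself in \<Gamma>;
  concatenating them merges the fixed blocks at the seams.\<close>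

lemma Gamma_form_comp:
  assumes G: "Gamma_form t e G" and F: "Gamma_form d t F"
  shows "Gamma_form d e (\<lambda>X. G (F X))"
proof -
  note Fp = regular_family_paths[OF Gamma_form_family[OF F]]
  \<comment> \<open>The fixed path stays the same; only its coefficient map is composed with
    \<open>F\<close>.\<close>
  have block: "fixed_block d e (\<lambda>X. D (F X))" if D': "fixed_block t e D" for D
  proof -
    obtain n Y A where D: "n \<ge> 1" "Y \<in> paths n" "regular_lin_map t (letters e) (letters n) A"
      "\<And>X. X \<in> paths t \<Longrightarrow> D X = Lambda e (A X) Y"
      by (rule fixed_blockE[OF D']) blast
    show ?thesis
      by (rule fixed_blockI[OF D(1,2) regular_lin_map_compose[OF D(3) Gamma_form_family[OF F] subspace_letters]])
        (rule D(4)[OF Fp])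
  qed
  show ?thesis using G
  proof (induction rule: Gamma_form.induct)
    case (base D) then show ?case by (intro Gamma_form.base block)
  next
    case (step G \<Phi> D H)
    from Gamma_form_concat[OF Gamma_form_concat[OF step(5) Gamma_form_Upsilon_comp[OF step(2) F]]
        Gamma_form.base[OF block[OF step(3)]]]
    show ?case by (rule Gamma_form_cong) (rule step(4)[OF Fp])
  qed
qed

lemma Gamma_concat_cong:
  "(\<And>i. i \<in> {1..k+1} \<Longrightarrow> A i = A' i \<and> Y i = Y' i) \<Longrightarrow> (\<And>i. i \<in> {1..k} \<Longrightarrow> \<Psi> i = \<Psi>' i) \<Longrightarrow>
    Gamma_concat t A Y \<Psi> X k = Gamma_concat t A' Y' \<Psi>' X k"
  by (induction k) auto

lemma Gamma_maps_iff: "F \<in> Gamma_maps d t \<longleftrightarrow> Gamma_form d t F"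
proof
  assume "F \<in> Gamma_maps d t"
  then obtain k n Y A \<Psi> where
    blk: "\<And>i. i \<in> {1..k+1} \<Longrightarrow> n i \<ge> 1 \<and> Y i \<in> paths (n i) \<and>
         regular_lin_map d (letters t) (letters (n i)) (A i)" and
    ups: "\<And>i. i \<in> {1..k} \<Longrightarrow> \<Psi> i \<in> Upsilon_maps d t" and
    F: "\<And>X. X \<in> paths d \<Longrightarrow> F X = Gamma_concat t A Y \<Psi> X k"
    unfolding Gamma_maps_def by blast
  have "Gamma_form d t (\<lambda>X. Gamma_concat t A Y \<Psi> X j)" if "j \<le> k" for j
    using that
  proof (induction j)
    case 0
    have "fixed_block d t (\<lambda>X. Lambda t (A 1 X) (Y 1))"
      using blk[of 1] by (intro fixed_blockI[of "n 1"]) auto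
    then show ?case by (intro Gamma_form.base) simp
  next
    case (Suc j)
    have D: "fixed_block d t (\<lambda>X. Lambda t (A (j + 2) X) (Y (j + 2)))"
      using blk[of "j + 2"] Suc by (intro fixed_blockI[of "n (j + 2)"]) auto
    have "Gamma_form d t (\<lambda>X. Gamma_concat t A Y \<Psi> X j)" "\<Psi> (j + 1) \<in> Upsilon_maps d t"
      using Suc ups[of "j + 1"] by auto
    from Gamma_form.step[OF this D] show ?case by simp
  qed
  from Gamma_form_cong[OF this[OF order_refl] F] show "Gamma_form d t F" .
next
  assume G: "Gamma_form d t F"
  define Q where "Q F k n Y A \<Psi> \<longleftrightarrow> (\<forall>i\<in>{1..k+1}. n i \<ge> 1 \<and> Y i \<in> paths (n i) \<and>
         regular_lin_map d (letters t) (letters (n i)) (A i)) \<and>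
      (\<forall>i\<in>{1..k}. \<Psi> i \<in> Upsilon_maps d t) \<and>
      (\<forall>X\<in>paths d. F X = Gamma_concat t A Y \<Psi> X k)" for F and k :: nat and n Y A \<Psi>
  have "\<exists>k n Y A \<Psi>. Q F k n Y A \<Psi>" using G
  proof (induction rule: Gamma_form.induct)
    case (base D)
    obtain n Y A where D: "n \<ge> 1" "Y \<in> paths n" "regular_lin_map d (letters t) (letters n) A"
      "\<And>X. X \<in> paths d \<Longrightarrow> D X = Lambda t (A X) Y"
      by (rule fixed_blockE[OF base]) blast
    have "Q D 0 (\<lambda>i. n) (\<lambda>i. Y) (\<lambda>i. A) (\<lambda>i X. X)" using D by (simp add: Q_def)
    then show ?case by blast
  next
    case (step F \<Psi>0 D G)
    obtain m Y0 A0 where D: "m \<ge> 1" "Y0 \<in> paths m" "regular_lin_map d (letters t) (letters m) A0"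
      "\<And>X. X \<in> paths d \<Longrightarrow> D X = Lambda t (A0 X) Y0"
      by (rule fixed_blockE[OF step(3)]) blast
    obtain k n Y A \<Psi> where "Q F k n Y A \<Psi>" using step(5) by blast
    then have F: "\<And>i. i \<in> {1..k+1} \<Longrightarrow> n i \<ge> 1 \<and> Y i \<in> paths (n i) \<and>
         regular_lin_map d (letters t) (letters (n i)) (A i)"
      "\<And>i. i \<in> {1..k} \<Longrightarrow> \<Psi> i \<in> Upsilon_maps d t"
      "\<And>X. X \<in> paths d \<Longrightarrow> F X = Gamma_concat t A Y \<Psi> X k" unfolding Q_def by blast+
    \<comment> \<open>Stage \<open>Suc k\<close> of \<open>Gamma_concat\<close> uses block
      \<open>k + 2\<close> and connecting map \<open>k + 1\<close>; the updates leave earlier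
      entries alone.\<close>
    have "Q G (Suc k) (n(k + 2 := m)) (Y(k + 2 := Y0)) (A(k + 2 := A0)) (\<Psi>(k + 1 := \<Psi>0))"
      unfolding Q_def
    proof (intro conjI ballI)
      fix i assume "i \<in> {1..Suc k + 1}"
      then have "i = k + 2 \<or> i \<in> {1..k+1}" by auto
      then show "1 \<le> (n(k + 2 := m)) i" "(Y(k + 2 := Y0)) i \<in> paths ((n(k + 2 := m)) i)"
        "regular_lin_map d (letters t) (letters ((n(k + 2 := m)) i)) ((A(k + 2 := A0)) i)"
        using D(1-3) F(1)[of i] by auto
    next
      fix i assume "i \<in> {1..Suc k}"
      then have "i = k + 1 \<or> i \<in> {1..k}" by auto
      then show "(\<Psi>(k + 1 := \<Psi>0)) i \<in> Upsilon_maps d t" using F(2)[of i] step(2) by auto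
    next
      fix X assume X: "X \<in> paths d"
      have "Gamma_concat t (A(k + 2 := A0)) (Y(k + 2 := Y0)) (\<Psi>(k + 1 := \<Psi>0)) X k =
          Gamma_concat t A Y \<Psi> X k"
        by (rule Gamma_concat_cong) auto
      then show "G X = Gamma_concat t (A(k + 2 := A0)) (Y(k + 2 := Y0)) (\<Psi>(k + 1 := \<Psi>0)) X (Suc k)"
        using step(4)[OF X] F(3)[OF X] D(4)[OF X] by simp
    qed
    then show ?case by blast
  qed
  then show "F \<in> Gamma_maps d t"
    using Gamma_form_family[OF G] unfolding Gamma_maps_def Q_def regular_family_def by blast
qed

theorem theorem8p15:
  shows "(\<forall>d t F. d \<ge> 1 \<and> t \<ge> 1 \<and> F \<in> Gamma_maps d t \<longrightarrow> regular_path_map d t F) \<and>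
    (\<forall>d t e F G. d \<ge> 1 \<and> t \<ge> 1 \<and> e \<ge> 1 \<and> F \<in> Gamma_maps d t \<and> G \<in> Gamma_maps t e
       \<longrightarrow> G \<circ> F \<in> Gamma_maps d e)"
  unfolding Gamma_maps_iff o_def
  using regular_family_imp_regular_path_map[OF _ Gamma_form_family] Gamma_form_comp by blast

end
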